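(* Let $\gamma_\Omega\in(0,1]$ be the number depending only on $\Omega$ described in the context and let $0<\gamma<\gamma_\Omega$. Let the nonlinearity $d\colon\Omega\times\mathbb{R}\to\mathbb{R}$ satisfy (A1), (A2), (A3). Let $f\in L^\infty(\Omega)$, let $u\in H^1_0(\Omega)\cap C_0(\Omega)$ be the weak solution of $-\Delta u+d(\cdot,u)=f$ in $\Omega$, $u=0$ on $\partial\Omega$, and let $u_h\in V_h$ be its finite element approximation. Then there holds $$\|u-u_h\|_{L^\infty(\Omega)}\le c\,h^{1+\gamma}\,|\ln h|,$$ where the constant $c$ depends on the nonlinearity $d$ and on $\|f\|_{L^\infty(\Omega)}$ and is independent of $h$.
   Context: $\Omega\subset\mathbb{R}^N$, $N\in\{2,3\}$, is a (bounded) convex polygonal ($N=2$) or polyhedral ($N=3$) domain. $C_0(\Omega)$ is the space of continuous functions on $\bar\Omega$ vanishing on $\partial\Omega$. $(\cdot,\cdot)$ is the $L^2(\Omega)$ inner product (duality pairing), and $d(v)$ denotes the function $x\mapsto d(x,v(x))$. Assumptions on $d$: (A1) for every $u_0\in\mathbb{R}$, $d(\cdot,u_0)\in L^\infty(\Omega)$; (A2) for almost all $x\in\Omega$, $d(x,\cdot)\colon\mathbb{R}\to\mathbb{R}$ is monotonically non-decreasing; (A3) for every $u_0\in\mathbb{R}$ and every $\varepsilon>0$ there is $\delta>0$ such that $|d(x,u)-d(x,u_0)|<\varepsilon$ for all $u\in\mathbb{R}$ with $|u-u_0|<\delta$ and for almost all $x\in\Omega$. The weak solution $u$ satisfies $(\nabla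 u,\nabla\varphi)+(d(u),\varphi)=(f,\varphi)$ for all $\varphi\in H^1_0(\Omega)$; it exists and is unique. $\{\mathcal{T}_h\}$ is a family of shape-regular, quasi-uniform (simplicial) meshes of $\Omega$ with mesh size $0<h\le h_{\max}$, where $h_{\max}<1$ is fixed, and $V_h\subset H^1_0(\Omega)\cap C(\bar\Omega)$ is the space of linear finite elements (continuous, piecewise linear, vanishing on $\partial\Omega$) on $\mathcal{T}_h$. The finite element approximation $u_h\in V_h$ is the unique solution of $(\nabla u_h,\nabla\varphi_h)+(d(u_h),\varphi_h)=(f,\varphi_h)$ for all $\varphi_h\in V_h$. The Ritz projection $R_h\colon W^{1,1}_0(\Omega)\to V_h$ is defined by $(\nabla(v-R_hv),\nabla\varphi_h)=0$ for all $\varphi_h\in V_h$. The number $\gamma_\Omega\in(0,1]$, depending only on $\Omega$, is one with the following property (such a number exists): there is a constant $c>0$ such that for every $0<\gamma<\gamma_\Omega$ and every $v\in H^1_0(\Omega)$ with $\Delta v\in L^\infty(\Omega)$ there holds $\|v-R_hv\|_{L^\infty(\Omega)}\le c\,h^{1+\gamma}|\ln h|\,\|\Delta v\|_{L^\infty(\Omega)}$. Constants may also depend on $\Omega$, $\gamma$, $h_{\max}$ and on the shape-regularity and quasi-uniformity constants of the mesh family. *)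

theory Defs
  imports "HOL-Analysis.Analysis" "HOL-Probability.Essential_Supremum"
begin

section \<open>Function spaces on an open set\<close>

text \<open>
  Functions on \<open>\<Omega>\<close> are represented by total functions; every notion below depends only on the
  values on \<open>\<Omega>\<close> (Lebesgue notions) or on its closure (notions involving continuity).
\<close>

definition L2 :: "'a::euclidean_space set \<Rightarrow> ('a \<Rightarrow> 'b::euclidean_space) set" where
  "L2 \<Omega> = {f. f \<in> borel_measurable (lebesgue_on \<Omega>) \<and>
              integrable (lebesgue_on \<Omega>) (\<lambda>x. (norm (f x))\<^sup>2)}"

definition L2_inner ::
    "'a::euclidean_space set \<Rightarrow> ('a \<Rightarrow> 'b::euclidean_space) \<Rightarrow> ('a \<Rightarrow> 'b) \<Rightarrow> real" where
  "L2_inner \<Omega> f g = (LINT x|lebesgue_on \<Omega>. f x \<bullet> g x)"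

text \<open>The norm of \<open>L\<^sup>\<infinity>(\<Omega>)\<close> is extended-real valued, so that an inequality
  bounding it by a real number includes essential boundedness.\<close>

definition Linf_norm :: "'a::euclidean_space set \<Rightarrow> ('a \<Rightarrow> real) \<Rightarrow> ereal" where
  "Linf_norm \<Omega> f = esssup (lebesgue_on \<Omega>) (\<lambda>x. ereal \<bar>f x\<bar>)"

definition Linf :: "'a::euclidean_space set \<Rightarrow> ('a \<Rightarrow> real) set" where
  "Linf \<Omega> = {f. f \<in> borel_measurable (lebesgue_on \<Omega>) \<and> Linf_norm \<Omega> f < \<infinity>}"

definition C0 :: "'a::euclidean_space set \<Rightarrow> ('a \<Rightarrow> real) set" where
  "C0 \<Omega> = {v. continuous_on (closure \<Omega>) v \<and> (\<forall>x\<in>frontier \<Omega>. v x = 0)}"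

primrec Ck :: "nat \<Rightarrow> ('a::euclidean_space \<Rightarrow> real) \<Rightarrow> bool" where
  "Ck 0 f \<longleftrightarrow> continuous_on UNIV f"
| "Ck (Suc k) f \<longleftrightarrow> (\<forall>x. f differentiable (at x)) \<and>
     (\<forall>b\<in>Basis. Ck k (\<lambda>x. frechet_derivative f (at x) b))"

definition test_functions :: "'a::euclidean_space set \<Rightarrow> ('a \<Rightarrow> real) set" where
  "test_functions \<Omega> =
     {\<phi>. (\<forall>k. Ck k \<phi>) \<and> compact (closure {x. \<phi> x \<noteq> 0}) \<and> closure {x. \<phi> x \<noteq> 0} \<subseteq> \<Omega>}"

definition grad :: "('a::euclidean_space \<Rightarrow> real) \<Rightarrow> 'a \<Rightarrow> 'a" where
  "grad f x = (\<Sum>b\<in>Basis. frechet_derivative f (at x) b *\<^sub>R b)"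

definition locally_integrable ::
    "'a::euclidean_space set \<Rightarrow> ('a \<Rightarrow> 'b::euclidean_space) \<Rightarrow> bool" where
  "locally_integrable \<Omega> f \<longleftrightarrow> (\<forall>K. compact K \<and> K \<subseteq> \<Omega> \<longrightarrow> integrable (lebesgue_on K) f)"

definition has_weak_gradient ::
    "'a::euclidean_space set \<Rightarrow> ('a \<Rightarrow> real) \<Rightarrow> ('a \<Rightarrow> 'a) \<Rightarrow> bool" where
  "has_weak_gradient \<Omega> v g \<longleftrightarrow> locally_integrable \<Omega> v \<and> locally_integrable \<Omega> g \<and>
     (\<forall>\<phi>\<in>test_functions \<Omega>.
        (LINT x|lebesgue_on \<Omega>. v x *\<^sub>R grad \<phi> x) = - (LINT x|lebesgue_on \<Omega>. \<phi> x *\<^sub>R g x))"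

text \<open>A representative of the weak gradient, which is unique up to null sets if it exists.\<close>

definition weak_grad :: "'a::euclidean_space set \<Rightarrow> ('a \<Rightarrow> real) \<Rightarrow> 'a \<Rightarrow> 'a" where
  "weak_grad \<Omega> v = (SOME g. has_weak_gradient \<Omega> v g)"

definition H1 :: "'a::euclidean_space set \<Rightarrow> ('a \<Rightarrow> real) set" where
  "H1 \<Omega> = {v. v \<in> L2 \<Omega> \<and> (\<exists>g. has_weak_gradient \<Omega> v g) \<and> weak_grad \<Omega> v \<in> L2 \<Omega>}"

text \<open>The closure of the test functions in the norm of \<open>H1 \<Omega>\<close>.\<close>

definition H10 :: "'a::euclidean_space set \<Rightarrow> ('a \<Rightarrow> real) set" where
  "H10 \<Omega> = {v\<in>H1 \<Omega>. \<exists>\<phi>. (\<forall>n::nat. \<phi> n \<in> test_functions \<Omega>) \<and>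
     (\<lambda>n. LINT x|lebesgue_on \<Omega>. (v x - \<phi> n x)\<^sup>2) \<longlonglongrightarrow> 0 \<and>
     (\<lambda>n. LINT x|lebesgue_on \<Omega>. (norm (weak_grad \<Omega> v x - grad (\<phi> n) x))\<^sup>2) \<longlonglongrightarrow> 0}"

text \<open>\<open>w\<close> represents the distributional Laplacian of \<open>v \<in> H1 \<Omega>\<close>.\<close>

definition has_weak_laplacian ::
    "'a::euclidean_space set \<Rightarrow> ('a \<Rightarrow> real) \<Rightarrow> ('a \<Rightarrow> real) \<Rightarrow> bool" where
  "has_weak_laplacian \<Omega> v w \<longleftrightarrow> locally_integrable \<Omega> w \<and>
     (\<forall>\<phi>\<in>test_functions \<Omega>.
        L2_inner \<Omega> w \<phi> = - L2_inner \<Omega> (weak_grad \<Omega> v) (grad \<phi>))"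


section \<open>Domains and meshes\<close>

definition convex_polytopal_domain :: "'a::euclidean_space set \<Rightarrow> bool" where
  "convex_polytopal_domain \<Omega> \<longleftrightarrow> open \<Omega> \<and> \<Omega> \<noteq> {} \<and> convex \<Omega> \<and> polytope (closure \<Omega>)"

text \<open>A mesh is the set of its closed cells. The library predicate \<open>triangulation\<close> expresses
  finiteness and conformity (two cells meet in a common, possibly empty, face).\<close>

definition simplicial_mesh :: "'a::euclidean_space set \<Rightarrow> 'a set set \<Rightarrow> bool" where
  "simplicial_mesh \<Omega> \<T> \<longleftrightarrow> triangulation \<T> \<and>
     (\<forall>K\<in>\<T>. int DIM('a) simplex K) \<and> \<Union>\<T> = closure \<Omega>"

definition mesh_size :: "'a::euclidean_space set set \<Rightarrow> real" where
  "mesh_size \<T> = Max (diameter ` \<T>)"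

definition inball_diameter :: "'a::euclidean_space set \<Rightarrow> real" where
  "inball_diameter K = Sup {2 * r | r. 0 \<le> r \<and> (\<exists>x. cball x r \<subseteq> K)}"

definition shape_regular :: "real \<Rightarrow> 'a::euclidean_space set set \<Rightarrow> bool" where
  "shape_regular \<sigma> \<T> \<longleftrightarrow> (\<forall>K\<in>\<T>. diameter K \<le> \<sigma> * inball_diameter K)"

definition quasi_uniform :: "real \<Rightarrow> 'a::euclidean_space set set \<Rightarrow> bool" where
  "quasi_uniform \<kappa> \<T> \<longleftrightarrow> (\<forall>K\<in>\<T>. mesh_size \<T> \<le> \<kappa> * diameter K)"

text \<open>The largest family of meshes of \<open>\<Omega>\<close> with the given mesh size bound, shape-regularity
  constant and quasi-uniformity constant. An estimate that is uniform over it is an estimate for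
  every shape-regular, quasi-uniform family whose constant depends on the family only through
  these three numbers.\<close>

definition mesh_family ::
    "'a::euclidean_space set \<Rightarrow> real \<Rightarrow> real \<Rightarrow> real \<Rightarrow> 'a set set set" where
  "mesh_family \<Omega> h_max \<sigma> \<kappa> = {\<T>. simplicial_mesh \<Omega> \<T> \<and> mesh_size \<T> \<le> h_max \<and>
     shape_regular \<sigma> \<T> \<and> quasi_uniform \<kappa> \<T>}"

definition Vh :: "'a::euclidean_space set \<Rightarrow> 'a set set \<Rightarrow> ('a \<Rightarrow> real) set" where
  "Vh \<Omega> \<T> = {v. v \<in> H10 \<Omega> \<and> v \<in> C0 \<Omega> \<and> (\<forall>K\<in>\<T>. \<exists>a b. \<forall>x\<in>K. v x = a \<bullet> x + b)}"


section \<open>Ritz projection\<close>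

text \<open>\<open>r\<close> is the Ritz projection of \<open>v\<close>; it is determined on the closure of \<open>\<Omega>\<close>.\<close>

definition is_ritz_projection ::
    "'a::euclidean_space set \<Rightarrow> 'a set set \<Rightarrow> ('a \<Rightarrow> real) \<Rightarrow> ('a \<Rightarrow> real) \<Rightarrow> bool" where
  "is_ritz_projection \<Omega> \<T> v r \<longleftrightarrow> r \<in> Vh \<Omega> \<T> \<and>
     (\<forall>\<phi>\<in>Vh \<Omega> \<T>. L2_inner \<Omega> (weak_grad \<Omega> (\<lambda>x. v x - r x)) (weak_grad \<Omega> \<phi>) = 0)"

text \<open>The characterizing property of the exponent \<open>\<gamma>\<^sub>\<Omega>\<close>. It refers to \<open>\<Omega>\<close> only; the constant of
  the Ritz projection estimate may depend on \<open>\<gamma>\<close>, \<open>h_max\<close> and on the constants of the meshes.\<close>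

definition ritz_exponent :: "'a::euclidean_space set \<Rightarrow> real \<Rightarrow> bool" where
  "ritz_exponent \<Omega> \<gamma>\<^sub>\<Omega> \<longleftrightarrow> 0 < \<gamma>\<^sub>\<Omega> \<and> \<gamma>\<^sub>\<Omega> \<le> 1 \<and>
     (\<forall>h_max \<sigma> \<kappa> \<gamma>. 0 < h_max \<and> h_max < 1 \<and> 0 < \<gamma> \<and> \<gamma> < \<gamma>\<^sub>\<Omega> \<longrightarrow>
       (\<exists>c>0. \<forall>\<T>\<in>mesh_family \<Omega> h_max \<sigma> \<kappa>. \<forall>v\<in>H10 \<Omega>. \<forall>w\<in>Linf \<Omega>. \<forall>r.
          has_weak_laplacian \<Omega> v w \<and> is_ritz_projection \<Omega> \<T> v r \<longrightarrow>
          Linf_norm \<Omega> (\<lambda>x. v x - r x)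
            \<le> ereal (c * mesh_size \<T> powr (1 + \<gamma>) * \<bar>ln (mesh_size \<T>)\<bar>) * Linf_norm \<Omega> w))"


section \<open>The semilinear problem\<close>

definition assm_A1 :: "'a::euclidean_space set \<Rightarrow> ('a \<Rightarrow> real \<Rightarrow> real) \<Rightarrow> bool" where
  "assm_A1 \<Omega> d \<longleftrightarrow> (\<forall>u\<^sub>0. (\<lambda>x. d x u\<^sub>0) \<in> Linf \<Omega>)"

definition assm_A2 :: "'a::euclidean_space set \<Rightarrow> ('a \<Rightarrow> real \<Rightarrow> real) \<Rightarrow> bool" where
  "assm_A2 \<Omega> d \<longleftrightarrow> (AE x in lebesgue_on \<Omega>. mono (d x))"

definition assm_A3 :: "'a::euclidean_space set \<Rightarrow> ('a \<Rightarrow> real \<Rightarrow> real) \<Rightarrow> bool" where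
  "assm_A3 \<Omega> d \<longleftrightarrow> (\<forall>u\<^sub>0. \<forall>\<epsilon>>0. \<exists>\<delta>>0. \<forall>u. \<bar>u - u\<^sub>0\<bar> < \<delta> \<longrightarrow>
     (AE x in lebesgue_on \<Omega>. \<bar>d x u - d x u\<^sub>0\<bar> < \<epsilon>))"

text \<open>\<open>u\<close> solves the variational equation in the space \<open>V\<close> (trial and test space): the weak
  solution is the case \<open>V = H10 \<Omega>\<close>, the finite element approximation the case \<open>V = Vh \<Omega> \<T>\<close>.\<close>

definition galerkin_solution ::
    "'a::euclidean_space set \<Rightarrow> ('a \<Rightarrow> real) set \<Rightarrow> ('a \<Rightarrow> real \<Rightarrow> real) \<Rightarrow> ('a \<Rightarrow> real) \<Rightarrow>
     ('a \<Rightarrow> real) \<Rightarrow> bool" where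
  "galerkin_solution \<Omega> V d f u \<longleftrightarrow> u \<in> V \<and>
     (\<forall>\<phi>\<in>V. L2_inner \<Omega> (weak_grad \<Omega> u) (weak_grad \<Omega> \<phi>) + L2_inner \<Omega> (\<lambda>x. d x (u x)) \<phi>
            = L2_inner \<Omega> f \<phi>)"

end

theory Submission
  imports Defs
begin

text \<open>
  Let \<open>z\<close> solve \<open>-\<Delta> z = f - d(u\<^sub>h)\<close>. Then \<open>u\<^sub>h\<close> is the Ritz projection of \<open>z\<close>, so
  \<open>\<epsilon> = \<parallel>z - u\<^sub>h\<parallel>\<^sub>\<infinity>\<close> is bounded by \<open>c h\<^sup>1\<^sup>+\<^sup>\<gamma> \<bar>ln h\<bar> \<parallel>f - d(u\<^sub>h)\<parallel>\<^sub>\<infinity>\<close>. Where \<open>z - u > \<epsilon>\<close>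
  we have \<open>u\<^sub>h > u\<close>, hence \<open>-\<Delta> (z - u) = d(u) - d(u\<^sub>h) \<le> 0\<close>, and the maximum principle gives
  \<open>\<bar>z - u\<bar> \<le> \<epsilon>\<close>, so that \<open>\<parallel>u - u\<^sub>h\<parallel>\<^sub>\<infinity> \<le> 2 \<epsilon>\<close>.

  It remains to bound \<open>u\<^sub>h\<close> uniformly, although no discrete maximum principle is available. A
  supersolution bounds \<open>u\<close> by some \<open>M\<close>. If \<open>d\<close> is truncated at level \<open>M + 1\<close>, the argument above
  applies to the truncated discrete solution, which for small \<open>h\<close> therefore differs from \<open>u\<close>
  by at most 1; it then solves the original discrete problem and equals \<open>u\<^sub>h\<close>. For \<open>h\<close> bounded
  away from 0, an inverse estimate and the energy bound suffice.
\<close>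

section \<open>Smooth bump functions\<close>

text \<open>The obstacle is regularity: \<open>z\<close> is known only as an element of
  \<open>H10 \<Omega>\<close>, with no continuity and no pointwise boundary values. The maximum
  principle is therefore built around a continuous companion, \<open>u\<^sub>h - u\<close>, which
  vanishes on the frontier and lies within \<open>\<epsilon>\<close> of \<open>z - u\<close> almost
  everywhere. Second differences fall on smooth bumps, never on \<open>z\<close>.

  The nonlinearity is bounded only for bounded arguments, and the null set in (A3) may vary with the
  argument. Clamping the argument, together with compactness and monotonicity, gives a bounded
  function that is monotone and continuous off one null set. Such a function has a convex potential,
  so the truncated discrete problem is solvable by minimization; the same minimization produces
  \<open>z\<close>.

  The bounds on \<open>u\<close> and on \<open>u\<^sub>h\<close> see \<open>d\<close> only through
  \<open>d x 0\<close>. Otherwise the truncation level would depend on the bound for the truncated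
  \<open>d\<close>, which in turn depends on the level. The threshold between small and large
  \<open>h\<close> is fixed by the Ritz constant, the norm of \<open>f\<close> and the first
  truncation, so the final constant is uniform in \<open>h\<close>.\<close>

abbreviation pd :: "'a::euclidean_space \<Rightarrow> ('a \<Rightarrow> real) \<Rightarrow> 'a \<Rightarrow> real" where
  "pd b f \<equiv> \<lambda>x. frechet_derivative f (at x) b"

definition smooth :: "('a::euclidean_space \<Rightarrow> real) \<Rightarrow> bool" where
  "smooth f \<longleftrightarrow> (\<forall>k. Ck k f)"

lemma pd_eqI: "(f has_derivative f') (at x) \<Longrightarrow> frechet_derivative f (at x) = f'"
  by (metis frechet_derivative_at)

lemma has_derivative_pd:
  "f differentiable (at x) \<Longrightarrow> (f has_derivative frechet_derivative f (at x)) (at x)"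
  by (simp add: frechet_derivative_works)

lemma pd_add:
  fixes f g :: "'a::euclidean_space \<Rightarrow> real"
  assumes "f differentiable (at x)" "g differentiable (at x)"
  shows "pd b (\<lambda>x. f x + g x) x = pd b f x + pd b g x"
  using pd_eqI[OF has_derivative_add[OF has_derivative_pd[OF assms(1)] has_derivative_pd[OF assms(2)]]]
  by simp

lemma pd_cmult:
  fixes f :: "'a::euclidean_space \<Rightarrow> real"
  assumes "f differentiable (at x)"
  shows "pd b (\<lambda>x. c * f x) x = c * pd b f x"
  using pd_eqI[OF has_derivative_mult_right[OF has_derivative_pd[OF assms(1)], of c]]
  by simp

lemma pd_mult:
  fixes f g :: "'a::euclidean_space \<Rightarrow> real"
  assumes "f differentiable (at x)" "g differentiable (at x)"
  shows "pd b (\<lambda>x. f x * g x) x = f x * pd b g x + pd b f x * g x"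
  using pd_eqI[OF has_derivative_mult[OF has_derivative_pd[OF assms(1)] has_derivative_pd[OF assms(2)]]]
  by simp

lemma Ck_imp_continuous: "Ck k f \<Longrightarrow> continuous_on UNIV f"
  by (cases k) (auto intro!: differentiable_imp_continuous_on simp: differentiable_on_def)

lemma Ck_Suc_imp_Ck: "Ck (Suc k) f \<Longrightarrow> Ck k f"
proof (induction k arbitrary: f)
  case 0
  then show ?case using Ck_imp_continuous[of "Suc 0" f] by simp
next
  case (Suc k)
  then show ?case by auto
qed

lemma Ck_add: "Ck k f \<Longrightarrow> Ck k g \<Longrightarrow> Ck k (\<lambda>x. f x + g x)"
proof (induction k arbitrary: f g)
  case 0
  then show ?case by (auto intro!: continuous_on_add continuous_on_mult)
next
  case (Suc k)
  then have "pd b (\<lambda>x. f x + g x) = (\<lambda>x. pd b f x + pd b g x)" for b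
    by (intro ext pd_add) auto
  with Suc show ?case by auto
qed

lemma Ck_cmult: "Ck k f \<Longrightarrow> Ck k (\<lambda>x. c * f x)"
proof (induction k arbitrary: f)
  case 0
  then show ?case by (auto intro!: continuous_on_add continuous_on_mult)
next
  case (Suc k)
  then have "pd b (\<lambda>x. c * f x) = (\<lambda>x. c * pd b f x)" for b
    by (intro ext pd_cmult) auto
  with Suc show ?case by auto
qed

lemma Ck_mult: "Ck k f \<Longrightarrow> Ck k g \<Longrightarrow> Ck k (\<lambda>x. f x * g x)"
proof (induction k arbitrary: f g)
  case 0
  then show ?case by (auto intro!: continuous_on_add continuous_on_mult)
next
  case (Suc k)
  then have "pd b (\<lambda>x. f x * g x) = (\<lambda>x. f x * pd b g x + pd b f x * g x)" for b
    by (intro ext pd_mult) auto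
  moreover have "Ck k f" "Ck k g" using Suc.prems Ck_Suc_imp_Ck by blast+
  ultimately show ?case using Suc by (auto intro!: Ck_add)
qed

lemma Ck_const: "Ck k (\<lambda>x. c)"
  by (induction k arbitrary: c) auto

lemma smooth_pd: "smooth f \<Longrightarrow> b \<in> Basis \<Longrightarrow> smooth (pd b f)"
  unfolding smooth_def by (metis Ck.simps(2))

lemma smooth_differentiable: "smooth f \<Longrightarrow> f differentiable (at x)"
  unfolding smooth_def by (metis Ck.simps(2))

lemma smooth_continuous: "smooth f \<Longrightarrow> continuous_on S f"
  unfolding smooth_def by (metis Ck_imp_continuous continuous_on_subset subset_UNIV)

lemma Ck_prod: "finite I \<Longrightarrow> (\<And>i. i \<in> I \<Longrightarrow> Ck k (f i)) \<Longrightarrow> Ck k (\<lambda>x. \<Prod>i\<in>I. f i x)"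
  by (induction I rule: finite_induct) (auto intro: Ck_const Ck_mult)

text \<open>The functions \<open>flat m\<close> are, up to linear combinations, the derivatives of \<open>flat 0\<close>,
  the standard smooth function that vanishes exactly on the half-line \<open>t \<le> 0\<close>.\<close>

definition flat :: "nat \<Rightarrow> real \<Rightarrow> real" where
  "flat m t = (if t \<le> 0 then 0 else exp (- (1 / t)) / t ^ m)"

lemma flat_tendsto_0: "(flat m \<longlongrightarrow> 0) (at_right 0)"
proof -
  have "((\<lambda>t::real. (inverse t) ^ m / exp (inverse t)) \<longlongrightarrow> 0) (at_right 0)"
    by (rule filterlim_compose[OF tendsto_power_div_exp_0 filterlim_inverse_at_top_right])
  then show ?thesis
    by (rule Lim_transform_eventually)
      (auto simp: flat_def eventually_at_filter exp_minus field_simps)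
qed

lemma DERIV_flat: "(flat m has_real_derivative (flat (m + 2) t - real m * flat (m + 1) t)) (at t)"
proof (cases t "0 :: real" rule: linorder_cases)
  case less
  have "((\<lambda>t. 0) has_real_derivative 0) (at t)" by simp
  then have "(flat m has_real_derivative 0) (at t)"
    by (rule has_field_derivative_transform_within_open[where S="{..<0}"]) (use less in \<open>auto simp: flat_def\<close>)
  with less show ?thesis by (simp add: flat_def)
next
  case equal
  \<comment> \<open>At 0 the right difference quotient of \<open>flat m\<close> is
    \<open>flat (Suc m)\<close>, so differentiability there reduces to the limit already known for
    the next index.\<close>
  have "((\<lambda>h. (flat m (0 + h) - flat m 0) / h) \<longlongrightarrow> 0) (at_right 0)"
    by (rule Lim_transform_eventually[OF flat_tendsto_0[of "Suc m"]])
      (auto simp: flat_def eventually_at_filter)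
  moreover have "((\<lambda>h. (flat m (0 + h) - flat m 0) / h) \<longlongrightarrow> 0) (at_left 0)"
    by (rule Lim_transform_eventually[OF tendsto_const])
      (auto simp: flat_def eventually_at_filter)
  ultimately have "((\<lambda>h. (flat m (0 + h) - flat m 0) / h) \<longlongrightarrow> 0) (at 0)"
    by (simp add: filterlim_split_at)
  with equal show ?thesis by (simp add: DERIV_def flat_def)
next
  case greater
  have "((\<lambda>t. exp (- (1 / t)) / t ^ m) has_real_derivative
      (exp (- (1 / t)) / t ^ (m + 2) - real m * (exp (- (1 / t)) / t ^ (m + 1)))) (at t)"
  proof -
    have 1: "((\<lambda>t. exp (- inverse t)) has_real_derivative (exp (- inverse t) * (inverse t)\<^sup>2)) (at t)"
      using greater by (auto intro!: derivative_eq_intros simp: power2_eq_square)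
    have 2: "((\<lambda>t. (inverse t) ^ m) has_real_derivative (- real m * (inverse t) ^ (m + 1))) (at t)"
    proof -
      have i: "(inverse has_real_derivative - (inverse t)\<^sup>2) (at t)"
        using DERIV_inverse[of t] greater by (simp add: power2_eq_square)
      show ?thesis
        using DERIV_power[OF i, of m] by (cases m) (simp_all add: power2_eq_square algebra_simps)
    qed
    have "exp (- inverse t) * (- real m * (inverse t) ^ (m + 1)) + exp (- inverse t) * (inverse t)\<^sup>2 * (inverse t) ^ m
        = exp (- inverse t) * (inverse t) ^ (m + 2) - real m * (exp (- inverse t) * (inverse t) ^ (m + 1))"
      by (simp add: algebra_simps power2_eq_square)
    with DERIV_mult'[OF 1 2] show ?thesis
      by (simp only: divide_inverse power_inverse[symmetric] mult_1_left)
  qed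
  then have "(flat m has_real_derivative
      (exp (- (1 / t)) / t ^ (m + 2) - real m * (exp (- (1 / t)) / t ^ (m + 1)))) (at t)"
    by (rule has_field_derivative_transform_within_open[where S="{0<..}"]) (use greater in \<open>auto simp: flat_def\<close>)
  with greater show ?thesis by (simp add: flat_def)
qed

text \<open>Keeping \<open>m\<close> arbitrary lets the induction on \<open>k\<close> absorb the
  shift of index under differentiation. The affine function of one coordinate is the shape in which
  the factors of \<open>bump\<close> need it.\<close>

lemma Ck_flat: "Ck k (\<lambda>x. flat m (\<alpha> * (x \<bullet> i) + \<beta>))"
proof (induction k arbitrary: m)
  case 0
  have "continuous_on UNIV (flat m)"
    by (rule DERIV_continuous_on) (rule DERIV_flat[THEN has_field_derivative_at_within])
  then have "continuous_on UNIV (\<lambda>x. flat m (\<alpha> * (x \<bullet> i) + \<beta>))"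
    by (rule continuous_on_compose2) (auto intro!: continuous_intros)
  then show ?case by simp
next
  case (Suc k)
  define F where "F = (\<lambda>m x. flat m (\<alpha> * (x \<bullet> i) + \<beta>))"
  have D: "(F m has_derivative (\<lambda>h. (F (m + 2) x - real m * F (m + 1) x) * (\<alpha> * (h \<bullet> i)))) (at x)" for x
  proof -
    have 1: "((\<lambda>x. \<alpha> * (x \<bullet> i) + \<beta>) has_derivative (\<lambda>h. \<alpha> * (h \<bullet> i))) (at x)"
      by (auto intro!: derivative_eq_intros)
    show ?thesis
      using diff_chain_at[OF 1 DERIV_flat[of m "\<alpha> * (x \<bullet> i) + \<beta>", unfolded has_field_derivative_def]]
      by (simp add: F_def o_def)
  qed
  have eq: "pd b (F m) = (\<lambda>x. (\<alpha> * (b \<bullet> i)) * (F (m + 2) x + (- real m) * F (m + 1) x))" for b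
    by (intro ext, subst pd_eqI[OF D]) simp
  have "Ck k (pd b (F m))" for b
    unfolding eq unfolding F_def by (intro Ck_cmult Ck_add Suc.IH)
  then show ?case using D unfolding F_def[symmetric] by (auto simp: differentiable_def F_def)
qed

text \<open>The factor \<open>Suc n\<close> steepens the profile:
  \<open>exp (- (1 / (Suc n * s)))\<close> tends to 1 for every \<open>s > 0\<close>. Hence these
  smooth functions with values between 0 and 1 converge to the indicator of the open box.\<close>

definition bump :: "'a::euclidean_space \<Rightarrow> 'a \<Rightarrow> nat \<Rightarrow> 'a \<Rightarrow> real" where
  "bump a b n x = (\<Prod>i\<in>Basis. flat 0 (real (Suc n) * (x \<bullet> i) + - real (Suc n) * (a \<bullet> i)) *
                              flat 0 (- real (Suc n) * (x \<bullet> i) + real (Suc n) * (b \<bullet> i)))"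

lemma smooth_bump: "smooth (bump a b n)"
  unfolding smooth_def bump_def
  by (intro allI Ck_prod Ck_mult Ck_flat) simp

lemma flat_0_bounds: "0 \<le> flat 0 t" "flat 0 t \<le> 1"
  by (auto simp: flat_def)

lemma bump_bounds: "0 \<le> bump a b n x" "bump a b n x \<le> 1"
  unfolding bump_def using flat_0_bounds by (auto intro!: prod_nonneg prod_le_1 mult_le_one)

lemma bump_eq_0: "x \<notin> box a b \<Longrightarrow> bump a b n x = 0"
proof -
  assume "x \<notin> box a b"
  then obtain i where i: "i \<in> Basis" "x \<bullet> i \<le> a \<bullet> i \<or> b \<bullet> i \<le> x \<bullet> i" by (force simp: mem_box)
  then have "real (Suc n) * (x \<bullet> i) \<le> real (Suc n) * (a \<bullet> i) \<or>
      real (Suc n) * (b \<bullet> i) \<le> real (Suc n) * (x \<bullet> i)"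
    by (auto intro: mult_left_mono)
  then have "flat 0 (real (Suc n) * (x \<bullet> i) + - real (Suc n) * (a \<bullet> i)) *
                              flat 0 (- real (Suc n) * (x \<bullet> i) + real (Suc n) * (b \<bullet> i)) = 0"
    unfolding mult_minus_left
  proof
    assume "real (Suc n) * (x \<bullet> i) \<le> real (Suc n) * (a \<bullet> i)"
    then have "flat 0 (real (Suc n) * (x \<bullet> i) + - (real (Suc n) * (a \<bullet> i))) = 0"
      unfolding flat_def by (simp del: of_nat_Suc)
    then show "flat 0 (real (Suc n) * (x \<bullet> i) + - (real (Suc n) * (a \<bullet> i))) *
        flat 0 (- (real (Suc n) * (x \<bullet> i)) + real (Suc n) * (b \<bullet> i)) = 0" by simp
  next
    assume "real (Suc n) * (b \<bullet> i) \<le> real (Suc n) * (x \<bullet> i)"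
    then have "flat 0 (- (real (Suc n) * (x \<bullet> i)) + real (Suc n) * (b \<bullet> i)) = 0"
      unfolding flat_def by (simp del: of_nat_Suc)
    then show "flat 0 (real (Suc n) * (x \<bullet> i) + - (real (Suc n) * (a \<bullet> i))) *
        flat 0 (- (real (Suc n) * (x \<bullet> i)) + real (Suc n) * (b \<bullet> i)) = 0" by simp
  qed
  then show ?thesis using i(1) by (auto simp: bump_def)
qed

lemma bump_tendsto: "(\<lambda>n. bump a b n x) \<longlonglongrightarrow> indicator (box a b) x"
proof (cases "x \<in> box a b")
  case False
  then show ?thesis by (simp add: bump_eq_0)
next
  case True
  have *: "(\<lambda>n. flat 0 (real (Suc n) * c)) \<longlonglongrightarrow> 1" if "c > 0" for c
  proof -
    have "(\<lambda>n. exp (- (inverse (real (Suc n)) * inverse c))) \<longlonglongrightarrow> exp (- (0 * inverse c))"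
      by (intro tendsto_intros LIMSEQ_inverse_real_of_nat)
    moreover have "flat 0 (real (Suc n) * c) = exp (- (inverse (real (Suc n)) * inverse c))" for n
      using that by (simp add: flat_def mult_le_0_iff divide_inverse del: of_nat_Suc)
    ultimately show ?thesis by simp
  qed
  have "(\<lambda>n. bump a b n x) \<longlonglongrightarrow> (\<Prod>i\<in>(Basis::'a set). 1 * 1)"
    unfolding bump_def
  proof (intro tendsto_prod tendsto_mult)
    fix i :: 'a assume i: "i \<in> Basis"
    show "(\<lambda>n. flat 0 (real (Suc n) * (x \<bullet> i) + - real (Suc n) * (a \<bullet> i))) \<longlonglongrightarrow> 1"
      using *[of "x \<bullet> i - a \<bullet> i"] True i by (simp add: mem_box algebra_simps)
    show "(\<lambda>n. flat 0 (- real (Suc n) * (x \<bullet> i) + real (Suc n) * (b \<bullet> i))) \<longlonglongrightarrow> 1"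
      using *[of "b \<bullet> i - x \<bullet> i"] True i by (simp add: mem_box algebra_simps)
  qed
  then show ?thesis using True by simp
qed

lemma test_functionsI:
  assumes "smooth \<phi>" "compact K" "K \<subseteq> \<Omega>" "\<And>x. x \<notin> K \<Longrightarrow> \<phi> x = 0"
  shows "\<phi> \<in> test_functions \<Omega>"
proof -
  have "closure {x. \<phi> x \<noteq> 0} \<subseteq> K"
    by (rule closure_minimal) (use assms compact_imp_closed in auto)
  moreover have "compact (closure {x. \<phi> x \<noteq> 0})"
    by (metis calculation assms(2) bounded_subset closed_closure compact_eq_bounded_closed)
  ultimately show ?thesis using assms unfolding test_functions_def smooth_def by auto
qed

text \<open>Off its closed support a test function vanishes on an open neighbourhood, so its
  derivatives vanish there as well; one compact set serves for all of them.\<close>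

lemma test_functionsE:
  assumes "\<phi> \<in> test_functions \<Omega>"
  obtains K where "smooth \<phi>" "compact K" "K \<subseteq> \<Omega>" "\<And>x. x \<notin> K \<Longrightarrow> \<phi> x = 0"
    "\<And>x b. x \<notin> K \<Longrightarrow> pd b \<phi> x = 0"
proof -
  let ?K = "closure {x. \<phi> x \<noteq> 0}"
  have z: "\<phi> x = 0" if "x \<notin> ?K" for x
    using that subsetD[OF closure_subset, of x "{x. \<phi> x \<noteq> 0}"] by auto
  have d: "pd b \<phi> x = 0" if "x \<notin> ?K" for x b
  proof -
    have "((\<lambda>x. 0) has_derivative (\<lambda>x. 0)) (at x)" by simp
    then have "(\<phi> has_derivative (\<lambda>x. 0)) (at x)"
    proof (rule has_derivative_transform_within_open[where s="- ?K"])
      show "0 = \<phi> y" if "y \<in> - ?K" for y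
        using z[of y] that by (metis ComplD)
    qed (use that in \<open>auto simp: open_Compl\<close>)
    then show ?thesis by (simp add: pd_eqI)
  qed
  show ?thesis
  proof (rule that[of ?K])
    show "smooth \<phi>" "compact ?K" "?K \<subseteq> \<Omega>" using assms by (auto simp: test_functions_def smooth_def)
    show "\<phi> x = 0" if "x \<notin> ?K" for x by (rule z[OF that])
    show "pd b \<phi> x = 0" if "x \<notin> ?K" for x b by (rule d[OF that])
  qed
qed

lemma test_functions_smooth: "\<phi> \<in> test_functions \<Omega> \<Longrightarrow> smooth \<phi>"
  by (erule test_functionsE)

lemma test_functions_lincomb:
  assumes "\<phi> \<in> test_functions \<Omega>" "\<psi> \<in> test_functions \<Omega>"
  shows "(\<lambda>x. \<phi> x + c * \<psi> x) \<in> test_functions \<Omega>"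
proof -
  obtain K L where "smooth \<phi>" "compact K" "K \<subseteq> \<Omega>" "\<And>x. x \<notin> K \<Longrightarrow> \<phi> x = 0"
    "smooth \<psi>" "compact L" "L \<subseteq> \<Omega>" "\<And>x. x \<notin> L \<Longrightarrow> \<psi> x = 0"
    by (rule test_functionsE[OF assms(1)], rule test_functionsE[OF assms(2)]) blast
  note KL = this
  have "smooth (\<lambda>x. \<phi> x + c * \<psi> x)"
    using KL(1,5) Ck_add[OF _ Ck_cmult] unfolding smooth_def by blast
  then show ?thesis
    by (rule test_functionsI[of _ "K \<union> L"]) (use KL in auto)
qed

lemma test_functions_pd:
  assumes "\<phi> \<in> test_functions \<Omega>" "b \<in> Basis" shows "pd b \<phi> \<in> test_functions \<Omega>"
proof -
  obtain K where K: "smooth \<phi>" "compact K" "K \<subseteq> \<Omega>" "\<And>x b. x \<notin> K \<Longrightarrow> pd b \<phi> x = 0"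
    by (rule test_functionsE[OF assms(1)]) blast
  show ?thesis
    by (rule test_functionsI[OF smooth_pd[OF K(1) assms(2)] K(2,3)]) (rule K(4))
qed

lemma test_functions_bounded:
  assumes "\<phi> \<in> test_functions \<Omega>"
  obtains B where "B > 0" "\<And>x. \<bar>\<phi> x\<bar> \<le> B"
proof -
  obtain K where K: "smooth \<phi>" "compact K" "K \<subseteq> \<Omega>" "\<And>x. x \<notin> K \<Longrightarrow> \<phi> x = 0"
    by (rule test_functionsE[OF assms]) blast
  have "bounded (\<phi> ` K)"
    using K by (intro compact_imp_bounded compact_continuous_image smooth_continuous)
  then obtain B where "B > 0" "\<And>x. x \<in> K \<Longrightarrow> \<bar>\<phi> x\<bar> \<le> B"
    unfolding bounded_pos by auto
  then show ?thesis using that[of B] K(4) by fastforce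
qed

lemma grad_inner: "grad f x \<bullet> b = pd b f x" if "b \<in> Basis"
  using that by (simp add: grad_def inner_sum_left inner_Basis if_distrib cong: if_cong)

lemma bump_test_function: "cbox a b \<subseteq> \<Omega> \<Longrightarrow> bump a b n \<in> test_functions \<Omega>"
  by (rule test_functionsI[of _ "cbox a b"])
    (auto simp: smooth_bump intro!: bump_eq_0 dest: subsetD[OF box_subset_cbox])

section \<open>Integration against test functions\<close>

lemma integrable_lborel_compact_support:
  fixes F :: "'a::euclidean_space \<Rightarrow> real"
  assumes "continuous_on UNIV F" "compact K" "\<And>x. x \<notin> K \<Longrightarrow> F x = 0"
  shows "integrable lborel F"
proof -
  have "integrable lborel (\<lambda>x. indicator K x *\<^sub>R F x)"
    by (rule borel_integrable_compact) (use assms continuous_on_subset[OF assms(1)] in auto)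
  moreover have "(\<lambda>x. indicator K x *\<^sub>R F x) = F"
    using assms(3) by (auto simp: indicator_def fun_eq_iff)
  ultimately show ?thesis by simp
qed

lemma integral_lebesgue_on_supported:
  fixes F :: "'a::euclidean_space \<Rightarrow> 'b::euclidean_space"
  assumes "\<Omega> \<in> sets lebesgue" "\<And>x. x \<notin> \<Omega> \<Longrightarrow> F x = 0"
  shows "integral\<^sup>L (lebesgue_on \<Omega>) F = integral\<^sup>L lebesgue F"
proof -
  have "(\<lambda>x. indicator \<Omega> x *\<^sub>R F x) = F"
    using assms(2) by (auto simp: indicator_def)
  then show ?thesis using assms(1) by (simp add: integral_restrict_space)
qed

lemma line_has_derivative:
  fixes F :: "'a::euclidean_space \<Rightarrow> real"
  assumes "F differentiable (at (x + s *\<^sub>R b))"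
  shows "((\<lambda>s. F (x + s *\<^sub>R b)) has_real_derivative pd b F (x + s *\<^sub>R b)) (at s)"
proof -
  have 1: "((\<lambda>s. x + s *\<^sub>R b) has_derivative (\<lambda>h. h *\<^sub>R b)) (at s)"
    by (auto intro!: derivative_eq_intros)
  have "((\<lambda>s. F (x + s *\<^sub>R b)) has_derivative (\<lambda>h. frechet_derivative F (at (x + s *\<^sub>R b)) (h *\<^sub>R b))) (at s)"
    using diff_chain_at[OF 1 has_derivative_pd[OF assms(1)]] by (simp add: o_def)
  moreover have "frechet_derivative F (at (x + s *\<^sub>R b)) (h *\<^sub>R b) = pd b F (x + s *\<^sub>R b) * h" for h
    using linear_scale[OF has_derivative_linear[OF has_derivative_pd[OF assms(1)]]] by simp
  ultimately show ?thesis by (simp add: has_field_derivative_def)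
qed

lemma line_difference_bound:
  fixes F :: "'a::euclidean_space \<Rightarrow> real"
  assumes "\<And>x. F differentiable (at x)" "\<And>x. \<bar>pd b F x\<bar> \<le> B"
  shows "\<bar>F (x + t *\<^sub>R b) - F x\<bar> \<le> \<bar>t\<bar> * B"
proof -
  have D: "((\<lambda>s. F (x + s *\<^sub>R b)) has_real_derivative pd b F (x + s *\<^sub>R b)) (at s)" for s
    by (rule line_has_derivative[OF assms(1)])
  have "norm (F (x + t *\<^sub>R b) - F (x + 0 *\<^sub>R b)) \<le> B * norm (t - 0)"
    by (rule field_differentiable_bound[OF convex_UNIV, where f="\<lambda>s. F (x + s *\<^sub>R b)", OF D])
      (use assms(2) in auto)
  then show ?thesis by (simp add: mult.commute)
qed

text \<open>The integral of \<open>F\<close> is invariant under translation in direction \<open>b\<close>; differentiating this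
  identity avoids Fubini's theorem.\<close>

lemma integral_pd_eq_0:
  fixes F :: "'a::euclidean_space \<Rightarrow> real"
  assumes F: "F \<in> test_functions \<Omega>" and \<Omega>: "\<Omega> \<in> sets lebesgue" and b: "b \<in> Basis"
  shows "(LINT x|lebesgue_on \<Omega>. pd b F x) = 0"
proof -
  obtain K where K: "smooth F" "compact K" "K \<subseteq> \<Omega>" "\<And>x. x \<notin> K \<Longrightarrow> F x = 0"
    "\<And>x b. x \<notin> K \<Longrightarrow> pd b F x = 0"
    by (rule test_functionsE[OF F]) blast
  obtain B where B: "\<And>x. \<bar>pd b F x\<bar> \<le> B" and "B > 0"
    using test_functions_bounded[OF test_functions_pd[OF F b]] by metis
  obtain R where R: "\<And>x. x \<in> K \<Longrightarrow> norm x \<le> R" "R > 0"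
    using compact_imp_bounded[OF K(2)] unfolding bounded_pos by auto
  define t where "t = (\<lambda>n. inverse (real (Suc n)))"
  have t: "0 < t n" "t n \<le> 1" for n by (auto simp: t_def field_simps)
  define s where "s = (\<lambda>n x. inverse (t n) * (F (x + t n *\<^sub>R b) - F x))"
  have cont: "continuous_on UNIV F" using K(1) by (rule smooth_continuous)
  have contb: "continuous_on UNIV (pd b F)" using K(1) b by (intro smooth_continuous smooth_pd)
  have Fint: "integrable lborel F" by (rule integrable_lborel_compact_support[OF cont K(2,4)])
  have conts: "continuous_on UNIV (\<lambda>x. F (x + c))" for c
    by (rule continuous_on_compose2[OF cont]) (auto intro!: continuous_intros)
  have shift: "integral\<^sup>L lborel (\<lambda>x. F (x + c)) = integral\<^sup>L lborel F" for c
  proof -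
    have "integral\<^sup>L lborel F = integral\<^sup>L (distr lborel borel ((+) c)) F"
      by (simp add: lborel_distr_plus)
    also have "\<dots> = integral\<^sup>L lborel (\<lambda>x. F (c + x))"
      by (rule integral_distr) (use borel_measurable_continuous_onI[OF cont] in auto)
    finally show ?thesis by (simp add: add.commute)
  qed
  have shift_int: "integrable lborel (\<lambda>x. F (x + c))" for c
  proof (rule integrable_lborel_compact_support[OF conts])
    show "compact ((\<lambda>x. x - c) ` K)"
      by (intro compact_continuous_image K continuous_intros)
    show "F (x + c) = 0" if "x \<notin> (\<lambda>x. x - c) ` K" for x
      using that by (intro K(4)) (metis add_diff_cancel image_eqI)
  qed
  have s0: "integral\<^sup>L lborel (s n) = 0" for n
    unfolding s_def using shift_int[of "t n *\<^sub>R b"] Fint by (simp add: shift)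
  have lim: "(\<lambda>n. s n x) \<longlonglongrightarrow> pd b F x" for x
  proof -
    have "((\<lambda>h. (F (x + (0 + h) *\<^sub>R b) - F (x + 0 *\<^sub>R b)) / h) \<longlongrightarrow> pd b F (x + 0 *\<^sub>R b)) (at 0)"
      using line_has_derivative[where F=F and x=x and s=0 and b=b] smooth_differentiable[OF K(1)]
      by (simp add: DERIV_def)
    moreover have "filterlim t (at 0) sequentially"
      using t(1) LIMSEQ_inverse_real_of_nat by (auto simp: filterlim_at t_def intro!: always_eventually)
    ultimately have "(\<lambda>n. (F (x + (0 + t n) *\<^sub>R b) - F (x + 0 *\<^sub>R b)) / t n) \<longlonglongrightarrow> pd b F (x + 0 *\<^sub>R b)"
      by (rule filterlim_compose)
    then show ?thesis by (simp add: s_def divide_inverse mult.commute)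
  qed
  \<comment> \<open>The shift is along a unit vector by at most 1, so every difference quotient
    vanishes outside the ball of radius \<open>R + 1\<close>; inside it the mean value bound gives
    \<open>B\<close>. This is the integrable majorant.\<close>
  have bd: "norm (s n x) \<le> B * indicator (cball 0 (R + 1)) x" for n x
  proof (cases "x \<in> cball 0 (R + 1)")
    case True
    have "\<bar>s n x\<bar> = inverse (t n) * \<bar>F (x + t n *\<^sub>R b) - F x\<bar>"
      using t[of n] by (simp add: s_def abs_mult)
    also have "\<dots> \<le> inverse (t n) * (\<bar>t n\<bar> * B)"
      using t[of n] by (intro mult_left_mono line_difference_bound smooth_differentiable K B) auto
    also have "\<dots> = B" using t[of n] by simp
    finally show ?thesis using True by simp
  next
    case False
    then have "norm x > R + 1" by simp
    moreover have "norm (x + t n *\<^sub>R b) \<ge> norm x - 1"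
      using norm_triangle_ineq2[of x "- (t n *\<^sub>R b)"] t[of n] b by simp
    ultimately have "x \<notin> K" "x + t n *\<^sub>R b \<notin> K" using R(1)[of x] R(1)[of "x + t n *\<^sub>R b"] by auto
    then show ?thesis using \<open>B > 0\<close> by (simp add: s_def K(4))
  qed
  have "(\<lambda>n. integral\<^sup>L lborel (s n)) \<longlonglongrightarrow> integral\<^sup>L lborel (pd b F)"
  proof (rule integral_dominated_convergence)
    show "pd b F \<in> borel_measurable lborel" using borel_measurable_continuous_onI[OF contb] by simp
    show "s n \<in> borel_measurable lborel" for n
      unfolding s_def using borel_measurable_continuous_onI[OF conts] borel_measurable_continuous_onI[OF cont]
      by simp
    show "integrable lborel (\<lambda>x::'a. B * indicator (cball 0 (R + 1)) x)"
      using emeasure_bounded_finite[OF bounded_cball, of "0::'a" "R+1"]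
      by (intro integrable_mult_right integrable_real_indicator) auto
  qed (use lim bd in auto)
  then have "integral\<^sup>L lborel (pd b F) = 0" unfolding s0 by (simp add: LIMSEQ_const_iff)
  moreover have "integral\<^sup>L (lebesgue_on \<Omega>) (pd b F) = integral\<^sup>L lborel (pd b F)"
    using borel_measurable_continuous_onI[OF contb] K(3,5) \<Omega>
    by (subst integral_lebesgue_on_supported) (auto simp: integral_completion)
  ultimately show ?thesis by simp
qed

lemma integrable_bounded_supported:
  fixes f :: "'a::euclidean_space \<Rightarrow> 'b::euclidean_space" and \<phi> :: "'a \<Rightarrow> real"
  assumes f: "locally_integrable \<Omega> f" and K: "compact K" "K \<subseteq> \<Omega>" and \<Omega>: "\<Omega> \<in> sets lebesgue"
    and \<phi>: "continuous_on UNIV \<phi>" "\<And>x. x \<notin> K \<Longrightarrow> \<phi> x = 0"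
  shows "integrable (lebesgue_on \<Omega>) (\<lambda>x. \<phi> x *\<^sub>R f x)"
proof -
  have Ks: "K \<in> sets lebesgue" using K(1) by (simp add: compact_imp_closed)
  have "bounded (\<phi> ` K)"
    using K by (intro compact_imp_bounded compact_continuous_image continuous_on_subset[OF \<phi>(1)]) auto
  then obtain B where B: "\<And>x. x \<in> K \<Longrightarrow> \<bar>\<phi> x\<bar> \<le> B" unfolding bounded_iff by auto
  have fK: "integrable lebesgue (\<lambda>x. indicator K x *\<^sub>R f x)"
    using f K Ks unfolding locally_integrable_def by (simp flip: integrable_restrict_space)
  have "integrable lebesgue (\<lambda>x. \<phi> x *\<^sub>R (indicator K x *\<^sub>R f x))"
  proof (rule Bochner_Integration.integrable_bound[OF integrable_scaleR_right[OF fK, of B]])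
    show "(\<lambda>x. \<phi> x *\<^sub>R indicator K x *\<^sub>R f x) \<in> borel_measurable lebesgue"
    proof (rule borel_measurable_scaleR[OF _ borel_measurable_integrable[OF fK]])
      show "\<phi> \<in> borel_measurable lebesgue"
        using borel_measurable_continuous_onI[OF \<phi>(1)] by (auto intro: measurable_completion)
    qed
    show "AE x in lebesgue. norm (\<phi> x *\<^sub>R indicator K x *\<^sub>R f x) \<le> norm (B *\<^sub>R indicator K x *\<^sub>R f x)"
    proof (intro AE_I2)
      fix x show "norm (\<phi> x *\<^sub>R indicator K x *\<^sub>R f x) \<le> norm (B *\<^sub>R indicator K x *\<^sub>R f x)"
        using B[of x] by (cases "x \<in> K") (auto intro!: mult_right_mono)
    qed
  qed
  moreover have "(\<lambda>x. \<phi> x *\<^sub>R (indicator K x *\<^sub>R f x)) = (\<lambda>x. indicator \<Omega> x *\<^sub>R (\<phi> x *\<^sub>R f x))"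
    using \<phi>(2) K(2) by (auto simp: indicator_def fun_eq_iff)
  ultimately show ?thesis using \<Omega> by (simp add: integrable_restrict_space)
qed

lemma integrable_test:
  fixes f :: "'a::euclidean_space \<Rightarrow> 'b::euclidean_space"
  assumes "locally_integrable \<Omega> f" "\<Omega> \<in> sets lebesgue" "\<phi> \<in> test_functions \<Omega>"
  shows "integrable (lebesgue_on \<Omega>) (\<lambda>x. \<phi> x *\<^sub>R f x)"
proof -
  obtain K where K: "smooth \<phi>" "compact K" "K \<subseteq> \<Omega>" "\<And>x. x \<notin> K \<Longrightarrow> \<phi> x = 0"
    by (rule test_functionsE[OF assms(3)]) blast
  show ?thesis
    by (rule integrable_bounded_supported[OF assms(1) K(2,3) assms(2) smooth_continuous[OF K(1)] K(4)])
qed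

text \<open>Completeness of Lebesgue measure. Extension by zero transports the statement between
  \<open>lebesgue_on \<Omega>\<close> and \<open>lebesgue\<close>.\<close>

lemma borel_measurable_AE_on:
  fixes f g :: "'a::euclidean_space \<Rightarrow> 'b::euclidean_space"
  assumes "f \<in> borel_measurable (lebesgue_on \<Omega>)" "AE x in lebesgue_on \<Omega>. f x = g x" "\<Omega> \<in> sets lebesgue"
  shows "g \<in> borel_measurable (lebesgue_on \<Omega>)"
proof -
  have "(\<lambda>x. if x \<in> \<Omega> then f x else 0) \<in> borel_measurable lebesgue"
    using assms(1,3) by (simp add: borel_measurable_if)
  then have "(\<lambda>x. if x \<in> \<Omega> then g x else 0) \<in> borel_measurable lebesgue"
    by (rule borel_measurable_AE) (use assms(2,3) in \<open>auto simp: AE_restrict_space_iff\<close>)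
  then show ?thesis using assms(3) by (simp add: borel_measurable_if)
qed

section \<open>Lebesgue differentiation over small cubes\<close>

lemma cube_subset_cball:
  fixes x :: "'a::euclidean_space"
  assumes "0 \<le> h" shows "cbox x (x + h *\<^sub>R One) \<subseteq> cball x (h * DIM('a))"
proof
  fix y assume y: "y \<in> cbox x (x + h *\<^sub>R One)"
  have "norm (y - x) \<le> (\<Sum>b\<in>Basis. \<bar>(y - x) \<bullet> b\<bar>)" by (rule norm_le_l1)
  also have "\<dots> \<le> (\<Sum>b\<in>(Basis::'a set). h)"
  proof (rule sum_mono)
    fix b :: 'a assume "b \<in> Basis"
    then have "x \<bullet> b \<le> y \<bullet> b" "y \<bullet> b \<le> x \<bullet> b + h" using y by (auto simp: mem_box inner_add_left)
    then show "\<bar>(y - x) \<bullet> b\<bar> \<le> h" by (simp add: inner_diff_left)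
  qed
  finally show "y \<in> cball x (h * DIM('a))" by (simp add: dist_norm norm_minus_commute mult.commute)
qed

lemma small_cube_subset:
  fixes x :: "'a::euclidean_space"
  assumes "open U" "x \<in> U"
  obtains d where "d > 0" "\<And>h. 0 < h \<Longrightarrow> h < d \<Longrightarrow> cbox x (x + h *\<^sub>R One) \<subseteq> U"
proof -
  obtain e where e: "e > 0" "cball x e \<subseteq> U" using assms open_contains_cball by blast
  show ?thesis
  proof (rule that[of "e / DIM('a)"])
    show "e / DIM('a) > 0" using e by simp
    fix h :: real assume "0 < h" "h < e / DIM('a)"
    then have "h * DIM('a) \<le> e" by (simp add: field_simps)
    then show "cbox x (x + h *\<^sub>R One) \<subseteq> U"
      using cube_subset_cball[of h x] e(2) \<open>0 < h\<close> by (force simp: subset_cball)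
  qed
qed

text \<open>Almost everywhere the averages over cubes with corner \<open>x\<close> converge to
  \<open>f x\<close>, so a value above \<open>c\<close> would push the small averages above
  \<open>c\<close>. This converts every cube estimate below into a bound almost everywhere.\<close>

lemma AE_le_if_cube_integrals_le:
  fixes f :: "'a::euclidean_space \<Rightarrow> real"
  assumes f: "locally_integrable \<Omega> f" and \<Omega>: "open \<Omega>"
    and le: "\<And>x. x \<in> \<Omega> \<Longrightarrow> \<exists>d>0. \<forall>h. 0 < h \<and> h < d \<and> cbox x (x + h *\<^sub>R One) \<subseteq> \<Omega> \<longrightarrow>
               (LINT y|lebesgue_on (cbox x (x + h *\<^sub>R One)). f y) \<le> c * h ^ DIM('a)"
  shows "AE x in lebesgue_on \<Omega>. f x \<le> c"
proof -
  \<comment> \<open>As \<open>f\<close> is only locally integrable, differentiation is applied to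
    its restriction \<open>g\<close> to each of countably many closed boxes that fill
    \<open>\<Omega>\<close>.\<close>
  obtain D where D: "countable D" "D \<subseteq> Pow \<Omega>" "\<And>X. X \<in> D \<Longrightarrow> \<exists>a b. X = cbox a b" "\<Union>D = \<Omega>"
    using open_countable_Union_open_cbox[OF \<Omega>] by metis
  have 1: "AE x in lebesgue. x \<in> X \<longrightarrow> f x \<le> c" if X: "X \<in> D" for X
  proof -
    obtain a b where ab: "X = cbox a b" using D X by blast
    have Xs: "X \<subseteq> \<Omega>" using D X by blast
    have fX: "integrable (lebesgue_on X) f"
      using f Xs unfolding locally_integrable_def ab by (simp add: compact_cbox)
    define g where "g = (\<lambda>x. if x \<in> X then f x else 0)"
    have g: "integrable lebesgue g"
      using fX unfolding g_def ab by (subst Lebesgue_Measure.integrable_restrict_UNIV) auto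
    have "g integrable_on cbox p q" for p q
    proof (rule integrable_on_lebesgue_on)
      show "integrable (lebesgue_on (cbox p q)) g"
        using integrable_mult_indicator[OF _ g, of "cbox p q"] by (simp add: integrable_restrict_space)
    qed simp
    then obtain N where N: "negligible N" "\<And>x e. \<lbrakk>x \<notin> N; 0 < e\<rbrakk> \<Longrightarrow>
         \<exists>d>0. \<forall>h. 0 < h \<and> h < d \<longrightarrow>
            norm (integral (cbox x (x + h *\<^sub>R One)) g /\<^sub>R h ^ DIM('a) - g x) < e"
      using integrable_ccontinuous_explicit[of g] by metis
    have "f x \<le> c" if x: "x \<in> box a b" "x \<notin> N" for x
    proof (rule ccontr)
      assume "\<not> f x \<le> c"
      have xX: "x \<in> X" using x box_subset_cbox ab by blast
      obtain d1 where d1: "d1 > 0" "\<And>h. 0 < h \<and> h < d1 \<Longrightarrow>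
            norm (integral (cbox x (x + h *\<^sub>R One)) g /\<^sub>R h ^ DIM('a) - g x) < f x - c"
        using N(2)[OF x(2), of "f x - c"] \<open>\<not> f x \<le> c\<close> by auto
      obtain d2 where d2: "d2 > 0" "\<And>h. 0 < h \<and> h < d2 \<and> cbox x (x + h *\<^sub>R One) \<subseteq> \<Omega> \<Longrightarrow>
               (LINT y|lebesgue_on (cbox x (x + h *\<^sub>R One)). f y) \<le> c * h ^ DIM('a)"
        using le[of x] xX Xs by blast
      obtain d3 where d3: "d3 > 0" "\<And>h. 0 < h \<Longrightarrow> h < d3 \<Longrightarrow> cbox x (x + h *\<^sub>R One) \<subseteq> box a b"
        by (rule small_cube_subset[OF open_box x(1)]) blast
      define h where "h = min d1 (min d2 d3) / 2"
      have h: "0 < h" "h < d1" "h < d2" "h < d3" using d1(1) d2(1) d3(1) by (auto simp: h_def)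
      let ?C = "cbox x (x + h *\<^sub>R One)"
      have C: "?C \<subseteq> X" using d3(2)[OF h(1,4)] box_subset_cbox[of a b] ab by blast
      have fC: "integrable (lebesgue_on ?C) f"
        using f C Xs unfolding locally_integrable_def by (meson compact_cbox order_trans)
      have "integral ?C g = integral ?C f"
        by (rule integral_cong) (use C in \<open>auto simp: g_def\<close>)
      also have "\<dots> = (LINT y|lebesgue_on ?C. f y)"
        by (rule lebesgue_integral_eq_integral[OF fC, symmetric]) simp
      also have "\<dots> \<le> c * h ^ DIM('a)" using d2(2)[of h] h C Xs by blast
      finally have "integral ?C g /\<^sub>R h ^ DIM('a) \<le> c"
        using h(1) by (simp add: field_simps)
      moreover have "g x = f x" using xX by (simp add: g_def)
      ultimately show False using d1(2)[of h] h by auto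
    qed
    \<comment> \<open>Interior points of the box leave room for small cubes; the faces join the
      exceptional set.\<close>
    then have "x \<in> X \<longrightarrow> f x \<le> c" if "x \<notin> N \<union> (cbox a b - box a b)" for x using that ab by auto
    moreover have "N \<union> (cbox a b - box a b) \<in> null_sets lebesgue"
      using N(1) negligible_frontier_interval negligible_Un negligible_iff_null_sets by blast
    ultimately show ?thesis by (intro AE_I'[of "N \<union> (cbox a b - box a b)"]) auto
  qed
  have "AE x in lebesgue. \<forall>X\<in>D. x \<in> X \<longrightarrow> f x \<le> c"
    using 1 D(1) by (intro AE_ball_countable[THEN iffD2]) auto
  then have "AE x in lebesgue. x \<in> \<Omega> \<longrightarrow> f x \<le> c"
    by eventually_elim (use D(4) in blast)
  then show ?thesis using \<Omega> by (simp add: AE_restrict_space_iff)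
qed

section \<open>Square-integrable functions\<close>

abbreviation L2_sq :: "'a::euclidean_space set \<Rightarrow> ('a \<Rightarrow> 'b::euclidean_space) \<Rightarrow> real" where
  "L2_sq \<Omega> f \<equiv> (LINT x|lebesgue_on \<Omega>. (norm (f x))\<^sup>2)"

lemma L2_D:
  assumes "f \<in> L2 \<Omega>"
  shows "f \<in> borel_measurable (lebesgue_on \<Omega>)" "integrable (lebesgue_on \<Omega>) (\<lambda>x. (norm (f x))\<^sup>2)"
  using assms by (auto simp: L2_def)

lemma L2_sq_eq_inner: "L2_sq \<Omega> f = L2_inner \<Omega> f f"
  by (simp add: L2_inner_def power2_norm_eq_inner)

lemma L2_sq_nonneg: "0 \<le> L2_sq \<Omega> f"
  by simp

lemma L2_inner_commute: "L2_inner \<Omega> f g = L2_inner \<Omega> g f"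
  by (simp add: L2_inner_def inner_commute)

lemma integrable_L2_inner:
  assumes "f \<in> L2 \<Omega>" "g \<in> L2 \<Omega>"
  shows "integrable (lebesgue_on \<Omega>) (\<lambda>x. f x \<bullet> g x)"
proof (rule Bochner_Integration.integrable_bound)
  show "integrable (lebesgue_on \<Omega>) (\<lambda>x. (norm (f x))\<^sup>2 + (norm (g x))\<^sup>2)"
    using assms by (intro Bochner_Integration.integrable_add L2_D)
  show "(\<lambda>x. f x \<bullet> g x) \<in> borel_measurable (lebesgue_on \<Omega>)"
    using assms by (intro borel_measurable_inner L2_D)
  show "AE x in lebesgue_on \<Omega>. norm (f x \<bullet> g x) \<le> norm ((norm (f x))\<^sup>2 + (norm (g x))\<^sup>2)"
  proof (intro AE_I2)
    fix x
    have "norm (f x \<bullet> g x) \<le> norm (f x) * norm (g x)" by (simp add: Cauchy_Schwarz_ineq2)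
    also have "\<dots> \<le> (norm (f x))\<^sup>2 + (norm (g x))\<^sup>2"
      using sum_squares_bound[of "norm (f x)" "norm (g x)"] mult_nonneg_nonneg[OF norm_ge_zero norm_ge_zero, of "f x" "g x"]
      by linarith
    finally show "norm (f x \<bullet> g x) \<le> norm ((norm (f x))\<^sup>2 + (norm (g x))\<^sup>2)" by simp
  qed
qed

lemma L2_lincomb:
  assumes "f \<in> L2 \<Omega>" "g \<in> L2 \<Omega>"
  shows "(\<lambda>x. f x + c *\<^sub>R g x) \<in> L2 \<Omega>"
proof -
  have "(\<lambda>x. (norm (f x + c *\<^sub>R g x))\<^sup>2) = (\<lambda>x. f x \<bullet> f x + (2 * c) * (f x \<bullet> g x) + c\<^sup>2 * (g x \<bullet> g x))"
    by (rule ext) (simp only: power2_norm_eq_inner,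
        simp add: inner_add_left inner_add_right inner_commute power2_eq_square algebra_simps)
  moreover have "integrable (lebesgue_on \<Omega>) (\<lambda>x. f x \<bullet> f x + (2 * c) * (f x \<bullet> g x) + c\<^sup>2 * (g x \<bullet> g x))"
    using assms by (intro Bochner_Integration.integrable_add integrable_mult_right integrable_L2_inner)
  moreover have "(\<lambda>x. f x + c *\<^sub>R g x) \<in> borel_measurable (lebesgue_on \<Omega>)"
    using assms by (intro borel_measurable_add borel_measurable_scaleR borel_measurable_const L2_D)
  ultimately show ?thesis by (simp add: L2_def)
qed

lemma L2_add: "f \<in> L2 \<Omega> \<Longrightarrow> g \<in> L2 \<Omega> \<Longrightarrow> (\<lambda>x. f x + g x) \<in> L2 \<Omega>"
  using L2_lincomb[of f \<Omega> g 1] by simp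

lemma L2_diff: "f \<in> L2 \<Omega> \<Longrightarrow> g \<in> L2 \<Omega> \<Longrightarrow> (\<lambda>x. f x - g x) \<in> L2 \<Omega>"
  using L2_lincomb[of f \<Omega> g "-1"] by simp

lemma L2_inner_lincomb_left:
  assumes "f \<in> L2 \<Omega>" "g \<in> L2 \<Omega>" "h \<in> L2 \<Omega>"
  shows "L2_inner \<Omega> (\<lambda>x. f x + c *\<^sub>R g x) h = L2_inner \<Omega> f h + c * L2_inner \<Omega> g h"
  using integrable_L2_inner[OF assms(1,3)] integrable_L2_inner[OF assms(2,3)]
  by (simp add: L2_inner_def inner_add_left)

lemma L2_inner_lincomb_right:
  assumes "f \<in> L2 \<Omega>" "g \<in> L2 \<Omega>" "h \<in> L2 \<Omega>"
  shows "L2_inner \<Omega> h (\<lambda>x. f x + c *\<^sub>R g x) = L2_inner \<Omega> h f + c * L2_inner \<Omega> h g"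
  using L2_inner_lincomb_left[OF assms] by (simp add: L2_inner_commute)

lemma L2_inner_diff_left:
  assumes "f \<in> L2 \<Omega>" "g \<in> L2 \<Omega>" "h \<in> L2 \<Omega>"
  shows "L2_inner \<Omega> (\<lambda>x. f x - g x) h = L2_inner \<Omega> f h - L2_inner \<Omega> g h"
  using L2_inner_lincomb_left[OF assms, of "-1"] by simp

lemma L2_inner_diff_right:
  assumes "f \<in> L2 \<Omega>" "g \<in> L2 \<Omega>" "h \<in> L2 \<Omega>"
  shows "L2_inner \<Omega> h (\<lambda>x. f x - g x) = L2_inner \<Omega> h f - L2_inner \<Omega> h g"
  using L2_inner_diff_left[OF assms] by (simp add: L2_inner_commute)

text \<open>The discriminant criterion. The degenerate case \<open>C = 0\<close> leaves an affine
  function of \<open>t\<close>, whose slope has to vanish.\<close>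

lemma square_le_if_quadratic_nonneg:
  fixes A B C :: real
  assumes q: "\<And>t. 0 \<le> A + 2 * t * B + t\<^sup>2 * C" and C: "0 \<le> C"
  shows "B\<^sup>2 \<le> A * C"
proof (cases "C = 0")
  case True
  have "B = 0"
  proof (rule ccontr)
    assume "B \<noteq> 0"
    then have "A + 2 * (- (A + 1) / (2 * B)) * B = -1" by (simp add: field_simps)
    then show False using q[of "- (A + 1) / (2 * B)"] True by simp
  qed
  then show ?thesis using True by simp
next
  case False
  have "0 \<le> C * (A + 2 * (- B / C) * B + (- B / C)\<^sup>2 * C)"
    using q[of "- B / C"] C by (rule mult_nonneg_nonneg[rotated])
  also have "\<dots> = A * C - B\<^sup>2" using False by (simp add: field_simps power2_eq_square)
  finally show ?thesis by simp
qed

lemma L2_Cauchy_Schwarz: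
  assumes "f \<in> L2 \<Omega>" "g \<in> L2 \<Omega>"
  shows "(L2_inner \<Omega> f g)\<^sup>2 \<le> L2_sq \<Omega> f * L2_sq \<Omega> g"
proof (rule square_le_if_quadratic_nonneg)
  fix t
  have "L2_sq \<Omega> (\<lambda>x. f x + t *\<^sub>R g x) =
      L2_inner \<Omega> f f + t * L2_inner \<Omega> g f + t * (L2_inner \<Omega> f g + t * L2_inner \<Omega> g g)"
    unfolding L2_sq_eq_inner
    by (simp add: L2_inner_lincomb_left L2_inner_lincomb_right assms L2_lincomb)
       (simp add: algebra_simps)
  then have "L2_sq \<Omega> (\<lambda>x. f x + t *\<^sub>R g x) =
      L2_sq \<Omega> f + 2 * t * L2_inner \<Omega> f g + t\<^sup>2 * L2_sq \<Omega> g"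
    unfolding L2_sq_eq_inner by (simp add: L2_inner_commute[of \<Omega> g f] power2_eq_square algebra_simps)
  then show "0 \<le> L2_sq \<Omega> f + 2 * t * L2_inner \<Omega> f g + t\<^sup>2 * L2_sq \<Omega> g"
    using L2_sq_nonneg[of \<Omega> "\<lambda>x. f x + t *\<^sub>R g x"] by simp
qed simp

text \<open>The parallelogram identity with the square of the difference dropped. It replaces the
  triangle inequality, so that all estimates can be carried out with squared norms.\<close>

lemma L2_sq_add_le:
  assumes "f \<in> L2 \<Omega>" "g \<in> L2 \<Omega>"
  shows "L2_sq \<Omega> (\<lambda>x. f x + g x) \<le> 2 * L2_sq \<Omega> f + 2 * L2_sq \<Omega> g"
proof -
  have "L2_sq \<Omega> (\<lambda>x. f x + g x) + L2_sq \<Omega> (\<lambda>x. f x - g x) =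
    (LINT x|lebesgue_on \<Omega>. (norm (f x + g x))\<^sup>2 + (norm (f x - g x))\<^sup>2)"
    using L2_add[OF assms] L2_diff[OF assms]
    by (intro Bochner_Integration.integral_add[symmetric] L2_D)
  also have "\<dots> = (LINT x|lebesgue_on \<Omega>. 2 * (norm (f x))\<^sup>2 + 2 * (norm (g x))\<^sup>2)"
    by (intro Bochner_Integration.integral_cong refl)
      (simp add: power2_norm_eq_inner inner_simps inner_commute)
  also have "\<dots> = 2 * L2_sq \<Omega> f + 2 * L2_sq \<Omega> g"
    using L2_D(2)[OF assms(1)] L2_D(2)[OF assms(2)] by simp
  finally show ?thesis using L2_sq_nonneg[of \<Omega> "\<lambda>x. f x - g x"] by linarith
qed

lemma L2_sq_commute: "L2_sq \<Omega> (\<lambda>x. f x - g x) = L2_sq \<Omega> (\<lambda>x. g x - f x)"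
  by (simp add: norm_minus_commute)

lemma L2_sq_diff_le:
  assumes "f \<in> L2 \<Omega>" "g \<in> L2 \<Omega>" "h \<in> L2 \<Omega>"
  shows "L2_sq \<Omega> (\<lambda>x. f x - g x) \<le> 2 * L2_sq \<Omega> (\<lambda>x. f x - h x) + 2 * L2_sq \<Omega> (\<lambda>x. h x - g x)"
  using L2_sq_add_le[OF L2_diff[OF assms(1,3)] L2_diff[OF assms(3,2)]] by simp

lemma L2_cong_AE:
  assumes "f \<in> L2 \<Omega>" "AE x in lebesgue_on \<Omega>. f x = g x" "\<Omega> \<in> sets lebesgue"
  shows "g \<in> L2 \<Omega>"
proof -
  have g: "g \<in> borel_measurable (lebesgue_on \<Omega>)"
    by (rule borel_measurable_AE_on[OF L2_D(1)[OF assms(1)] assms(2,3)])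
  have "integrable (lebesgue_on \<Omega>) (\<lambda>x. (norm (g x))\<^sup>2)"
  proof (rule integrable_cong_AE_imp[OF L2_D(2)[OF assms(1)]])
    show "AE x in lebesgue_on \<Omega>. (norm (f x))\<^sup>2 = (norm (g x))\<^sup>2"
      using assms(2) by eventually_elim simp
  qed (use g in measurable)
  with g show ?thesis by (simp add: L2_def)
qed

lemma L2_inner_cong_AE:
  assumes "f \<in> L2 \<Omega>" "g \<in> L2 \<Omega>" "h \<in> L2 \<Omega>" "AE x in lebesgue_on \<Omega>. f x = g x"
  shows "L2_inner \<Omega> f h = L2_inner \<Omega> g h"
  unfolding L2_inner_def
proof (rule integral_cong_AE)
  show "AE x in lebesgue_on \<Omega>. f x \<bullet> h x = g x \<bullet> h x" using assms(4) by eventually_elim simp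
qed (rule borel_measurable_inner; rule L2_D(1); rule assms)+

lemma L2_sq_cong_AE:
  assumes "f \<in> L2 \<Omega>" "g \<in> L2 \<Omega>" "AE x in lebesgue_on \<Omega>. f x = g x"
  shows "L2_sq \<Omega> f = L2_sq \<Omega> g"
  unfolding L2_sq_eq_inner using L2_inner_cong_AE[OF assms(1,2,1,3)] L2_inner_cong_AE[OF assms(1,2,2,3)]
  by (simp add: L2_inner_commute)

lemma AE_eq_if_L2_sq_eq_0:
  assumes "f \<in> L2 \<Omega>" "g \<in> L2 \<Omega>" "L2_sq \<Omega> (\<lambda>x. f x - g x) = 0"
  shows "AE x in lebesgue_on \<Omega>. f x = g x"
proof -
  have "AE x in lebesgue_on \<Omega>. (norm (f x - g x))\<^sup>2 = 0"
    using assms L2_D[OF L2_diff[OF assms(1,2)]] by (subst integral_nonneg_eq_0_iff_AE[symmetric]) auto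
  then show ?thesis by eventually_elim simp
qed

lemma L2_bounded:
  fixes f :: "'a::euclidean_space \<Rightarrow> 'b::euclidean_space"
  assumes "\<Omega> \<in> lmeasurable" "f \<in> borel_measurable (lebesgue_on \<Omega>)" "AE x in lebesgue_on \<Omega>. norm (f x) \<le> B"
  shows "f \<in> L2 \<Omega>"
proof -
  interpret finite_measure "lebesgue_on \<Omega>" by (rule finite_measure_lebesgue_on[OF assms(1)])
  have "integrable (lebesgue_on \<Omega>) (\<lambda>x. (norm (f x))\<^sup>2)"
  proof (rule integrable_const_bound[where B="B\<^sup>2"])
    show "AE x in lebesgue_on \<Omega>. norm ((norm (f x))\<^sup>2) \<le> B\<^sup>2"
      using assms(3) by eventually_elim (auto intro: power_mono)
  qed (use assms(2) in measurable)
  then show ?thesis using assms(2) by (simp add: L2_def)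
qed

lemma L2_imp_integrable:
  fixes f :: "'a::euclidean_space \<Rightarrow> 'b::euclidean_space"
  assumes "\<Omega> \<in> lmeasurable" "f \<in> L2 \<Omega>"
  shows "integrable (lebesgue_on \<Omega>) f"
proof -
  interpret finite_measure "lebesgue_on \<Omega>" by (rule finite_measure_lebesgue_on[OF assms(1)])
  show ?thesis
  proof (rule Bochner_Integration.integrable_bound)
    show "integrable (lebesgue_on \<Omega>) (\<lambda>x. 1 + (norm (f x))\<^sup>2)"
      using L2_D[OF assms(2)] by simp
    show "f \<in> borel_measurable (lebesgue_on \<Omega>)" using L2_D[OF assms(2)] by simp
    have "t \<le> 1 + t\<^sup>2" for t :: real using sum_squares_bound[of 1 t] zero_le_power2[of t]
      by (cases "t \<ge> 0") (simp, linarith)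
    then show "AE x in lebesgue_on \<Omega>. norm (f x) \<le> norm (1 + (norm (f x))\<^sup>2)" by simp
  qed
qed

lemma integrable_lebesgue_on_subset:
  fixes f :: "'a::euclidean_space \<Rightarrow> 'b::euclidean_space"
  assumes "integrable (lebesgue_on \<Omega>) f" "K \<subseteq> \<Omega>" "K \<in> sets lebesgue" "\<Omega> \<in> sets lebesgue"
  shows "integrable (lebesgue_on K) f"
proof -
  have "integrable lebesgue (\<lambda>x. indicator K x *\<^sub>R (indicator \<Omega> x *\<^sub>R f x))"
    using assms(1,4) by (intro integrable_mult_indicator[OF assms(3)])
      (simp add: integrable_restrict_space del: real_scaleR_def)
  moreover have "(\<lambda>x. indicator K x *\<^sub>R (indicator \<Omega> x *\<^sub>R f x)) = (\<lambda>x. indicator K x *\<^sub>R f x)"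
    using assms(2) by (auto simp: indicator_def fun_eq_iff)
  ultimately show ?thesis using assms by (simp add: integrable_restrict_space)
qed

lemma integrable_imp_locally_integrable:
  fixes f :: "'a::euclidean_space \<Rightarrow> 'b::euclidean_space"
  assumes "integrable (lebesgue_on \<Omega>) f" "\<Omega> \<in> sets lebesgue"
  shows "locally_integrable \<Omega> f"
  unfolding locally_integrable_def
  using integrable_lebesgue_on_subset[OF assms(1) _ _ assms(2)] by (auto simp: compact_imp_closed)

lemma continuous_supported_L2:
  fixes f :: "'a::euclidean_space \<Rightarrow> 'b::euclidean_space"
  assumes "\<Omega> \<in> lmeasurable" "continuous_on UNIV f" "compact K" "\<And>x. x \<notin> K \<Longrightarrow> f x = 0"
  shows "f \<in> L2 \<Omega>"
proof -
  have "bounded (f ` K)"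
    by (intro compact_imp_bounded compact_continuous_image assms continuous_on_subset[OF assms(2)]) simp
  then obtain B where "B > 0" "\<And>x. x \<in> K \<Longrightarrow> norm (f x) \<le> B" unfolding bounded_pos by auto
  then have "norm (f x) \<le> B" for x using assms(4)[of x] by (cases "x \<in> K") auto
  moreover have "f \<in> borel_measurable lebesgue"
    using borel_measurable_continuous_onI[OF assms(2)] by (auto intro: measurable_completion)
  ultimately show ?thesis
    by (intro L2_bounded[OF assms(1), of f B] measurable_restrict_space1) auto
qed

lemma test_functions_L2:
  assumes "\<Omega> \<in> lmeasurable" "\<phi> \<in> test_functions \<Omega>"
  shows "\<phi> \<in> L2 \<Omega>" "grad \<phi> \<in> L2 \<Omega>"
proof -
  obtain K where K: "smooth \<phi>" "compact K" "K \<subseteq> \<Omega>" "\<And>x. x \<notin> K \<Longrightarrow> \<phi> x = 0"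
    "\<And>x b. x \<notin> K \<Longrightarrow> pd b \<phi> x = 0"
    by (rule test_functionsE[OF assms(2)]) blast
  show "\<phi> \<in> L2 \<Omega>"
    by (rule continuous_supported_L2[OF assms(1) smooth_continuous[OF K(1)] K(2,4)])
  show "grad \<phi> \<in> L2 \<Omega>"
  proof (rule continuous_supported_L2[OF assms(1) _ K(2)])
    show "continuous_on UNIV (grad \<phi>)" unfolding grad_def[abs_def]
      by (intro continuous_intros smooth_continuous smooth_pd K)
  qed (simp add: grad_def K(5))
qed

lemma L2_inner_tendsto:
  assumes "\<And>n. f n \<in> L2 \<Omega>" "g \<in> L2 \<Omega>" "h \<in> L2 \<Omega>"
    and lim: "(\<lambda>n. L2_sq \<Omega> (\<lambda>x. f n x - g x)) \<longlonglongrightarrow> 0"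
  shows "(\<lambda>n. L2_inner \<Omega> (f n) h) \<longlonglongrightarrow> L2_inner \<Omega> g h"
proof -
  have "(\<lambda>n. (L2_inner \<Omega> (f n) h - L2_inner \<Omega> g h)\<^sup>2) \<longlonglongrightarrow> 0"
  proof (rule tendsto_sandwich[OF _ _ tendsto_const])
    show "\<forall>\<^sub>F n in sequentially. (L2_inner \<Omega> (f n) h - L2_inner \<Omega> g h)\<^sup>2 \<le>
        L2_sq \<Omega> (\<lambda>x. f n x - g x) * L2_sq \<Omega> h"
      using L2_Cauchy_Schwarz[OF L2_diff[OF assms(1,2)] assms(3)]
      by (simp add: L2_inner_diff_left assms)
    show "(\<lambda>n. L2_sq \<Omega> (\<lambda>x. f n x - g x) * L2_sq \<Omega> h) \<longlonglongrightarrow> 0"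
      using tendsto_mult_left_zero[OF lim] by simp
  qed simp
  then have "(\<lambda>n. sqrt ((L2_inner \<Omega> (f n) h - L2_inner \<Omega> g h)\<^sup>2)) \<longlonglongrightarrow> sqrt 0"
    by (rule tendsto_real_sqrt)
  then have "(\<lambda>n. L2_inner \<Omega> (f n) h - L2_inner \<Omega> g h) \<longlonglongrightarrow> 0"
    by (simp add: tendsto_rabs_zero_iff)
  then show ?thesis by (simp add: LIM_zero_iff)
qed

text \<open>Riesz-Fischer through a rapidly Cauchy subsequence: its increments are summable in the
  mean, hence almost everywhere, and Fatou's lemma carries the Cauchy estimate over to the pointwise
  limit of the subsequence.\<close>

lemma L2_complete:
  fixes f :: "nat \<Rightarrow> 'a::euclidean_space \<Rightarrow> 'b::euclidean_space"
  assumes \<Omega>: "\<Omega> \<in> lmeasurable" and f: "\<And>n. f n \<in> L2 \<Omega>"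
    and Cauchy: "\<And>e. e > 0 \<Longrightarrow> \<exists>N. \<forall>m\<ge>N. \<forall>n\<ge>N. L2_sq \<Omega> (\<lambda>x. f m x - f n x) < e"
  obtains g where "g \<in> L2 \<Omega>" "(\<lambda>n. L2_sq \<Omega> (\<lambda>x. f n x - g x)) \<longlonglongrightarrow> 0"
proof -
  let ?M = "lebesgue_on \<Omega>"
  interpret finite_measure ?M by (rule finite_measure_lebesgue_on[OF \<Omega>])
  have fm[measurable]: "f n \<in> borel_measurable ?M" for n
    by (rule L2_D(1)[OF f])
  have "\<forall>k. \<exists>N. \<forall>m\<ge>N. \<forall>n\<ge>N. L2_sq \<Omega> (\<lambda>x. f m x - f n x) < (1/4) ^ k"
    using Cauchy by simp
  then obtain N where "\<forall>k. \<forall>m\<ge>N k. \<forall>n\<ge>N k. L2_sq \<Omega> (\<lambda>x. f m x - f n x) < (1/4) ^ k"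
    by (rule choice[THEN exE])
  then have N: "\<And>k m n. m \<ge> N k \<Longrightarrow> n \<ge> N k \<Longrightarrow> L2_sq \<Omega> (\<lambda>x. f m x - f n x) < (1/4) ^ k"
    by blast
  \<comment> \<open>Adding up the thresholds makes \<open>R j\<close> exceed every
    \<open>N k\<close> with \<open>k \<le> j\<close>; the summand \<open>k\<close> makes
    \<open>R\<close> unbounded, which the application of Fatou's lemma needs.\<close>
  define R where "R = (\<lambda>k. k + (\<Sum>j\<le>k. N j))"
  have R: "N k \<le> R j" if "k \<le> j" for k j
    unfolding R_def using that by (intro trans_le_add2 member_le_sum) auto
  define h where "h = (\<lambda>k x. f (R (Suc k)) x - f (R k) x)"
  have hL: "h k \<in> L2 \<Omega>" for k unfolding h_def by (intro L2_diff f)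
  have hm[measurable]: "h k \<in> borel_measurable ?M" for k
    by (rule L2_D(1)[OF hL])
  define \<mu> where "\<mu> = measure ?M (space ?M)"
  \<comment> \<open>Young's inequality with weight \<open>2 ^ k\<close> trades the bound
    \<open>(1/4) ^ k\<close> on the square for the summable bound \<open>(1/2) ^ k\<close> on the
    mean; the constant term costs the finite measure \<open>\<mu>\<close>.\<close>
  have h1: "(LINT x|?M. norm (h k x)) \<le> (1 + \<mu>) * (1/2) ^ k" for k
  proof -
    have "(LINT x|?M. norm (h k x)) \<le> (LINT x|?M. 2 ^ k * (norm (h k x))\<^sup>2 + (1/2) ^ k)"
    proof (rule integral_mono)
      show "integrable ?M (\<lambda>x. norm (h k x))" by (intro integrable_norm L2_imp_integrable \<Omega> hL)
      show "integrable ?M (\<lambda>x. 2 ^ k * (norm (h k x))\<^sup>2 + (1/2) ^ k)" using L2_D(2)[OF hL] by simp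
      fix x
      let ?t = "norm (h k x)"
      have "0 \<le> (2 ^ k * ?t - 1)\<^sup>2" by simp
      also have "\<dots> = 2 ^ k * (2 ^ k * ?t\<^sup>2 - 2 * ?t + (1/2) ^ k)"
        by (simp add: power2_eq_square algebra_simps power_divide)
      finally have "0 \<le> 2 ^ k * ?t\<^sup>2 - 2 * ?t + (1/2) ^ k"
        using zero_less_power[of "2::real" k] unfolding zero_le_mult_iff by linarith
      then show "?t \<le> 2 ^ k * ?t\<^sup>2 + (1/2) ^ k" using norm_ge_zero[of "h k x"] by linarith
    qed
    also have "\<dots> = 2 ^ k * L2_sq \<Omega> (h k) + \<mu> * (1/2) ^ k"
      using L2_D(2)[OF hL] by (simp add: \<mu>_def)
    also have "\<dots> \<le> 2 ^ k * (1/4) ^ k + \<mu> * (1/2) ^ k"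
      using N[of k "R (Suc k)" "R k"] R[of k "Suc k"] R[of k k] unfolding h_def
      by (intro add_right_mono mult_left_mono less_imp_le) auto
    also have "(2::real) ^ k * (1/4) ^ k = (1/2) ^ k" by (simp flip: power_mult_distrib)
    finally show ?thesis by (simp add: algebra_simps)
  qed
  have "(\<integral>\<^sup>+x. (\<Sum>k. ennreal (norm (h k x))) \<partial>?M) = (\<Sum>k. \<integral>\<^sup>+x. ennreal (norm (h k x)) \<partial>?M)"
    by (rule nn_integral_suminf) measurable
  also have "\<dots> = (\<Sum>k. ennreal (LINT x|?M. norm (h k x)))"
    by (intro suminf_cong nn_integral_eq_integral) (auto intro!: integrable_norm L2_imp_integrable \<Omega> hL)
  also have "\<dots> \<le> (\<Sum>k. ennreal ((1 + \<mu>) * (1/2) ^ k))"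
    by (intro suminf_le ennreal_leI h1) auto
  also have "\<dots> = ennreal (\<Sum>k. (1 + \<mu>) * (1/2) ^ k)"
    by (intro suminf_ennreal2) (auto simp: \<mu>_def summable_mult)
  also have "\<dots> < \<infinity>" by simp
  finally have fin: "(\<integral>\<^sup>+x. (\<Sum>k. ennreal (norm (h k x))) \<partial>?M) < \<infinity>" .
  have "(\<lambda>x. \<Sum>k. ennreal (norm (h k x))) \<in> borel_measurable ?M" by measurable
  from nn_integral_PInf_AE[OF this] fin have "AE x in ?M. (\<Sum>k. ennreal (norm (h k x))) \<noteq> \<infinity>"
    by simp
  then have conv: "AE x in ?M. convergent (\<lambda>k. f (R k) x)"
  proof eventually_elim
    fix x assume "(\<Sum>k. ennreal (norm (h k x))) \<noteq> \<infinity>"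
    then have "summable (\<lambda>k. norm (h k x))"
      by (intro summable_suminf_not_top) auto
    then have "summable (\<lambda>k. f (R (Suc k)) x - f (R k) x)"
      unfolding h_def by (rule summable_norm_cancel)
    then have "convergent (\<lambda>k. f (R k) x - f (R 0) x)"
      unfolding summable_iff_convergent sum_lessThan_telescope[of "\<lambda>k. f (R k) x"] .
    from convergent_add[OF this convergent_const[of "f (R 0) x"]]
    show "convergent (\<lambda>k. f (R k) x)" by simp
  qed
  define g where "g = (\<lambda>x. lim (\<lambda>k. f (R k) x))"
  have gm[measurable]: "g \<in> borel_measurable ?M" unfolding g_def by measurable
  have g: "AE x in ?M. (\<lambda>k. f (R k) x) \<longlonglongrightarrow> g x"
    using conv by eventually_elim (simp add: g_def convergent_LIMSEQ_iff)
  have main: "integrable ?M (\<lambda>x. (norm (f n x - g x))\<^sup>2)" "L2_sq \<Omega> (\<lambda>x. f n x - g x) \<le> e"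
    if e: "e > 0" and n: "\<And>m. m \<ge> N0 \<Longrightarrow> L2_sq \<Omega> (\<lambda>x. f n x - f m x) < e" for n e N0
  proof -
    have "(\<integral>\<^sup>+x. ennreal ((norm (f n x - g x))\<^sup>2) \<partial>?M) \<le>
        (\<integral>\<^sup>+x. liminf (\<lambda>k. ennreal ((norm (f n x - f (R k) x))\<^sup>2)) \<partial>?M)"
    proof (rule nn_integral_mono_AE)
      show "AE x in ?M. ennreal ((norm (f n x - g x))\<^sup>2) \<le> liminf (\<lambda>k. ennreal ((norm (f n x - f (R k) x))\<^sup>2))"
        using g
      proof eventually_elim
        fix x assume "(\<lambda>k. f (R k) x) \<longlonglongrightarrow> g x"
        then have "(\<lambda>k. ennreal ((norm (f n x - f (R k) x))\<^sup>2)) \<longlonglongrightarrow> ennreal ((norm (f n x - g x))\<^sup>2)"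
          by (intro tendsto_intros)
        then show "ennreal ((norm (f n x - g x))\<^sup>2) \<le> liminf (\<lambda>k. ennreal ((norm (f n x - f (R k) x))\<^sup>2))"
          using lim_imp_Liminf[OF sequentially_bot] by fastforce
      qed
    qed
    also have "\<dots> \<le> liminf (\<lambda>k. \<integral>\<^sup>+x. ennreal ((norm (f n x - f (R k) x))\<^sup>2) \<partial>?M)"
      by (rule nn_integral_liminf) measurable
    also have "\<dots> \<le> ennreal e"
    proof -
      have *: "(\<integral>\<^sup>+x. ennreal ((norm (f n x - f m x))\<^sup>2) \<partial>?M) = ennreal (L2_sq \<Omega> (\<lambda>x. f n x - f m x))" for m
        using L2_D(2)[OF L2_diff[OF f f]] by (intro nn_integral_eq_integral) auto
      have "liminf (\<lambda>k. \<integral>\<^sup>+x. ennreal ((norm (f n x - f (R k) x))\<^sup>2) \<partial>?M) \<le> liminf (\<lambda>k::nat. ennreal e)"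
      proof (rule Liminf_mono, rule eventually_sequentiallyI)
        fix k assume "N0 \<le> k"
        then have "N0 \<le> R k" by (simp add: R_def)
        then show "(\<integral>\<^sup>+x. ennreal ((norm (f n x - f (R k) x))\<^sup>2) \<partial>?M) \<le> ennreal e"
          unfolding * using n by (intro ennreal_leI less_imp_le)
      qed
      then show ?thesis by (simp add: Liminf_const)
    qed
    finally have le: "(\<integral>\<^sup>+x. ennreal ((norm (f n x - g x))\<^sup>2) \<partial>?M) \<le> ennreal e" .
    show 1: "integrable ?M (\<lambda>x. (norm (f n x - g x))\<^sup>2)"
      using le by (intro integrableI_bounded) (measurable, auto simp: le_less_trans)
    show "L2_sq \<Omega> (\<lambda>x. f n x - g x) \<le> e"
      using le e nn_integral_eq_integral[OF 1] by (simp add: ennreal_le_iff)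
  qed
  show ?thesis
  proof (rule that[of g])
    obtain N0 where N0: "\<And>m n. m \<ge> N0 \<Longrightarrow> n \<ge> N0 \<Longrightarrow> L2_sq \<Omega> (\<lambda>x. f m x - f n x) < 1"
      using Cauchy[of 1] by auto
    have "integrable ?M (\<lambda>x. (norm (f N0 x - g x))\<^sup>2)"
      by (rule main(1)[of 1 N0]) (use N0 in auto)
    then have "(\<lambda>x. f N0 x - g x) \<in> L2 \<Omega>" by (simp add: L2_def)
    from L2_diff[OF f[of N0] this] show "g \<in> L2 \<Omega>" by simp
    show "(\<lambda>n. L2_sq \<Omega> (\<lambda>x. f n x - g x)) \<longlonglongrightarrow> 0"
    proof (rule LIMSEQ_I)
      fix r :: real assume r: "0 < r"
      obtain N1 where N1: "\<And>m n. m \<ge> N1 \<Longrightarrow> n \<ge> N1 \<Longrightarrow> L2_sq \<Omega> (\<lambda>x. f m x - f n x) < r / 2"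
        using Cauchy[of "r / 2"] r by auto
      have "L2_sq \<Omega> (\<lambda>x. f n x - g x) \<le> r / 2" if "n \<ge> N1" for n
        by (rule main(2)[of "r / 2" N1]) (use N1 that r in auto)
      then show "\<exists>no. \<forall>n\<ge>no. norm (L2_sq \<Omega> (\<lambda>x. f n x - g x) - 0) < r"
        using r by (intro exI[of _ N1]) (auto intro: le_less_trans[of _ "r/2"])
    qed
  qed
qed

section \<open>Weak gradients\<close>

text \<open>The bumps tend to the indicator of the open box, the faces are null, and
  \<open>f\<close> restricted to the closed box dominates. This turns information on test functions
  into information on cubes.\<close>

lemma bump_integral_tendsto:
  fixes f :: "'a::euclidean_space \<Rightarrow> real"
  assumes f: "locally_integrable \<Omega> f" and ab: "cbox a b \<subseteq> \<Omega>" and \<Omega>: "\<Omega> \<in> sets lebesgue"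
  shows "(\<lambda>n. LINT x|lebesgue_on \<Omega>. bump a b n x * f x) \<longlonglongrightarrow> (LINT x|lebesgue_on (cbox a b). f x)"
proof -
  define F where "F = (\<lambda>x. indicator (cbox a b) x * f x)"
  have F: "integrable lebesgue F"
    using f ab unfolding locally_integrable_def F_def
    by (auto simp: integrable_restrict_space compact_cbox dest!: spec[of _ "cbox a b"])
  have eq: "(LINT x|lebesgue_on \<Omega>. bump a b n x * f x) = (LINT x|lebesgue. bump a b n x * F x)" for n
  proof -
    have *: "bump a b n x = 0" if "x \<notin> cbox a b" for x
      using bump_eq_0 that box_subset_cbox by blast
    have "(LINT x|lebesgue_on \<Omega>. bump a b n x * f x) = (LINT x|lebesgue. bump a b n x * f x)"
      by (rule integral_lebesgue_on_supported[OF \<Omega>]) (use * ab in auto)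
    also have "\<dots> = (LINT x|lebesgue. bump a b n x * F x)"
      by (rule Bochner_Integration.integral_cong) (use * in \<open>auto simp: F_def indicator_def\<close>)
    finally show ?thesis .
  qed
  have "(\<lambda>n. LINT x|lebesgue. bump a b n x * F x) \<longlonglongrightarrow> (LINT x|lebesgue. F x)"
  proof (rule integral_dominated_convergence[OF _ _ integrable_norm[OF F]])
    have bm: "bump a b n \<in> borel_measurable lebesgue" for n
      using borel_measurable_continuous_onI[OF smooth_continuous[OF smooth_bump[of a b n]]]
      by (auto intro: measurable_completion)
    show "(\<lambda>x. bump a b n x * F x) \<in> borel_measurable lebesgue" for n
      by (intro borel_measurable_times bm borel_measurable_integrable F)
    have "AE x in lebesgue. x \<notin> cbox a b - box a b"
      using negligible_frontier_interval[of a b] unfolding negligible_iff_null_sets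
      by (rule AE_not_in)
    then show "AE x in lebesgue. (\<lambda>n. bump a b n x * F x) \<longlonglongrightarrow> F x"
    proof eventually_elim
      fix x assume x: "x \<notin> cbox a b - box a b"
      have "(\<lambda>n. bump a b n x * F x) \<longlonglongrightarrow> indicator (box a b) x * F x"
        by (intro tendsto_mult bump_tendsto tendsto_const)
      moreover have "indicator (box a b) x * F x = F x"
        using x by (auto simp: F_def indicator_def)
      ultimately show "(\<lambda>n. bump a b n x * F x) \<longlonglongrightarrow> F x" by simp
    qed
    show "AE x in lebesgue. norm (bump a b n x * F x) \<le> norm (F x)" for n
      using bump_bounds[of a b n] by (intro AE_I2) (auto simp: abs_mult intro!: mult_left_le_one_le)
  qed (rule borel_measurable_integrable[OF F])
  moreover have "(LINT x|lebesgue. F x) = (LINT x|lebesgue_on (cbox a b). f x)"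
    by (simp add: F_def integral_restrict_space)
  ultimately show ?thesis by (simp add: eq)
qed

lemma Ck_linear: "Ck k (\<lambda>x. x \<bullet> b)"
proof (cases k)
  case 0
  then show ?thesis by (auto intro!: continuous_intros)
next
  case (Suc j)
  have D: "((\<lambda>x. x \<bullet> b) has_derivative (\<lambda>h. h \<bullet> b)) (at x)" for x
    by (auto intro!: derivative_eq_intros)
  then have "pd c (\<lambda>x. x \<bullet> b) = (\<lambda>x. c \<bullet> b)" for c
    by (intro ext) (simp add: pd_eqI[OF D])
  then show ?thesis using Suc D by (auto simp: Ck_const differentiable_def)
qed

locale bounded_domain =
  fixes \<Omega> :: "'a::euclidean_space set"
  assumes open_domain: "open \<Omega>" and bounded_domain: "bounded \<Omega>"
begin

lemma lmeasurable_domain: "\<Omega> \<in> lmeasurable"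
  by (rule lmeasurable_open[OF bounded_domain open_domain])

lemma sets_domain [simp]: "\<Omega> \<in> sets lebesgue"
  using lmeasurable_domain by blast

lemma L2_integrable:
  fixes f :: "'a \<Rightarrow> 'b::euclidean_space"
  assumes "f \<in> L2 \<Omega>" shows "integrable (lebesgue_on \<Omega>) f"
  by (rule L2_imp_integrable[OF lmeasurable_domain assms])

lemma L2_locally_integrable:
  fixes f :: "'a \<Rightarrow> 'b::euclidean_space"
  assumes "f \<in> L2 \<Omega>" shows "locally_integrable \<Omega> f"
  by (rule integrable_imp_locally_integrable[OF L2_integrable[OF assms] sets_domain])

lemma test_L2:
  assumes "\<phi> \<in> test_functions \<Omega>" shows "\<phi> \<in> L2 \<Omega>" "grad \<phi> \<in> L2 \<Omega>"
  by (rule test_functions_L2[OF lmeasurable_domain assms])+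

text \<open>A one-sided fundamental lemma of the calculus of variations: bumps concentrate on cubes,
  and the differentiation result with \<open>c = 0\<close> recovers the sign.\<close>

lemma AE_nonpos_if_test_integrals_nonpos:
  assumes f: "locally_integrable \<Omega> f"
    and le: "\<And>\<phi>. \<phi> \<in> test_functions \<Omega> \<Longrightarrow> (\<And>x. 0 \<le> \<phi> x) \<Longrightarrow> (LINT x|lebesgue_on \<Omega>. \<phi> x * f x) \<le> 0"
  shows "AE x in lebesgue_on \<Omega>. f x \<le> 0"
proof (rule AE_le_if_cube_integrals_le[OF f open_domain], intro exI[of _ 1] conjI allI impI)
  fix x h assume "0 < h \<and> h < 1 \<and> cbox x (x + h *\<^sub>R One) \<subseteq> \<Omega>"
  then have sub: "cbox x (x + h *\<^sub>R One) \<subseteq> \<Omega>" by blast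
  have "(LINT y|lebesgue_on (cbox x (x + h *\<^sub>R One)). f y) \<le> 0"
    by (rule LIMSEQ_le_const2[OF bump_integral_tendsto[OF f sub sets_domain]])
      (use le[OF bump_test_function[OF sub]] bump_bounds in blast)
  then show "(LINT y|lebesgue_on (cbox x (x + h *\<^sub>R One)). f y) \<le> 0 * h ^ DIM('a)" by simp
qed simp

lemma AE_zero_if_test_integrals_zero:
  assumes f: "locally_integrable \<Omega> f"
    and eq: "\<And>\<phi>. \<phi> \<in> test_functions \<Omega> \<Longrightarrow> (LINT x|lebesgue_on \<Omega>. \<phi> x * f x) = 0"
  shows "AE x in lebesgue_on \<Omega>. f x = 0"
proof -
  have 1: "AE x in lebesgue_on \<Omega>. f x \<le> 0"
    by (rule AE_nonpos_if_test_integrals_nonpos[OF f]) (simp add: eq)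
  have nf: "locally_integrable \<Omega> (\<lambda>x. - f x)" using f unfolding locally_integrable_def by simp
  have 2: "AE x in lebesgue_on \<Omega>. - f x \<le> 0"
    by (rule AE_nonpos_if_test_integrals_nonpos[OF nf]) (simp add: eq)
  show ?thesis using 1 2 by eventually_elim simp
qed

lemma test_pairing_component:
  assumes \<phi>: "\<phi> \<in> test_functions \<Omega>" and b: "b \<in> Basis"
  shows "locally_integrable \<Omega> v \<Longrightarrow>
      (LINT x|lebesgue_on \<Omega>. v x *\<^sub>R grad \<phi> x) \<bullet> b = (LINT x|lebesgue_on \<Omega>. pd b \<phi> x * v x)"
    and "locally_integrable \<Omega> g \<Longrightarrow>
      (LINT x|lebesgue_on \<Omega>. \<phi> x *\<^sub>R g x) \<bullet> b = (LINT x|lebesgue_on \<Omega>. \<phi> x * (g x \<bullet> b))"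
proof -
  assume v: "locally_integrable \<Omega> v"
  have "integrable (lebesgue_on \<Omega>) (\<lambda>x. pd c \<phi> x * v x)" if "c \<in> Basis" for c
    using integrable_test[OF v sets_domain test_functions_pd[OF \<phi> that]] by simp
  then have "integrable (lebesgue_on \<Omega>) (\<lambda>x. \<Sum>c\<in>Basis. (pd c \<phi> x * v x) *\<^sub>R c)"
    by (intro Bochner_Integration.integrable_sum integrable_scaleR_left) auto
  moreover have "(\<lambda>x. \<Sum>c\<in>Basis. (pd c \<phi> x * v x) *\<^sub>R c) = (\<lambda>x. v x *\<^sub>R grad \<phi> x)"
    by (simp add: grad_def scaleR_sum_right mult.commute)
  ultimately have "integrable (lebesgue_on \<Omega>) (\<lambda>x. v x *\<^sub>R grad \<phi> x)" by simp
  from integral_inner_left[OF this, of b]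
  show "(LINT x|lebesgue_on \<Omega>. v x *\<^sub>R grad \<phi> x) \<bullet> b = (LINT x|lebesgue_on \<Omega>. pd b \<phi> x * v x)"
    using b by (simp add: grad_inner mult.commute)
next
  assume "locally_integrable \<Omega> g"
  from integral_inner_left[OF integrable_test[OF this sets_domain \<phi>], of b]
  show "(LINT x|lebesgue_on \<Omega>. \<phi> x *\<^sub>R g x) \<bullet> b = (LINT x|lebesgue_on \<Omega>. \<phi> x * (g x \<bullet> b))"
    by simp
qed

lemma has_weak_gradient_component:
  assumes g: "has_weak_gradient \<Omega> v g" and \<phi>: "\<phi> \<in> test_functions \<Omega>" and b: "b \<in> Basis"
  shows "(LINT x|lebesgue_on \<Omega>. pd b \<phi> x * v x) = - (LINT x|lebesgue_on \<Omega>. \<phi> x * (g x \<bullet> b))"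
proof -
  have li: "locally_integrable \<Omega> v" "locally_integrable \<Omega> g"
    and eq: "(LINT x|lebesgue_on \<Omega>. v x *\<^sub>R grad \<phi> x) = - (LINT x|lebesgue_on \<Omega>. \<phi> x *\<^sub>R g x)"
    using g \<phi> by (auto simp: has_weak_gradient_def)
  have "(LINT x|lebesgue_on \<Omega>. pd b \<phi> x * v x) = (LINT x|lebesgue_on \<Omega>. v x *\<^sub>R grad \<phi> x) \<bullet> b"
    by (rule test_pairing_component(1)[OF \<phi> b li(1), symmetric])
  also have "\<dots> = - ((LINT x|lebesgue_on \<Omega>. \<phi> x *\<^sub>R g x) \<bullet> b)" unfolding eq by (rule inner_minus_left)
  also have "\<dots> = - (LINT x|lebesgue_on \<Omega>. \<phi> x * (g x \<bullet> b))"
    by (simp only: test_pairing_component(2)[OF \<phi> b li(2)])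
  finally show ?thesis .
qed

lemma has_weak_gradientI:
  assumes v: "integrable (lebesgue_on \<Omega>) v" and g: "integrable (lebesgue_on \<Omega>) g"
    and eq: "\<And>\<phi> b. \<phi> \<in> test_functions \<Omega> \<Longrightarrow> b \<in> Basis \<Longrightarrow>
      (LINT x|lebesgue_on \<Omega>. pd b \<phi> x * v x) = - (LINT x|lebesgue_on \<Omega>. \<phi> x * (g x \<bullet> b))"
  shows "has_weak_gradient \<Omega> v g"
proof -
  have li: "locally_integrable \<Omega> v" "locally_integrable \<Omega> g"
    by (rule integrable_imp_locally_integrable[OF v sets_domain] integrable_imp_locally_integrable[OF g sets_domain])+
  have "(LINT x|lebesgue_on \<Omega>. v x *\<^sub>R grad \<phi> x) = - (LINT x|lebesgue_on \<Omega>. \<phi> x *\<^sub>R g x)"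
    if \<phi>: "\<phi> \<in> test_functions \<Omega>" for \<phi>
  proof (rule euclidean_eqI)
    fix b :: 'a assume b: "b \<in> Basis"
    show "(LINT x|lebesgue_on \<Omega>. v x *\<^sub>R grad \<phi> x) \<bullet> b = (- (LINT x|lebesgue_on \<Omega>. \<phi> x *\<^sub>R g x)) \<bullet> b"
      unfolding inner_minus_left test_pairing_component(1)[OF \<phi> b li(1)] test_pairing_component(2)[OF \<phi> b li(2)]
      by (rule eq[OF \<phi> b])
  qed
  with li show ?thesis by (simp add: has_weak_gradient_def)
qed

lemma has_weak_gradient_unique:
  assumes g: "has_weak_gradient \<Omega> v g" and g': "has_weak_gradient \<Omega> v g'"
  shows "AE x in lebesgue_on \<Omega>. g x = g' x"
proof -
  have "AE x in lebesgue_on \<Omega>. (g x - g' x) \<bullet> b = 0" if b: "b \<in> Basis" for b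
  proof (rule AE_zero_if_test_integrals_zero)
    have li: "locally_integrable \<Omega> g" "locally_integrable \<Omega> g'"
      using g g' by (auto simp: has_weak_gradient_def)
    then show "locally_integrable \<Omega> (\<lambda>x. (g x - g' x) \<bullet> b)"
      unfolding locally_integrable_def by (auto intro!: integrable_inner_left)
    fix \<phi> assume \<phi>: "\<phi> \<in> test_functions \<Omega>"
    have "integrable (lebesgue_on \<Omega>) (\<lambda>x. (\<phi> x *\<^sub>R g x) \<bullet> b)" "integrable (lebesgue_on \<Omega>) (\<lambda>x. (\<phi> x *\<^sub>R g' x) \<bullet> b)"
      by (intro integrable_inner_left integrable_test li sets_domain \<phi>)+
    then show "(LINT x|lebesgue_on \<Omega>. \<phi> x * ((g x - g' x) \<bullet> b)) = 0"
      using has_weak_gradient_component[OF g \<phi> b] has_weak_gradient_component[OF g' \<phi> b]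
      by (simp add: inner_diff_left right_diff_distrib)
  qed
  then have "AE x in lebesgue_on \<Omega>. \<forall>b\<in>Basis. (g x - g' x) \<bullet> b = 0"
    by (intro AE_finite_all[THEN iffD2]) auto
  then show ?thesis
  proof eventually_elim
    fix x assume "\<forall>b\<in>Basis. (g x - g' x) \<bullet> b = 0"
    then show "g x = g' x" by (subst euclidean_eq_iff) (simp add: inner_diff_left)
  qed
qed

text \<open>\<open>weak_grad\<close> is an arbitrary choice; by uniqueness almost everywhere any
  weak gradient at hand may replace it under an integral.\<close>

lemma weak_grad_AE:
  assumes "has_weak_gradient \<Omega> v g"
  shows "AE x in lebesgue_on \<Omega>. weak_grad \<Omega> v x = g x"
proof -
  have "has_weak_gradient \<Omega> v (weak_grad \<Omega> v)"
    unfolding weak_grad_def using assms someI[of "has_weak_gradient \<Omega> v" g] by simp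
  from has_weak_gradient_unique[OF this assms] show ?thesis .
qed

lemma H1_D:
  assumes "v \<in> H1 \<Omega>"
  shows "v \<in> L2 \<Omega>" "has_weak_gradient \<Omega> v (weak_grad \<Omega> v)" "weak_grad \<Omega> v \<in> L2 \<Omega>"
  using assms someI[of "has_weak_gradient \<Omega> v"] unfolding H1_def weak_grad_def by auto

lemma H1_I:
  assumes "v \<in> L2 \<Omega>" "has_weak_gradient \<Omega> v g" "g \<in> L2 \<Omega>"
  shows "v \<in> H1 \<Omega>"
proof -
  have "AE x in lebesgue_on \<Omega>. g x = weak_grad \<Omega> v x"
    using weak_grad_AE[OF assms(2)] by eventually_elim simp
  from L2_cong_AE[OF assms(3) this] assms show ?thesis by (auto simp: H1_def)
qed

text \<open>Integration by parts is the vanishing of the integral of a derivative, applied to the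
  compactly supported product of \<open>v\<close> and \<open>\<phi>\<close>.\<close>

lemma has_weak_gradient_test:
  assumes "v \<in> test_functions \<Omega>" shows "has_weak_gradient \<Omega> v (grad v)"
proof (rule has_weak_gradientI)
  note L = test_L2[OF assms]
  show "integrable (lebesgue_on \<Omega>) v" "integrable (lebesgue_on \<Omega>) (grad v)"
    using L by (auto intro: L2_integrable)
  fix \<phi> and b :: 'a assume \<phi>: "\<phi> \<in> test_functions \<Omega>" and b: "b \<in> Basis"
  have s: "smooth v" "smooth \<phi>" using assms \<phi> by (auto intro: test_functions_smooth)
  obtain K where K: "compact K" "K \<subseteq> \<Omega>" "\<And>x. x \<notin> K \<Longrightarrow> v x = 0"
    by (rule test_functionsE[OF assms]) blast
  have F: "(\<lambda>x. v x * \<phi> x) \<in> test_functions \<Omega>"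
    by (rule test_functionsI[OF _ K(1,2)]) (use s K in \<open>auto simp: smooth_def intro: Ck_mult\<close>)
  have pd: "pd b (\<lambda>x. v x * \<phi> x) = (\<lambda>x. v x * pd b \<phi> x + pd b v x * \<phi> x)"
    by (intro ext pd_mult smooth_differentiable s)
  have i: "integrable (lebesgue_on \<Omega>) (\<lambda>x. v x * pd b \<phi> x)"
    using integrable_L2_inner[OF L(1) test_L2(1)[OF test_functions_pd[OF \<phi> b]]]
    by simp
  have j: "integrable (lebesgue_on \<Omega>) (\<lambda>x. pd b v x * \<phi> x)"
    using integrable_L2_inner[OF test_L2(1)[OF test_functions_pd[OF assms b]]
      test_L2(1)[OF \<phi>]] by simp
  have "(LINT x|lebesgue_on \<Omega>. v x * pd b \<phi> x) + (LINT x|lebesgue_on \<Omega>. pd b v x * \<phi> x) = 0"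
    using integral_pd_eq_0[OF F sets_domain b] i j unfolding pd by simp
  then show "(LINT x|lebesgue_on \<Omega>. pd b \<phi> x * v x) = - (LINT x|lebesgue_on \<Omega>. \<phi> x * (grad v x \<bullet> b))"
    using b by (simp add: grad_inner mult.commute)
qed

lemma test_H1: "\<phi> \<in> test_functions \<Omega> \<Longrightarrow> \<phi> \<in> H1 \<Omega>"
  using H1_I has_weak_gradient_test test_L2 by blast

lemma has_weak_gradient_lincomb:
  assumes v: "v \<in> H1 \<Omega>" and w: "w \<in> H1 \<Omega>"
  shows "has_weak_gradient \<Omega> (\<lambda>x. v x + c * w x) (\<lambda>x. weak_grad \<Omega> v x + c *\<^sub>R weak_grad \<Omega> w x)"
proof (rule has_weak_gradientI)
  note V = H1_D[OF v] and W = H1_D[OF w]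
  note int = L2_integrable
  show "integrable (lebesgue_on \<Omega>) (\<lambda>x. v x + c * w x)"
    "integrable (lebesgue_on \<Omega>) (\<lambda>x. weak_grad \<Omega> v x + c *\<^sub>R weak_grad \<Omega> w x)"
    using int[OF V(1)] int[OF W(1)] int[OF V(3)] int[OF W(3)] by auto
  fix \<phi> and b :: 'a assume \<phi>: "\<phi> \<in> test_functions \<Omega>" and b: "b \<in> Basis"
  have "integrable (lebesgue_on \<Omega>) (\<lambda>x. pd b \<phi> x * u x)" if "u \<in> L2 \<Omega>" for u
    using integrable_L2_inner[OF test_L2(1)[OF test_functions_pd[OF \<phi> b]] that] by simp
  moreover have "integrable (lebesgue_on \<Omega>) (\<lambda>x. \<phi> x * (g x \<bullet> b))" if "g \<in> L2 \<Omega>" for g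
    using integrable_inner_left[OF integrable_test[OF integrable_imp_locally_integrable[OF int[OF that] sets_domain] sets_domain \<phi>]]
    by simp
  ultimately show "(LINT x|lebesgue_on \<Omega>. pd b \<phi> x * (v x + c * w x)) =
      - (LINT x|lebesgue_on \<Omega>. \<phi> x * ((weak_grad \<Omega> v x + c *\<^sub>R weak_grad \<Omega> w x) \<bullet> b))"
    using has_weak_gradient_component[OF V(2) \<phi> b] has_weak_gradient_component[OF W(2) \<phi> b] V W
    by (simp add: inner_add_left distrib_left mult.left_commute[of _ c])
qed

lemma H1_lincomb:
  assumes v: "v \<in> H1 \<Omega>" and w: "w \<in> H1 \<Omega>"
  shows "(\<lambda>x. v x + c * w x) \<in> H1 \<Omega>"
    "AE x in lebesgue_on \<Omega>. weak_grad \<Omega> (\<lambda>x. v x + c * w x) x = weak_grad \<Omega> v x + c *\<^sub>R weak_grad \<Omega> w x"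
proof -
  show "(\<lambda>x. v x + c * w x) \<in> H1 \<Omega>"
    using L2_lincomb[OF H1_D(1)[OF v] H1_D(1)[OF w], of c]
    by (intro H1_I[OF _ has_weak_gradient_lincomb[OF v w] L2_lincomb[OF H1_D(3)[OF v] H1_D(3)[OF w]]]) simp
  show "AE x in lebesgue_on \<Omega>. weak_grad \<Omega> (\<lambda>x. v x + c * w x) x = weak_grad \<Omega> v x + c *\<^sub>R weak_grad \<Omega> w x"
    by (rule weak_grad_AE[OF has_weak_gradient_lincomb[OF v w]])
qed

abbreviation energy :: "('a \<Rightarrow> real) \<Rightarrow> ('a \<Rightarrow> real) \<Rightarrow> real" where
  "energy v w \<equiv> L2_inner \<Omega> (weak_grad \<Omega> v) (weak_grad \<Omega> w)"

lemma energy_lincomb_left: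
  assumes "v \<in> H1 \<Omega>" "w \<in> H1 \<Omega>" "z \<in> H1 \<Omega>"
  shows "energy (\<lambda>x. v x + c * w x) z = energy v z + c * energy w z"
proof -
  have "energy (\<lambda>x. v x + c * w x) z =
      L2_inner \<Omega> (\<lambda>x. weak_grad \<Omega> v x + c *\<^sub>R weak_grad \<Omega> w x) (weak_grad \<Omega> z)"
    by (rule L2_inner_cong_AE) (auto intro!: H1_D(3) H1_lincomb assms L2_lincomb)
  also have "\<dots> = energy v z + c * energy w z"
    by (intro L2_inner_lincomb_left H1_D assms)
  finally show ?thesis .
qed

lemma energy_commute: "energy v w = energy w v"
  by (rule L2_inner_commute)

lemma energy_lincomb_right:
  assumes "v \<in> H1 \<Omega>" "w \<in> H1 \<Omega>" "z \<in> H1 \<Omega>"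
  shows "energy z (\<lambda>x. v x + c * w x) = energy z v + c * energy z w"
  using energy_lincomb_left[OF assms] by (simp add: energy_commute)

lemma energy_nonneg: "0 \<le> energy v v"
  using L2_sq_nonneg[of \<Omega> "weak_grad \<Omega> v"] by (simp only: L2_sq_eq_inner)

lemma energy_diff_diff:
  assumes "v \<in> H1 \<Omega>" "w \<in> H1 \<Omega>"
  shows "energy (\<lambda>x. v x - w x) (\<lambda>x. v x - w x) = L2_sq \<Omega> (\<lambda>x. weak_grad \<Omega> v x - weak_grad \<Omega> w x)"
proof -
  have "AE x in lebesgue_on \<Omega>. weak_grad \<Omega> (\<lambda>x. v x - w x) x = weak_grad \<Omega> v x - weak_grad \<Omega> w x"
    using H1_lincomb(2)[OF assms, of "-1"] by simp
  then have "L2_sq \<Omega> (weak_grad \<Omega> (\<lambda>x. v x - w x)) = L2_sq \<Omega> (\<lambda>x. weak_grad \<Omega> v x - weak_grad \<Omega> w x)"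
    using H1_lincomb(1)[OF assms, of "-1"] by (intro L2_sq_cong_AE L2_diff H1_D assms) auto
  then show ?thesis by (simp only: L2_sq_eq_inner)
qed

lemma energy_Cauchy_Schwarz:
  assumes "v \<in> H1 \<Omega>" "w \<in> H1 \<Omega>"
  shows "(energy v w)\<^sup>2 \<le> energy v v * energy w w"
  using L2_Cauchy_Schwarz[OF H1_D(3)[OF assms(1)] H1_D(3)[OF assms(2)]] by (simp only: L2_sq_eq_inner)


section \<open>The space \<open>H10\<close>, the Poincare inequality and completeness\<close>

lemma H10_D:
  assumes "v \<in> H10 \<Omega>"
  shows "v \<in> H1 \<Omega>" "v \<in> L2 \<Omega>" "has_weak_gradient \<Omega> v (weak_grad \<Omega> v)" "weak_grad \<Omega> v \<in> L2 \<Omega>"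
  using assms H1_D unfolding H10_def by auto

lemma H10_approx:
  assumes "v \<in> H10 \<Omega>"
  obtains \<phi> where "\<And>n. \<phi> n \<in> test_functions \<Omega>" "(\<lambda>n. L2_sq \<Omega> (\<lambda>x. v x - \<phi> n x)) \<longlonglongrightarrow> 0"
    "(\<lambda>n. L2_sq \<Omega> (\<lambda>x. weak_grad \<Omega> v x - grad (\<phi> n) x)) \<longlonglongrightarrow> 0"
  using assms unfolding H10_def by auto

text \<open>The approximation may be checked against any weak gradient \<open>g\<close> at hand
  instead of the chosen \<open>weak_grad \<Omega> v\<close>.\<close>

lemma H10_I:
  assumes "v \<in> L2 \<Omega>" "has_weak_gradient \<Omega> v g" "g \<in> L2 \<Omega>" "\<And>n. \<phi> n \<in> test_functions \<Omega>"
    and 1: "(\<lambda>n. L2_sq \<Omega> (\<lambda>x. v x - \<phi> n x)) \<longlonglongrightarrow> 0"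
    and 2: "(\<lambda>n. L2_sq \<Omega> (\<lambda>x. g x - grad (\<phi> n) x)) \<longlonglongrightarrow> 0"
  shows "v \<in> H10 \<Omega>"
proof -
  have H1: "v \<in> H1 \<Omega>" by (rule H1_I[OF assms(1-3)])
  have "L2_sq \<Omega> (\<lambda>x. weak_grad \<Omega> v x - grad (\<phi> n) x) = L2_sq \<Omega> (\<lambda>x. g x - grad (\<phi> n) x)" for n
  proof (rule L2_sq_cong_AE)
    show "AE x in lebesgue_on \<Omega>. weak_grad \<Omega> v x - grad (\<phi> n) x = g x - grad (\<phi> n) x"
      using weak_grad_AE[OF assms(2)] by eventually_elim simp
  qed (intro L2_diff H1_D(3) H1 assms(3) test_L2 assms(4))+
  with 2 have 3: "(\<lambda>n. L2_sq \<Omega> (\<lambda>x. weak_grad \<Omega> v x - grad (\<phi> n) x)) \<longlonglongrightarrow> 0" by simp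
  have "(\<lambda>n. LINT x|lebesgue_on \<Omega>. (v x - \<phi> n x)\<^sup>2) \<longlonglongrightarrow> 0" using 1 by simp
  then show ?thesis using H1 3 assms(4) unfolding H10_def by blast
qed

lemma H10_lincomb:
  assumes v: "v \<in> H10 \<Omega>" and w: "w \<in> H10 \<Omega>"
  shows "(\<lambda>x. v x + c * w x) \<in> H10 \<Omega>"
proof -
  note V = H10_D[OF v] and W = H10_D[OF w]
  obtain \<phi> where \<phi>: "\<And>n. \<phi> n \<in> test_functions \<Omega>" "(\<lambda>n. L2_sq \<Omega> (\<lambda>x. v x - \<phi> n x)) \<longlonglongrightarrow> 0"
    "(\<lambda>n. L2_sq \<Omega> (\<lambda>x. weak_grad \<Omega> v x - grad (\<phi> n) x)) \<longlonglongrightarrow> 0"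
    by (rule H10_approx[OF v]) blast
  obtain \<psi> where \<psi>: "\<And>n. \<psi> n \<in> test_functions \<Omega>" "(\<lambda>n. L2_sq \<Omega> (\<lambda>x. w x - \<psi> n x)) \<longlonglongrightarrow> 0"
    "(\<lambda>n. L2_sq \<Omega> (\<lambda>x. weak_grad \<Omega> w x - grad (\<psi> n) x)) \<longlonglongrightarrow> 0"
    by (rule H10_approx[OF w]) blast
  note T = test_L2
  have sc: "L2_sq \<Omega> (\<lambda>x. c *\<^sub>R f x) = c\<^sup>2 * L2_sq \<Omega> f" for f :: "'a \<Rightarrow> 'c::euclidean_space"
    by (simp add: power_mult_distrib)
  \<comment> \<open>Values in any Euclidean space are allowed, so that one estimate serves the
    functions and their gradients alike.\<close>
  have sq: "(\<lambda>n. L2_sq \<Omega> (\<lambda>x. (f x + c *\<^sub>R g x) - (p n x + c *\<^sub>R q n x))) \<longlonglongrightarrow> 0"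
    if "f \<in> L2 \<Omega>" "g \<in> L2 \<Omega>" "\<And>n. p n \<in> L2 \<Omega>" "\<And>n. q n \<in> L2 \<Omega>"
      "(\<lambda>n. L2_sq \<Omega> (\<lambda>x. f x - p n x)) \<longlonglongrightarrow> 0" "(\<lambda>n. L2_sq \<Omega> (\<lambda>x. g x - q n x)) \<longlonglongrightarrow> 0"
    for f g :: "'a \<Rightarrow> 'c::euclidean_space" and p q :: "nat \<Rightarrow> 'a \<Rightarrow> 'c"
  proof (rule tendsto_sandwich[OF _ _ tendsto_const])
    have "L2_sq \<Omega> (\<lambda>x. (f x + c *\<^sub>R g x) - (p n x + c *\<^sub>R q n x)) \<le>
        2 * L2_sq \<Omega> (\<lambda>x. f x - p n x) + 2 * (c\<^sup>2 * L2_sq \<Omega> (\<lambda>x. g x - q n x))" for n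
    proof -
      have d: "(\<lambda>x. f x - p n x) \<in> L2 \<Omega>" "(\<lambda>x. c *\<^sub>R (g x - q n x)) \<in> L2 \<Omega>"
        using L2_diff[OF that(1,3)] L2_lincomb[OF L2_diff[OF that(2,2)] L2_diff[OF that(2,4)], of c] by auto
      have e: "(f x + c *\<^sub>R g x) - (p n x + c *\<^sub>R q n x) = (f x - p n x) + c *\<^sub>R (g x - q n x)" for x
        by (simp add: algebra_simps)
      show ?thesis unfolding e using L2_sq_add_le[OF d] unfolding sc .
    qed
    then show "\<forall>\<^sub>F n in sequentially. L2_sq \<Omega> (\<lambda>x. (f x + c *\<^sub>R g x) - (p n x + c *\<^sub>R q n x)) \<le>
        2 * L2_sq \<Omega> (\<lambda>x. f x - p n x) + 2 * (c\<^sup>2 * L2_sq \<Omega> (\<lambda>x. g x - q n x))" by simp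
    have "(\<lambda>n. 2 * L2_sq \<Omega> (\<lambda>x. f x - p n x) + 2 * (c\<^sup>2 * L2_sq \<Omega> (\<lambda>x. g x - q n x))) \<longlonglongrightarrow> 2 * 0 + 2 * (c\<^sup>2 * 0)"
      by (intro tendsto_intros that(5,6))
    then show "(\<lambda>n. 2 * L2_sq \<Omega> (\<lambda>x. f x - p n x) + 2 * (c\<^sup>2 * L2_sq \<Omega> (\<lambda>x. g x - q n x))) \<longlonglongrightarrow> 0" by simp
  qed simp
  show ?thesis
  proof (rule H10_I)
    show "(\<lambda>x. v x + c * w x) \<in> L2 \<Omega>" using L2_lincomb[OF V(2) W(2), of c] by simp
    show "has_weak_gradient \<Omega> (\<lambda>x. v x + c * w x) (\<lambda>x. weak_grad \<Omega> v x + c *\<^sub>R weak_grad \<Omega> w x)"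
      by (rule has_weak_gradient_lincomb[OF V(1) W(1)])
    show "(\<lambda>x. weak_grad \<Omega> v x + c *\<^sub>R weak_grad \<Omega> w x) \<in> L2 \<Omega>"
      by (rule L2_lincomb[OF V(4) W(4)])
    show "(\<lambda>x. \<phi> n x + c * \<psi> n x) \<in> test_functions \<Omega>" for n
      by (rule test_functions_lincomb[OF \<phi>(1) \<psi>(1)])
    show "(\<lambda>n. L2_sq \<Omega> (\<lambda>x. (v x + c * w x) - (\<phi> n x + c * \<psi> n x))) \<longlonglongrightarrow> 0"
      using sq[OF V(2) W(2) T(1) T(1) \<phi>(2) \<psi>(2)] \<phi>(1) \<psi>(1) by simp
    have "grad (\<lambda>x. \<phi> n x + c * \<psi> n x) = (\<lambda>x. grad (\<phi> n) x + c *\<^sub>R grad (\<psi> n) x)" for n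
    proof -
      have s: "smooth (\<phi> n)" "smooth (\<psi> n)" using \<phi>(1) \<psi>(1) test_functions_smooth by blast+
      have "pd b (\<lambda>x. \<phi> n x + c * \<psi> n x) x = pd b (\<phi> n) x + c * pd b (\<psi> n) x" for b x
        using smooth_differentiable[OF s(1), of x] smooth_differentiable[OF s(2), of x]
        by (subst pd_add) (auto intro!: differentiable_mult simp: pd_cmult)
      then show ?thesis
        by (simp add: grad_def fun_eq_iff scaleR_sum_right scaleR_left_distrib sum.distrib)
    qed
    then show "(\<lambda>n. L2_sq \<Omega> (\<lambda>x. (weak_grad \<Omega> v x + c *\<^sub>R weak_grad \<Omega> w x) -
        grad (\<lambda>x. \<phi> n x + c * \<psi> n x) x)) \<longlonglongrightarrow> 0"
      using sq[OF V(4) W(4) T(2) T(2) \<phi>(3) \<psi>(3)] \<phi>(1) \<psi>(1) by simp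
  qed
qed

lemma H10_diff: "v \<in> H10 \<Omega> \<Longrightarrow> w \<in> H10 \<Omega> \<Longrightarrow> (\<lambda>x. v x - w x) \<in> H10 \<Omega>"
  using H10_lincomb[of v w "-1"] by simp

lemma test_H10: assumes "\<phi> \<in> test_functions \<Omega>" shows "\<phi> \<in> H10 \<Omega>"
  using assms test_L2[OF assms] has_weak_gradient_test[OF assms]
  by (intro H10_I[of \<phi> "grad \<phi>" "\<lambda>_. \<phi>"]) auto

lemma has_weak_gradient_cong_AE:
  assumes v: "has_weak_gradient \<Omega> v g" and vw: "AE x in lebesgue_on \<Omega>. v x = w x"
    and L: "v \<in> L2 \<Omega>" "g \<in> L2 \<Omega>"
  shows "has_weak_gradient \<Omega> w g"
proof (rule has_weak_gradientI)
  have w: "w \<in> L2 \<Omega>" by (rule L2_cong_AE[OF L(1) vw sets_domain])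
  show "integrable (lebesgue_on \<Omega>) w" "integrable (lebesgue_on \<Omega>) g"
    using w L by (auto intro: L2_integrable)
  fix \<phi> and b :: 'a assume \<phi>: "\<phi> \<in> test_functions \<Omega>" and b: "b \<in> Basis"
  have "L2_inner \<Omega> v (pd b \<phi>) = L2_inner \<Omega> w (pd b \<phi>)"
    by (rule L2_inner_cong_AE[OF L(1) w _ vw])
      (intro test_L2 test_functions_pd \<phi> b)
  then show "(LINT x|lebesgue_on \<Omega>. pd b \<phi> x * w x) = - (LINT x|lebesgue_on \<Omega>. \<phi> x * (g x \<bullet> b))"
    using has_weak_gradient_component[OF v \<phi> b] by (simp add: L2_inner_def mult.commute)
qed

text \<open>Needed for limits of finite element functions: the energy limit is known up to null sets
  only, while membership in \<open>Vh\<close> asks for its continuous representative.\<close>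

lemma H10_cong_AE:
  assumes v: "v \<in> H10 \<Omega>" and vw: "AE x in lebesgue_on \<Omega>. v x = w x"
  shows "w \<in> H10 \<Omega>" "AE x in lebesgue_on \<Omega>. weak_grad \<Omega> w x = weak_grad \<Omega> v x"
proof -
  note V = H10_D[OF v]
  obtain \<phi> where \<phi>: "\<And>n. \<phi> n \<in> test_functions \<Omega>" "(\<lambda>n. L2_sq \<Omega> (\<lambda>x. v x - \<phi> n x)) \<longlonglongrightarrow> 0"
    "(\<lambda>n. L2_sq \<Omega> (\<lambda>x. weak_grad \<Omega> v x - grad (\<phi> n) x)) \<longlonglongrightarrow> 0"
    by (rule H10_approx[OF v]) blast
  have w: "w \<in> L2 \<Omega>" by (rule L2_cong_AE[OF V(2) vw sets_domain])
  have g: "has_weak_gradient \<Omega> w (weak_grad \<Omega> v)"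
    by (rule has_weak_gradient_cong_AE[OF V(3) vw V(2,4)])
  have "L2_sq \<Omega> (\<lambda>x. v x - \<phi> n x) = L2_sq \<Omega> (\<lambda>x. w x - \<phi> n x)" for n
  proof (rule L2_sq_cong_AE)
    show "AE x in lebesgue_on \<Omega>. v x - \<phi> n x = w x - \<phi> n x" using vw by eventually_elim simp
  qed (intro L2_diff V(2) w test_L2 \<phi>(1))+
  with \<phi>(2) have "(\<lambda>n. L2_sq \<Omega> (\<lambda>x. w x - \<phi> n x)) \<longlonglongrightarrow> 0" by simp
  then show "w \<in> H10 \<Omega>" by (rule H10_I[OF w g V(4) \<phi>(1) _ \<phi>(3)])
  show "AE x in lebesgue_on \<Omega>. weak_grad \<Omega> w x = weak_grad \<Omega> v x" by (rule weak_grad_AE[OF g])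
qed

text \<open>The derivative of \<open>(x \<bullet> b) * (\<phi> x)\<^sup>2\<close> in a single
  direction \<open>b\<close> has integral zero. It consists of \<open>(\<phi> x)\<^sup>2\<close> and
  a mixed term, and Young's inequality with \<open>\<bar>x \<bullet> b\<bar> \<le> R\<close> lets
  half of the first absorb the second.\<close>

lemma Poincare_test:
  assumes \<phi>: "\<phi> \<in> test_functions \<Omega>" and R: "\<And>x. x \<in> \<Omega> \<Longrightarrow> norm x \<le> R"
  shows "L2_sq \<Omega> \<phi> \<le> 4 * R\<^sup>2 * L2_sq \<Omega> (grad \<phi>)"
proof -
  obtain b :: 'a where b: "b \<in> Basis" using nonempty_Basis by blast
  obtain K where K: "smooth \<phi>" "compact K" "K \<subseteq> \<Omega>" "\<And>x. x \<notin> K \<Longrightarrow> \<phi> x = 0"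
    by (rule test_functionsE[OF \<phi>]) blast
  define p where "p = pd b \<phi>"
  have p: "p \<in> test_functions \<Omega>" unfolding p_def by (rule test_functions_pd[OF \<phi> b])
  note L = test_L2(1)
  have D: "((\<lambda>x. x \<bullet> b) has_derivative (\<lambda>h. h \<bullet> b)) (at x)" for x
    by (auto intro!: derivative_eq_intros)
  have F: "(\<lambda>x. (x \<bullet> b) * (\<phi> x * \<phi> x)) \<in> test_functions \<Omega>"
    by (rule test_functionsI[OF _ K(2,3)])
      (use K in \<open>auto simp: smooth_def intro!: Ck_mult Ck_linear\<close>)
  have pdF: "pd b (\<lambda>x. (x \<bullet> b) * (\<phi> x * \<phi> x)) x = 2 * ((x \<bullet> b) * \<phi> x * p x) + (\<phi> x)\<^sup>2" for x
  proof -
    have "\<phi> differentiable (at x)" by (rule smooth_differentiable[OF K(1)])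
    then show ?thesis using D[of x] b
      by (subst pd_mult) (auto simp: pd_mult pd_eqI[OF D] p_def differentiable_def[of "\<lambda>x. x \<bullet> b"]
          power2_eq_square algebra_simps intro!: differentiable_mult)
  qed
  have xb: "\<bar>x \<bullet> b\<bar> \<le> R" if "x \<in> \<Omega>" for x
    using R[OF that] Basis_le_norm[OF b, of x] by simp
  have i1: "integrable (lebesgue_on \<Omega>) (\<lambda>x. (\<phi> x)\<^sup>2)" using L2_D(2)[OF L[OF \<phi>]] by simp
  have i2: "integrable (lebesgue_on \<Omega>) (\<lambda>x. (p x)\<^sup>2)" using L2_D(2)[OF L[OF p]] by simp
  have i4: "integrable (lebesgue_on \<Omega>) (\<lambda>x. 2 * ((x \<bullet> b) * \<phi> x * p x) + (\<phi> x)\<^sup>2)"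
    using L2_integrable[OF L[OF test_functions_pd[OF F b]]] unfolding pdF .
  have "0 = (LINT x|lebesgue_on \<Omega>. 2 * ((x \<bullet> b) * \<phi> x * p x) + (\<phi> x)\<^sup>2)"
    using integral_pd_eq_0[OF F sets_domain b] unfolding pdF by simp
  also have "\<dots> \<ge> (LINT x|lebesgue_on \<Omega>. (1/2) * (\<phi> x)\<^sup>2 - 2 * R\<^sup>2 * (p x)\<^sup>2)"
  proof (rule integral_mono)
    show "integrable (lebesgue_on \<Omega>) (\<lambda>x. (1/2) * (\<phi> x)\<^sup>2 - 2 * R\<^sup>2 * (p x)\<^sup>2)" using i1 i2 by simp
    fix x assume "x \<in> space (lebesgue_on \<Omega>)"
    then have "x \<in> \<Omega>" by simp
    have "(x \<bullet> b)\<^sup>2 \<le> R\<^sup>2" using power_mono[OF xb[OF \<open>x \<in> \<Omega>\<close>], of 2] by simp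
    then have "2 * ((x \<bullet> b)\<^sup>2 * (p x)\<^sup>2) \<le> 2 * (R\<^sup>2 * (p x)\<^sup>2)"
      by (intro mult_left_mono mult_right_mono) auto
    moreover have "0 \<le> (\<phi> x + 2 * (x \<bullet> b) * p x)\<^sup>2 / 2" by simp
    then have "0 \<le> (1/2) * (\<phi> x)\<^sup>2 + 2 * ((x \<bullet> b) * \<phi> x * p x) + 2 * ((x \<bullet> b)\<^sup>2 * (p x)\<^sup>2)"
      by (simp add: power2_eq_square field_simps)
    ultimately show "(1/2) * (\<phi> x)\<^sup>2 - 2 * R\<^sup>2 * (p x)\<^sup>2 \<le> 2 * ((x \<bullet> b) * \<phi> x * p x) + (\<phi> x)\<^sup>2"
      by simp
  qed (rule i4)
  also have "(LINT x|lebesgue_on \<Omega>. (1/2) * (\<phi> x)\<^sup>2 - 2 * R\<^sup>2 * (p x)\<^sup>2) = (1/2) * L2_sq \<Omega> \<phi> - 2 * R\<^sup>2 * L2_sq \<Omega> p"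
    using i1 i2 by simp
  finally have "L2_sq \<Omega> \<phi> \<le> 4 * R\<^sup>2 * L2_sq \<Omega> p" by simp
  also have "L2_sq \<Omega> p \<le> L2_sq \<Omega> (grad \<phi>)"
  proof (rule integral_mono)
    show "integrable (lebesgue_on \<Omega>) (\<lambda>x. (norm (p x))\<^sup>2)" by (rule L2_D(2)[OF L[OF p]])
    show "integrable (lebesgue_on \<Omega>) (\<lambda>x. (norm (grad \<phi> x))\<^sup>2)"
      by (rule L2_D(2)[OF test_L2(2)[OF \<phi>]])
    show "(norm (p x))\<^sup>2 \<le> (norm (grad \<phi> x))\<^sup>2" for x
      using Basis_le_norm[OF b, of "grad \<phi> x"] b by (intro power_mono) (auto simp: grad_inner p_def)
  qed
  then have "4 * R\<^sup>2 * L2_sq \<Omega> p \<le> 4 * R\<^sup>2 * L2_sq \<Omega> (grad \<phi>)" by (intro mult_left_mono) auto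
  finally show ?thesis .
qed

lemma Poincare:
  obtains C where "C > 0" "\<And>v. v \<in> H10 \<Omega> \<Longrightarrow> L2_sq \<Omega> v \<le> C * energy v v"
proof -
  obtain R where R: "R > 0" "\<And>x. x \<in> \<Omega> \<Longrightarrow> norm x \<le> R"
    using bounded_domain unfolding bounded_pos by auto
  show ?thesis
  \<comment> \<open>The constant \<open>4 * R\<^sup>2\<close> for test functions is doubled twice,
    once for each square that is split during the approximation.\<close>
  proof (rule that[of "16 * R\<^sup>2"])
    fix v assume v: "v \<in> H10 \<Omega>"
    note V = H10_D[OF v]
    obtain \<phi> where \<phi>: "\<And>n. \<phi> n \<in> test_functions \<Omega>" "(\<lambda>n. L2_sq \<Omega> (\<lambda>x. v x - \<phi> n x)) \<longlonglongrightarrow> 0"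
      "(\<lambda>n. L2_sq \<Omega> (\<lambda>x. weak_grad \<Omega> v x - grad (\<phi> n) x)) \<longlonglongrightarrow> 0"
      by (rule H10_approx[OF v]) blast
    note T = test_L2[OF \<phi>(1)]
    define X where "X = (\<lambda>n. 2 * L2_sq \<Omega> (\<lambda>x. v x - \<phi> n x) + 2 * (4 * R\<^sup>2 *
      (2 * L2_sq \<Omega> (\<lambda>x. weak_grad \<Omega> v x - grad (\<phi> n) x) + 2 * L2_sq \<Omega> (weak_grad \<Omega> v))))"
    have "L2_sq \<Omega> v \<le> X n" for n
    proof -
      have "L2_sq \<Omega> v \<le> 2 * L2_sq \<Omega> (\<lambda>x. v x - \<phi> n x) + 2 * L2_sq \<Omega> (\<phi> n)"
        using L2_sq_add_le[OF L2_diff[OF V(2) T(1)[of n]] T(1)[of n]] by simp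
      moreover have "L2_sq \<Omega> (\<phi> n) \<le> 4 * R\<^sup>2 * L2_sq \<Omega> (grad (\<phi> n))"
        by (rule Poincare_test[OF \<phi>(1) R(2)])
      moreover have "L2_sq \<Omega> (grad (\<phi> n)) \<le> 2 * L2_sq \<Omega> (\<lambda>x. weak_grad \<Omega> v x - grad (\<phi> n) x) + 2 * L2_sq \<Omega> (weak_grad \<Omega> v)"
        using L2_sq_add_le[OF L2_diff[OF T(2)[of n] V(4)] V(4)] L2_sq_commute[of \<Omega> "grad (\<phi> n)"] by simp
      then have "4 * R\<^sup>2 * L2_sq \<Omega> (grad (\<phi> n)) \<le> 4 * R\<^sup>2 * (2 * L2_sq \<Omega> (\<lambda>x. weak_grad \<Omega> v x - grad (\<phi> n) x) + 2 * L2_sq \<Omega> (weak_grad \<Omega> v))"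
        by (intro mult_left_mono) auto
      ultimately show ?thesis unfolding X_def by linarith
    qed
    moreover have "X \<longlonglongrightarrow> 2 * 0 + 2 * (4 * R\<^sup>2 * (2 * 0 + 2 * L2_sq \<Omega> (weak_grad \<Omega> v)))"
      unfolding X_def by (intro tendsto_intros \<phi>)
    ultimately have "L2_sq \<Omega> v \<le> 2 * 0 + 2 * (4 * R\<^sup>2 * (2 * 0 + 2 * L2_sq \<Omega> (weak_grad \<Omega> v)))"
      by (intro LIMSEQ_le_const) auto
    then show "L2_sq \<Omega> v \<le> 16 * R\<^sup>2 * energy v v" by (simp add: L2_sq_eq_inner)
  qed (use R in simp)
qed

text \<open>By the Poincare inequality an energy Cauchy sequence is Cauchy in \<open>L2\<close> too.
  The two limits \<open>u\<close> and \<open>G\<close> are linked because the weak gradient identity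
  passes to the limit, and a diagonal choice of test functions shows that \<open>u\<close> stays in
  their closure.\<close>

lemma H10_complete:
  assumes v: "\<And>n. v n \<in> H10 \<Omega>"
    and Cauchy: "\<And>e. e > 0 \<Longrightarrow> \<exists>N. \<forall>m\<ge>N. \<forall>n\<ge>N. energy (\<lambda>x. v m x - v n x) (\<lambda>x. v m x - v n x) < e"
  obtains u where "u \<in> H10 \<Omega>" "(\<lambda>n. energy (\<lambda>x. v n x - u x) (\<lambda>x. v n x - u x)) \<longlonglongrightarrow> 0"
    "(\<lambda>n. L2_sq \<Omega> (\<lambda>x. v n x - u x)) \<longlonglongrightarrow> 0"
proof -
  note V = H10_D[OF v]
  obtain C where C: "C > 0" "\<And>v. v \<in> H10 \<Omega> \<Longrightarrow> L2_sq \<Omega> v \<le> C * energy v v" by (rule Poincare) blast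
  have en: "energy (\<lambda>x. v m x - v n x) (\<lambda>x. v m x - v n x) =
      L2_sq \<Omega> (\<lambda>x. weak_grad \<Omega> (v m) x - weak_grad \<Omega> (v n) x)" for m n
    by (rule energy_diff_diff[OF V(1) V(1)])
  obtain G where G: "G \<in> L2 \<Omega>" "(\<lambda>n. L2_sq \<Omega> (\<lambda>x. weak_grad \<Omega> (v n) x - G x)) \<longlonglongrightarrow> 0"
  proof (rule L2_complete[OF lmeasurable_domain V(4)])
    fix e :: real assume "e > 0"
    then show "\<exists>N. \<forall>m\<ge>N. \<forall>n\<ge>N. L2_sq \<Omega> (\<lambda>x. weak_grad \<Omega> (v m) x - weak_grad \<Omega> (v n) x) < e"
      using Cauchy[of e] unfolding en by simp
  qed blast
  obtain u where u: "u \<in> L2 \<Omega>" "(\<lambda>n. L2_sq \<Omega> (\<lambda>x. v n x - u x)) \<longlonglongrightarrow> 0"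
  proof (rule L2_complete[OF lmeasurable_domain V(2)])
    fix e :: real assume "e > 0"
    then obtain N where N: "\<And>m n. m \<ge> N \<Longrightarrow> n \<ge> N \<Longrightarrow> energy (\<lambda>x. v m x - v n x) (\<lambda>x. v m x - v n x) < e / C"
      using Cauchy[of "e / C"] C(1) by auto
    have "L2_sq \<Omega> (\<lambda>x. v m x - v n x) < e" if "m \<ge> N" "n \<ge> N" for m n
      using C(2)[OF H10_diff[OF v v], of m n] N[OF that] C(1) by (simp add: field_simps)
    then show "\<exists>N. \<forall>m\<ge>N. \<forall>n\<ge>N. L2_sq \<Omega> (\<lambda>x. v m x - v n x) < e" by blast
  qed blast
  have wg: "has_weak_gradient \<Omega> u G"
  proof (rule has_weak_gradientI)
    show "integrable (lebesgue_on \<Omega>) u" "integrable (lebesgue_on \<Omega>) G"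
      using u G by (auto intro: L2_integrable)
    fix \<phi> and b :: 'a assume \<phi>: "\<phi> \<in> test_functions \<Omega>" and b: "b \<in> Basis"
    have 1: "(\<lambda>n. L2_inner \<Omega> (v n) (pd b \<phi>)) \<longlonglongrightarrow> L2_inner \<Omega> u (pd b \<phi>)"
      by (intro L2_inner_tendsto V(2) u test_L2 test_functions_pd \<phi> b)
    have \<phi>b: "(\<lambda>x. \<phi> x *\<^sub>R b) \<in> L2 \<Omega>"
    proof -
      obtain K where K: "smooth \<phi>" "compact K" "K \<subseteq> \<Omega>" "\<And>x. x \<notin> K \<Longrightarrow> \<phi> x = 0"
        by (rule test_functionsE[OF \<phi>]) blast
      show ?thesis
        by (rule continuous_supported_L2[OF lmeasurable_domain _ K(2)])
          (auto intro!: continuous_intros smooth_continuous simp: K)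
    qed
    have 2: "(\<lambda>n. L2_inner \<Omega> (weak_grad \<Omega> (v n)) (\<lambda>x. \<phi> x *\<^sub>R b)) \<longlonglongrightarrow> L2_inner \<Omega> G (\<lambda>x. \<phi> x *\<^sub>R b)"
      by (rule L2_inner_tendsto[OF V(4) G(1) \<phi>b G(2)])
    have "L2_inner \<Omega> (v n) (pd b \<phi>) = - L2_inner \<Omega> (weak_grad \<Omega> (v n)) (\<lambda>x. \<phi> x *\<^sub>R b)" for n
      using has_weak_gradient_component[OF V(3) \<phi> b, of n] by (simp add: L2_inner_def mult.commute)
    with 1 have "(\<lambda>n. - L2_inner \<Omega> (weak_grad \<Omega> (v n)) (\<lambda>x. \<phi> x *\<^sub>R b)) \<longlonglongrightarrow> L2_inner \<Omega> u (pd b \<phi>)" by simp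
    from LIMSEQ_unique[OF this tendsto_minus[OF 2]]
    show "(LINT x|lebesgue_on \<Omega>. pd b \<phi> x * u x) = - (LINT x|lebesgue_on \<Omega>. \<phi> x * (G x \<bullet> b))"
      by (simp add: L2_inner_def mult.commute)
  qed
  have "\<exists>\<psi>. \<psi> \<in> test_functions \<Omega> \<and> L2_sq \<Omega> (\<lambda>x. v n x - \<psi> x) < inverse (real (Suc n)) \<and>
      L2_sq \<Omega> (\<lambda>x. weak_grad \<Omega> (v n) x - grad \<psi> x) < inverse (real (Suc n))" for n
  proof -
    obtain \<phi> where \<phi>: "\<And>n. \<phi> n \<in> test_functions \<Omega>" "(\<lambda>k. L2_sq \<Omega> (\<lambda>x. v n x - \<phi> k x)) \<longlonglongrightarrow> 0"
      "(\<lambda>k. L2_sq \<Omega> (\<lambda>x. weak_grad \<Omega> (v n) x - grad (\<phi> k) x)) \<longlonglongrightarrow> 0"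
      by (rule H10_approx[OF v[of n]]) blast
    have "\<forall>\<^sub>F k in sequentially. L2_sq \<Omega> (\<lambda>x. v n x - \<phi> k x) < inverse (real (Suc n))"
      "\<forall>\<^sub>F k in sequentially. L2_sq \<Omega> (\<lambda>x. weak_grad \<Omega> (v n) x - grad (\<phi> k) x) < inverse (real (Suc n))"
      using \<phi>(2,3) by (intro order_tendstoD(2)[where y=0]; simp)+
    then have "\<forall>\<^sub>F k in sequentially. L2_sq \<Omega> (\<lambda>x. v n x - \<phi> k x) < inverse (real (Suc n)) \<and>
       L2_sq \<Omega> (\<lambda>x. weak_grad \<Omega> (v n) x - grad (\<phi> k) x) < inverse (real (Suc n))" by (rule eventually_conj)
    then obtain k where "L2_sq \<Omega> (\<lambda>x. v n x - \<phi> k x) < inverse (real (Suc n)) \<and>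
       L2_sq \<Omega> (\<lambda>x. weak_grad \<Omega> (v n) x - grad (\<phi> k) x) < inverse (real (Suc n))"
      using eventually_happens'[OF sequentially_bot] by blast
    then show ?thesis using \<phi>(1) by blast
  qed
  then have "\<forall>n. \<exists>\<psi>. \<psi> \<in> test_functions \<Omega> \<and> L2_sq \<Omega> (\<lambda>x. v n x - \<psi> x) < inverse (real (Suc n)) \<and>
      L2_sq \<Omega> (\<lambda>x. weak_grad \<Omega> (v n) x - grad \<psi> x) < inverse (real (Suc n))" by blast
  from choice[OF this] obtain \<psi> where \<psi>: "\<And>n. \<psi> n \<in> test_functions \<Omega>"
    "\<And>n. L2_sq \<Omega> (\<lambda>x. v n x - \<psi> n x) < inverse (real (Suc n))"
    "\<And>n. L2_sq \<Omega> (\<lambda>x. weak_grad \<Omega> (v n) x - grad (\<psi> n) x) < inverse (real (Suc n))"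
    by blast
  note T = test_L2[OF \<psi>(1)]
  have diag: "(\<lambda>n. L2_sq \<Omega> (\<lambda>x. f x - q n x)) \<longlonglongrightarrow> 0"
    if "f \<in> L2 \<Omega>" "\<And>n. p n \<in> L2 \<Omega>" "\<And>n. q n \<in> L2 \<Omega>" "(\<lambda>n. L2_sq \<Omega> (\<lambda>x. p n x - f x)) \<longlonglongrightarrow> 0"
      "\<And>n. L2_sq \<Omega> (\<lambda>x. p n x - q n x) < inverse (real (Suc n))"
    for f :: "'a \<Rightarrow> 'c::euclidean_space" and p q
  proof (rule tendsto_sandwich[OF _ _ tendsto_const])
    have "L2_sq \<Omega> (\<lambda>x. f x - q n x) \<le> 2 * L2_sq \<Omega> (\<lambda>x. p n x - f x) + 2 * inverse (real (Suc n))" for n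
      using L2_sq_diff_le[OF that(1,3,2), of n n] L2_sq_commute[of \<Omega> f "p n"] that(5)[of n] by linarith
    then show "\<forall>\<^sub>F n in sequentially. L2_sq \<Omega> (\<lambda>x. f x - q n x) \<le>
        2 * L2_sq \<Omega> (\<lambda>x. p n x - f x) + 2 * inverse (real (Suc n))" by simp
    have "(\<lambda>n. 2 * L2_sq \<Omega> (\<lambda>x. p n x - f x) + 2 * inverse (real (Suc n))) \<longlonglongrightarrow> 2 * 0 + 2 * 0"
      by (intro tendsto_intros that(4) LIMSEQ_inverse_real_of_nat)
    then show "(\<lambda>n. 2 * L2_sq \<Omega> (\<lambda>x. p n x - f x) + 2 * inverse (real (Suc n))) \<longlonglongrightarrow> 0" by simp
  qed simp
  have uH: "u \<in> H10 \<Omega>"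
    by (rule H10_I[OF u(1) wg G(1) \<psi>(1) diag[OF u(1) V(2) T(1) u(2) \<psi>(2)] diag[OF G(1) V(4) T(2) G(2) \<psi>(3)]])
  have "energy (\<lambda>x. v n x - u x) (\<lambda>x. v n x - u x) = L2_sq \<Omega> (\<lambda>x. weak_grad \<Omega> (v n) x - G x)" for n
  proof -
    have "AE x in lebesgue_on \<Omega>. weak_grad \<Omega> (v n) x - weak_grad \<Omega> u x = weak_grad \<Omega> (v n) x - G x"
      using weak_grad_AE[OF wg] by eventually_elim simp
    then show ?thesis
      unfolding energy_diff_diff[OF V(1) H10_D(1)[OF uH]]
      by (intro L2_sq_cong_AE L2_diff V(4) H10_D(4) uH G(1))
  qed
  with G(2) have "(\<lambda>n. energy (\<lambda>x. v n x - u x) (\<lambda>x. v n x - u x)) \<longlonglongrightarrow> 0" by simp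
  then show ?thesis by (rule that[OF uH _ u(2)])
qed

end

section \<open>A weak maximum principle\<close>

text \<open>Taylor's formula towards \<open>e\<close> and towards \<open>- e\<close> with Lagrange
  remainder: the odd terms cancel. The form with two intermediate points yields both the limit and a
  uniform bound of the quotients.\<close>

lemma second_difference:
  fixes F :: "'a::euclidean_space \<Rightarrow> real"
  assumes F: "smooth F" and e: "e \<in> Basis"
  shows "\<exists>a b. \<bar>a\<bar> \<le> \<bar>t\<bar> \<and> \<bar>b\<bar> \<le> \<bar>t\<bar> \<and>
    F (y + t *\<^sub>R e) + F (y - t *\<^sub>R e) - 2 * F y =
      t\<^sup>2 * ((pd e (pd e F) (y + a *\<^sub>R e) + pd e (pd e F) (y + b *\<^sub>R e)) / 2)"
proof -
  define diff where "diff = (\<lambda>m::nat. if m = 0 then (\<lambda>s. F (y + s *\<^sub>R e))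
    else if m = 1 then (\<lambda>s. pd e F (y + s *\<^sub>R e)) else (\<lambda>s. pd e (pd e F) (y + s *\<^sub>R e)))"
  have D: "\<forall>m s. m < 2 \<and> \<bar>s\<bar> \<le> \<bar>x\<bar> \<longrightarrow> DERIV (diff m) s :> diff (Suc m) s" for x
  proof (intro allI impI)
    fix m :: nat and s :: real assume "m < 2 \<and> \<bar>s\<bar> \<le> \<bar>x\<bar>"
    then have "m = 0 \<or> m = 1" by auto
    then show "DERIV (diff m) s :> diff (Suc m) s"
      using line_has_derivative[OF smooth_differentiable[OF F]]
        line_has_derivative[OF smooth_differentiable[OF smooth_pd[OF F e]]]
      by (auto simp: diff_def)
  qed
  have T: "\<exists>s. \<bar>s\<bar> \<le> \<bar>x\<bar> \<and> F (y + x *\<^sub>R e) = F y + pd e F y * x + pd e (pd e F) (y + s *\<^sub>R e) / 2 * x\<^sup>2" for x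
    using Maclaurin_bi_le[of diff "\<lambda>s. F (y + s *\<^sub>R e)" 2 x, OF _ D]
    by (auto simp: diff_def numeral_2_eq_2 lessThan_Suc)
  obtain a b where "\<bar>a\<bar> \<le> \<bar>t\<bar>" "F (y + t *\<^sub>R e) = F y + pd e F y * t + pd e (pd e F) (y + a *\<^sub>R e) / 2 * t\<^sup>2"
    "\<bar>b\<bar> \<le> \<bar>t\<bar>" "F (y + (- t) *\<^sub>R e) = F y + pd e F y * (- t) + pd e (pd e F) (y + b *\<^sub>R e) / 2 * (- t)\<^sup>2"
    using T[of t] T[of "- t"] by auto
  then show ?thesis
    by (intro exI[of _ a] exI[of _ b]) (auto simp: algebra_simps add_divide_distrib)
qed

lemma bump_translate: "bump (a + c) (b + c) n y = bump a b n (y - c)"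
  by (simp add: bump_def inner_add_left inner_diff_left algebra_simps)

lemma integral_bump_le:
  fixes x :: "'a::euclidean_space"
  assumes "0 \<le> h" "\<Omega> \<in> sets lebesgue" "cbox x (x + h *\<^sub>R One) \<subseteq> \<Omega>"
  shows "(LINT y|lebesgue_on \<Omega>. bump x (x + h *\<^sub>R One) n y) \<le> h ^ DIM('a)"
proof -
  let ?C = "cbox x (x + h *\<^sub>R One)"
  have z: "bump x (x + h *\<^sub>R One) n y = 0" if "y \<notin> ?C" for y
    using that box_subset_cbox by (intro bump_eq_0) blast
  have "(LINT y|lebesgue_on \<Omega>. bump x (x + h *\<^sub>R One) n y) = (LINT y|lebesgue. bump x (x + h *\<^sub>R One) n y)"
    by (rule integral_lebesgue_on_supported) (use assms z in auto)
  also have "\<dots> \<le> (LINT y|lebesgue. indicator ?C y)"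
  proof (rule integral_mono')
    show "integrable lebesgue (indicat_real ?C)"
      using emeasure_bounded_finite[OF bounded_cbox, of x "x + h *\<^sub>R One"]
      by (intro integrable_real_indicator) auto
  qed (use z bump_bounds in \<open>auto simp: indicator_def\<close>)
  also have "\<dots> = measure lebesgue ?C" by simp
  also have "\<dots> = h ^ DIM('a)"
    using assms(1) by (simp add: content_cbox_cases inner_add_left)
  finally show ?thesis .
qed

context bounded_domain
begin

lemma energy_test_eq:
  assumes z: "z \<in> H1 \<Omega>" and \<phi>: "\<phi> \<in> test_functions \<Omega>"
  shows "energy z \<phi> = L2_inner \<Omega> (weak_grad \<Omega> z) (grad \<phi>)"
  using L2_inner_cong_AE[OF H1_D(3)[OF test_H1[OF \<phi>]] test_L2(2)[OF \<phi>] H1_D(3)[OF z]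
      weak_grad_AE[OF has_weak_gradient_test[OF \<phi>]]]
  by (simp add: L2_inner_commute)

text \<open>\<open>pd e \<phi>\<close> is again a test function; testing the weak gradient with it
  moves all derivatives off \<open>z\<close>, which need not have second derivatives.\<close>

lemma laplacian_test_integral:
  assumes z: "z \<in> H1 \<Omega>" and \<phi>: "\<phi> \<in> test_functions \<Omega>"
  shows "(\<Sum>e\<in>Basis. LINT y|lebesgue_on \<Omega>. pd e (pd e \<phi>) y * z y) = - energy z \<phi>"
proof -
  note Z = H1_D[OF z]
  have i: "integrable (lebesgue_on \<Omega>) (\<lambda>y. pd e \<phi> y * (weak_grad \<Omega> z y \<bullet> e))" if e: "e \<in> Basis" for e
    using integrable_inner_left[OF integrable_test[OF L2_locally_integrable[OF Z(3)] sets_domain test_functions_pd[OF \<phi> e]]]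
    by simp
  have "energy z \<phi> = L2_inner \<Omega> (weak_grad \<Omega> z) (grad \<phi>)"
    by (rule energy_test_eq[OF z \<phi>])
  also have "\<dots> = (LINT y|lebesgue_on \<Omega>. (\<Sum>e\<in>Basis. pd e \<phi> y * (weak_grad \<Omega> z y \<bullet> e)))"
    unfolding L2_inner_def
    by (intro Bochner_Integration.integral_cong refl, subst euclidean_inner)
      (auto intro!: sum.cong simp: grad_inner)
  also have "\<dots> = (\<Sum>e\<in>Basis. (LINT y|lebesgue_on \<Omega>. pd e \<phi> y * (weak_grad \<Omega> z y \<bullet> e)))"
    by (intro Bochner_Integration.integral_sum i)
  also have "\<dots> = (\<Sum>e\<in>Basis. - (LINT y|lebesgue_on \<Omega>. pd e (pd e \<phi>) y * z y))"
    by (intro sum.cong refl) (simp add: has_weak_gradient_component[OF Z(2) test_functions_pd[OF \<phi>]])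
  finally show ?thesis by (simp add: sum_negf)
qed

text \<open>The remainder form bounds the quotients of \<open>\<phi>\<close> by a bound of
  \<open>pd e (pd e \<phi>)\<close>, so dominated convergence applies for a merely square-integrable
  \<open>z\<close>.\<close>

lemma second_difference_integral_tendsto:
  assumes z: "z \<in> L2 \<Omega>" and \<phi>: "\<phi> \<in> test_functions \<Omega>" and e: "e \<in> Basis"
    and t: "t \<longlonglongrightarrow> 0" "\<And>k. t k \<noteq> 0"
  shows "(\<lambda>k. LINT y|lebesgue_on \<Omega>. (\<phi> (y + t k *\<^sub>R e) + \<phi> (y - t k *\<^sub>R e) - 2 * \<phi> y) / (t k)\<^sup>2 * z y)
    \<longlonglongrightarrow> (LINT y|lebesgue_on \<Omega>. pd e (pd e \<phi>) y * z y)"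
proof -
  have s: "smooth \<phi>" by (rule test_functions_smooth[OF \<phi>])
  define q where "q = pd e (pd e \<phi>)"
  have q: "q \<in> test_functions \<Omega>" unfolding q_def by (intro test_functions_pd \<phi> e)
  have sq: "continuous_on UNIV q" by (rule smooth_continuous[OF test_functions_smooth[OF q]])
  obtain B where B: "\<And>y. \<bar>q y\<bar> \<le> B" by (rule test_functions_bounded[OF q], rule that)
  define D where "D = (\<lambda>k y. (\<phi> (y + t k *\<^sub>R e) + \<phi> (y - t k *\<^sub>R e) - 2 * \<phi> y) / (t k)\<^sup>2)"
  have "\<exists>a b. \<bar>a\<bar> \<le> \<bar>t k\<bar> \<and> \<bar>b\<bar> \<le> \<bar>t k\<bar> \<and> D k y = (q (y + a *\<^sub>R e) + q (y + b *\<^sub>R e)) / 2" for k y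
  proof -
    obtain a b where "\<bar>a\<bar> \<le> \<bar>t k\<bar>" "\<bar>b\<bar> \<le> \<bar>t k\<bar>"
      "\<phi> (y + t k *\<^sub>R e) + \<phi> (y - t k *\<^sub>R e) - 2 * \<phi> y = (t k)\<^sup>2 * ((q (y + a *\<^sub>R e) + q (y + b *\<^sub>R e)) / 2)"
      using second_difference[OF s e, of "t k" y] unfolding q_def by blast
    then show ?thesis using t(2)[of k] by (intro exI[of _ a] exI[of _ b]) (simp add: D_def)
  qed
  then obtain a b where ab: "\<And>k y. \<bar>a k y\<bar> \<le> \<bar>t k\<bar>" "\<And>k y. \<bar>b k y\<bar> \<le> \<bar>t k\<bar>"
    "\<And>k y. D k y = (q (y + a k y *\<^sub>R e) + q (y + b k y *\<^sub>R e)) / 2" by metis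
  have Dm: "D k \<in> borel_measurable (lebesgue_on \<Omega>)" for k
  proof -
    have "continuous_on UNIV (D k)" unfolding D_def
      using smooth_continuous[OF s] t(2)[of k]
      by (auto intro!: continuous_intros continuous_on_compose2[OF smooth_continuous[OF s, of UNIV]])
    then show ?thesis
      by (intro measurable_restrict_space1 measurable_completion) (simp add: borel_measurable_continuous_onI)
  qed
  have zm: "z \<in> borel_measurable (lebesgue_on \<Omega>)" by (rule L2_D(1)[OF z])
  have "(\<lambda>k. LINT y|lebesgue_on \<Omega>. D k y * z y) \<longlonglongrightarrow> (LINT y|lebesgue_on \<Omega>. q y * z y)"
  proof (rule integral_dominated_convergence)
    show "(\<lambda>y. q y * z y) \<in> borel_measurable (lebesgue_on \<Omega>)"
      by (intro borel_measurable_times zm L2_D(1)[OF test_L2(1)[OF q]])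
    show "(\<lambda>y. D k y * z y) \<in> borel_measurable (lebesgue_on \<Omega>)" for k
      by (intro borel_measurable_times zm Dm)
    show "integrable (lebesgue_on \<Omega>) (\<lambda>y. B * norm (z y))"
      by (intro integrable_mult_right integrable_norm L2_integrable[OF z])
    show "AE y in lebesgue_on \<Omega>. (\<lambda>k. D k y * z y) \<longlonglongrightarrow> q y * z y"
    proof (intro AE_I2 tendsto_mult tendsto_const)
      fix y
      have lim: "(\<lambda>k. q (y + c k *\<^sub>R e)) \<longlonglongrightarrow> q y" if "\<And>k. \<bar>c k\<bar> \<le> \<bar>t k\<bar>" for c
      proof -
        have "c \<longlonglongrightarrow> 0"
          by (rule Lim_null_comparison[OF _ tendsto_rabs_zero[OF t(1)]]) (use that in auto)
        then have "(\<lambda>k. y + c k *\<^sub>R e) \<longlonglongrightarrow> y + 0 *\<^sub>R e" by (intro tendsto_intros)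
        then have "(\<lambda>k. y + c k *\<^sub>R e) \<longlonglongrightarrow> y" by simp
        then show ?thesis
          using sq by (intro isCont_tendsto_compose[of y q]) (auto simp: continuous_on_eq_continuous_at)
      qed
      have "(\<lambda>k. (q (y + a k y *\<^sub>R e) + q (y + b k y *\<^sub>R e)) / 2) \<longlonglongrightarrow> (q y + q y) / 2"
        by (intro tendsto_intros lim ab) simp
      then show "(\<lambda>k. D k y) \<longlonglongrightarrow> q y" unfolding ab(3) by simp
    qed
    show "AE y in lebesgue_on \<Omega>. norm (D k y * z y) \<le> B * norm (z y)" for k
    proof (intro AE_I2)
      fix y
      have "\<bar>D k y\<bar> \<le> B" unfolding ab(3) using B[of "y + a k y *\<^sub>R e"] B[of "y + b k y *\<^sub>R e"] by (simp add: abs_le_iff)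
      then show "norm (D k y * z y) \<le> B * norm (z y)" by (simp add: abs_mult mult_right_mono)
    qed
  qed
  then show ?thesis by (simp add: D_def q_def)
qed

text \<open>Secures a maximum of the averages on a compact set. The corner \<open>x\<close> enters
  only through the argument \<open>y - x\<close> of one fixed continuous bump.\<close>

lemma bump_average_continuous:
  assumes z: "z \<in> L2 \<Omega>"
  shows "continuous_on S (\<lambda>x. LINT y|lebesgue_on \<Omega>. bump x (x + v) n y * z y)"
  unfolding continuous_on_sequentially
proof (intro allI ballI impI, elim conjE)
  fix X :: "nat \<Rightarrow> 'a" and a assume "X \<longlonglongrightarrow> a"
  have eq: "bump x (x + v) n y = bump 0 v n (y - x)" for x y
    using bump_translate[of 0 x v n y] by (simp add: add.commute)
  have bm: "(\<lambda>y. bump x (x + v) n y) \<in> borel_measurable (lebesgue_on \<Omega>)" for x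
    by (intro measurable_restrict_space1 measurable_completion)
      (simp add: borel_measurable_continuous_onI smooth_continuous smooth_bump)
  have zm: "z \<in> borel_measurable (lebesgue_on \<Omega>)" by (rule L2_D(1)[OF z])
  have "(\<lambda>k. LINT y|lebesgue_on \<Omega>. bump (X k) (X k + v) n y * z y) \<longlonglongrightarrow>
      (LINT y|lebesgue_on \<Omega>. bump a (a + v) n y * z y)"
  proof (rule integral_dominated_convergence)
    show "integrable (lebesgue_on \<Omega>) (\<lambda>y. norm (z y))"
      by (intro integrable_norm L2_integrable[OF z])
    show "AE y in lebesgue_on \<Omega>. (\<lambda>k. bump (X k) (X k + v) n y * z y) \<longlonglongrightarrow> bump a (a + v) n y * z y"
    proof (intro AE_I2 tendsto_mult tendsto_const)
      fix y
      have "(\<lambda>k. y - X k) \<longlonglongrightarrow> y - a" by (intro tendsto_intros \<open>X \<longlonglongrightarrow> a\<close>)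
      then show "(\<lambda>k. bump (X k) (X k + v) n y) \<longlonglongrightarrow> bump a (a + v) n y"
        unfolding eq using smooth_continuous[OF smooth_bump[of 0 v n], of UNIV]
        by (intro isCont_tendsto_compose[of "y - a" "bump 0 v n"]) (auto simp: continuous_on_eq_continuous_at)
    qed
    show "AE y in lebesgue_on \<Omega>. norm (bump (X k) (X k + v) n y * z y) \<le> norm (z y)" for k
      using bump_bounds[of "X k" "X k + v" n] by (auto simp: abs_mult intro!: mult_left_le_one_le)
  qed (intro borel_measurable_times bm zm)+
  then show "((\<lambda>x. LINT y|lebesgue_on \<Omega>. bump x (x + v) n y * z y) \<circ> X) \<longlonglongrightarrow>
      (LINT y|lebesgue_on \<Omega>. bump a (a + v) n y * z y)" by (simp add: o_def)
qed

text \<open>The averages \<open>Z\<close> of \<open>z\<close> against a translated bump are classical functions. At an interior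
  maximum of \<open>Z + (A / 2) |x|\<^sup>2\<close> over the compact set \<open>K\<close> the second differences would be
  nonpositive, which contradicts \<open>-\<Delta> Z \<le> C h\<^sup>N < A\<close>; so the maximum is attained where \<open>z\<close> is small.\<close>

lemma bump_average_le:
  assumes z: "z \<in> H1 \<Omega>" and g: "locally_integrable \<Omega> g"
    and eq: "\<And>\<phi>. \<phi> \<in> test_functions \<Omega> \<Longrightarrow> energy z \<phi> = (LINT y|lebesgue_on \<Omega>. \<phi> y * g y)"
    and K: "compact K" "K \<subseteq> \<Omega>"
    and h: "0 < h" and cubes: "\<And>x. x \<in> K \<Longrightarrow> cbox x (x + h *\<^sub>R One) \<subseteq> U" "U \<subseteq> \<Omega>"
    and gU: "AE y in lebesgue_on \<Omega>. y \<in> U \<longrightarrow> g y \<le> C" and C: "0 \<le> C" "C * h ^ DIM('a) < A"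
    and bd: "\<And>x. x \<in> K - interior K' \<Longrightarrow> AE y in lebesgue_on \<Omega>. y \<in> cbox x (x + h *\<^sub>R One) \<longrightarrow> z y \<le> B"
    and K': "K' \<subseteq> K" and B: "0 \<le> B"
    and R: "\<And>x. x \<in> \<Omega> \<Longrightarrow> norm x \<le> R"
    and x: "x \<in> K"
  shows "(LINT y|lebesgue_on \<Omega>. bump x (x + h *\<^sub>R One) n y * z y) \<le> h ^ DIM('a) * B + A / 2 * R\<^sup>2"
proof -
  define Z where "Z = (\<lambda>x. LINT y|lebesgue_on \<Omega>. bump x (x + h *\<^sub>R One) n y * z y)"
  define W where "W = (\<lambda>x. Z x + A / 2 * (norm x)\<^sup>2)"
  note zL = H1_D(1)[OF z]
  have A: "0 < A" using C h by (smt (verit) mult_nonneg_nonneg zero_le_power)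
  have "continuous_on K W"
    unfolding W_def Z_def by (intro continuous_intros bump_average_continuous zL)
  then obtain x1 where x1: "x1 \<in> K" "\<And>y. y \<in> K \<Longrightarrow> W y \<le> W x1"
    using continuous_attains_sup[OF K(1), of W] x by blast
  let ?\<phi> = "bump x1 (x1 + h *\<^sub>R One) n"
  have cube: "cbox x1 (x1 + h *\<^sub>R One) \<subseteq> \<Omega>" using cubes x1(1) by blast
  have \<phi>: "?\<phi> \<in> test_functions \<Omega>" by (rule bump_test_function[OF cube])
  have \<phi>0: "?\<phi> y = 0" if "y \<notin> cbox x1 (x1 + h *\<^sub>R One)" for y
    using that box_subset_cbox by (intro bump_eq_0) blast
  have int\<phi>: "integrable (lebesgue_on \<Omega>) ?\<phi>"
    by (intro L2_integrable test_L2 \<phi>)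
  have int\<phi>_le: "(LINT y|lebesgue_on \<Omega>. ?\<phi> y) \<le> h ^ DIM('a)"
    by (rule integral_bump_le[OF _ sets_domain cube]) (use h in simp)
  have "x1 \<notin> interior K'"
  proof
    assume "x1 \<in> interior K'"
    then obtain r where r: "r > 0" "ball x1 r \<subseteq> K'" using mem_interior by blast
    \<comment> \<open>In each coordinate direction the quadratic term contributes exactly
      \<open>A * (t k)\<^sup>2\<close> to the second difference of \<open>W\<close>; maximality
      leaves at most \<open>- A * (t k)\<^sup>2\<close> for \<open>Z\<close>, and division by
      \<open>(t k)\<^sup>2\<close> precedes the limit.\<close>
    have le0: "(LINT y|lebesgue_on \<Omega>. pd e (pd e ?\<phi>) y * z y) + A \<le> 0" if e: "e \<in> Basis" for e
    proof -
      define t where "t = (\<lambda>k. inverse (real (Suc k)))"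
      have t: "t \<longlonglongrightarrow> 0" "\<And>k. t k > 0" unfolding t_def using LIMSEQ_inverse_real_of_nat by auto
      have shift: "bump (x1 + c) (x1 + c + h *\<^sub>R One) n y = ?\<phi> (y - c)" for c y
        using bump_translate[of x1 c "x1 + h *\<^sub>R One" n y] by (simp add: algebra_simps)
      have bint: "integrable (lebesgue_on \<Omega>) (\<lambda>y. bump a b n y * z y)" for a b
      proof (rule Bochner_Integration.integrable_bound[OF L2_integrable[OF zL]])
        show "(\<lambda>y. bump a b n y * z y) \<in> borel_measurable (lebesgue_on \<Omega>)"
          by (intro borel_measurable_times L2_D(1)[OF zL] measurable_restrict_space1 measurable_completion)
            (simp add: borel_measurable_continuous_onI smooth_continuous smooth_bump)
        show "AE y in lebesgue_on \<Omega>. norm (bump a b n y * z y) \<le> norm (z y)"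
          using bump_bounds[of a b n] by (auto simp: abs_mult intro!: mult_left_le_one_le)
      qed
      have "\<forall>\<^sub>F k in sequentially. t k < r" by (rule order_tendstoD(2)[OF t(1) r(1)])
      then have ev: "\<forall>\<^sub>F k in sequentially. (LINT y|lebesgue_on \<Omega>.
          (?\<phi> (y + t k *\<^sub>R e) + ?\<phi> (y - t k *\<^sub>R e) - 2 * ?\<phi> y) / (t k)\<^sup>2 * z y) + A \<le> 0"
      proof eventually_elim
        fix k assume tk: "t k < r"
        have "x1 + t k *\<^sub>R e \<in> K" "x1 + (- t k) *\<^sub>R e \<in> K"
          using r(2) K' tk t(2)[of k] e by (auto simp: dist_norm subset_iff)
        then have "W (x1 + t k *\<^sub>R e) + W (x1 + (- t k) *\<^sub>R e) - 2 * W x1 \<le> 0"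
          using x1(2) by (smt (verit))
        moreover have "(norm (x1 + t k *\<^sub>R e))\<^sup>2 + (norm (x1 + (- t k) *\<^sub>R e))\<^sup>2 = 2 * (norm x1)\<^sup>2 + 2 * (t k)\<^sup>2"
        proof -
          have "(norm (x1 + u))\<^sup>2 + (norm (x1 - u))\<^sup>2 = 2 * (norm x1)\<^sup>2 + 2 * (norm u)\<^sup>2" for u
            by (simp add: power2_norm_eq_inner inner_simps inner_commute)
          from this[of "t k *\<^sub>R e"] show ?thesis using e by simp
        qed
        then have "A / 2 * (norm (x1 + t k *\<^sub>R e))\<^sup>2 + A / 2 * (norm (x1 + (- t k) *\<^sub>R e))\<^sup>2 - 2 * (A / 2 * (norm x1)\<^sup>2) = A * (t k)\<^sup>2"
        proof -
          have "A / 2 * p + A / 2 * q - 2 * (A / 2 * n) = A * s" if "p + q = 2 * n + 2 * s" for p q n s :: real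
          proof -
            have "p = 2 * n + 2 * s - q" using that by simp
            then show ?thesis by (simp only:) (simp add: algebra_simps)
          qed
          then show ?thesis using \<open>(norm (x1 + t k *\<^sub>R e))\<^sup>2 + (norm (x1 + (- t k) *\<^sub>R e))\<^sup>2 = _\<close> by blast
        qed
        ultimately have "Z (x1 + t k *\<^sub>R e) + Z (x1 + (- t k) *\<^sub>R e) - 2 * Z x1 + A * (t k)\<^sup>2 \<le> 0"
        proof -
          have lin: "z1 + z2 - 2 * z0 + s \<le> 0"
            if "(z1 + p) + (z2 + q) - 2 * (z0 + n) \<le> 0" "p + q - 2 * n = s" for z1 z2 z0 p q n s :: real
            using that by (simp add: algebra_simps)
          show "(W (x1 + t k *\<^sub>R e) + W (x1 + (- t k) *\<^sub>R e) - 2 * W x1 \<le> 0) \<Longrightarrow>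
            A / 2 * (norm (x1 + t k *\<^sub>R e))\<^sup>2 + A / 2 * (norm (x1 + (- t k) *\<^sub>R e))\<^sup>2 - 2 * (A / 2 * (norm x1)\<^sup>2) = A * (t k)\<^sup>2 \<Longrightarrow> ?thesis"
            unfolding W_def by (rule lin)
        qed
        \<comment> \<open>Translating the cube translates the bump, so the second difference of
          \<open>Z\<close> falls on the bump under the integral.\<close>
        moreover have "Z (x1 + t k *\<^sub>R e) + Z (x1 + (- t k) *\<^sub>R e) - 2 * Z x1 =
            (LINT y|lebesgue_on \<Omega>. (t k)\<^sup>2 * ((?\<phi> (y + t k *\<^sub>R e) + ?\<phi> (y - t k *\<^sub>R e) - 2 * ?\<phi> y) / (t k)\<^sup>2 * z y))"
        proof -
          have "(LINT y|lebesgue_on \<Omega>. (t k)\<^sup>2 * ((?\<phi> (y + t k *\<^sub>R e) + ?\<phi> (y - t k *\<^sub>R e) - 2 * ?\<phi> y) / (t k)\<^sup>2 * z y)) =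
            (LINT y|lebesgue_on \<Omega>. bump (x1 + (- t k) *\<^sub>R e) (x1 + (- t k) *\<^sub>R e + h *\<^sub>R One) n y * z y +
              bump (x1 + t k *\<^sub>R e) (x1 + t k *\<^sub>R e + h *\<^sub>R One) n y * z y - 2 * (?\<phi> y * z y))"
            using t(2)[of k] unfolding shift by (intro Bochner_Integration.integral_cong refl) (simp add: field_simps)
          also have "\<dots> = Z (x1 + (- t k) *\<^sub>R e) + Z (x1 + t k *\<^sub>R e) - 2 * Z x1"
            unfolding Z_def by (simp add: bint del: scaleR_minus_left)
          finally show ?thesis by simp
        qed
        ultimately have "(t k)\<^sup>2 * ((LINT y|lebesgue_on \<Omega>.
          (?\<phi> (y + t k *\<^sub>R e) + ?\<phi> (y - t k *\<^sub>R e) - 2 * ?\<phi> y) / (t k)\<^sup>2 * z y) + A) \<le> 0"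
          unfolding integral_mult_right_zero by (simp only: distrib_left mult.commute[of A])
        then show "(LINT y|lebesgue_on \<Omega>.
          (?\<phi> (y + t k *\<^sub>R e) + ?\<phi> (y - t k *\<^sub>R e) - 2 * ?\<phi> y) / (t k)\<^sup>2 * z y) + A \<le> 0"
          using t(2)[of k] by (simp add: mult_le_0_iff)
      qed
      have "(\<lambda>k. (LINT y|lebesgue_on \<Omega>.
          (?\<phi> (y + t k *\<^sub>R e) + ?\<phi> (y - t k *\<^sub>R e) - 2 * ?\<phi> y) / (t k)\<^sup>2 * z y) + A)
          \<longlonglongrightarrow> (LINT y|lebesgue_on \<Omega>. pd e (pd e ?\<phi>) y * z y) + A"
        using t(2) by (intro tendsto_add tendsto_const second_difference_integral_tendsto zL \<phi> e t(1)) (metis less_irrefl)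
      then show ?thesis using ev by (intro tendsto_upperbound) auto
    qed
    \<comment> \<open>Summation over the directions gives \<open>DIM('a) * A\<close> as a lower
      bound of the energy, which the source keeps below \<open>C * h ^ DIM('a) < A\<close>.\<close>
    have "(\<Sum>e\<in>Basis. (LINT y|lebesgue_on \<Omega>. pd e (pd e ?\<phi>) y * z y) + A) \<le> 0"
      by (intro sum_nonpos le0)
    then have "real DIM('a) * A \<le> energy z ?\<phi>"
      using laplacian_test_integral[OF z \<phi>] by (simp add: sum.distrib)
    also have "energy z ?\<phi> = (LINT y|lebesgue_on \<Omega>. ?\<phi> y * g y)" by (rule eq[OF \<phi>])
    also have "\<dots> \<le> (LINT y|lebesgue_on \<Omega>. C * ?\<phi> y)"
    proof (rule integral_mono_AE)
      show "integrable (lebesgue_on \<Omega>) (\<lambda>y. ?\<phi> y * g y)"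
        using integrable_test[OF g sets_domain \<phi>] by simp
      show "AE y in lebesgue_on \<Omega>. ?\<phi> y * g y \<le> C * ?\<phi> y"
        using gU
      proof eventually_elim
        fix y assume "y \<in> U \<longrightarrow> g y \<le> C"
        then show "?\<phi> y * g y \<le> C * ?\<phi> y"
          using \<phi>0[of y] cubes(1)[OF x1(1)] bump_bounds(1)[of x1 "x1 + h *\<^sub>R One" n y]
          by (cases "y \<in> cbox x1 (x1 + h *\<^sub>R One)") (auto simp: mult.commute[of C] intro!: mult_left_mono)
      qed
    qed (use int\<phi> in simp)
    also have "\<dots> \<le> C * h ^ DIM('a)" using int\<phi>_le C(1) by (simp add: mult_left_mono)
    also have "\<dots> < 1 * A" using C(2) by simp
    also have "\<dots> \<le> real DIM('a) * A" using A DIM_positive[where 'a='a] by (intro mult_right_mono) (simp_all add: Suc_le_eq)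
    finally show False by simp
  qed
  \<comment> \<open>At a maximum outside the interior of \<open>K'\<close> the average is controlled
    by the bound on \<open>z\<close> itself; all other points of \<open>K\<close> inherit it up to
    the quadratic term.\<close>
  with x1(1) have bd1: "AE y in lebesgue_on \<Omega>. y \<in> cbox x1 (x1 + h *\<^sub>R One) \<longrightarrow> z y \<le> B"
    by (intro bd) auto
  have "Z x1 \<le> (LINT y|lebesgue_on \<Omega>. B * ?\<phi> y)"
    unfolding Z_def
  proof (rule integral_mono_AE)
    show "integrable (lebesgue_on \<Omega>) (\<lambda>y. ?\<phi> y * z y)"
      using integrable_test[OF L2_locally_integrable[OF zL] sets_domain \<phi>]
      by simp
    show "AE y in lebesgue_on \<Omega>. ?\<phi> y * z y \<le> B * ?\<phi> y"
      using bd1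
    proof eventually_elim
      fix y assume "y \<in> cbox x1 (x1 + h *\<^sub>R One) \<longrightarrow> z y \<le> B"
      then show "?\<phi> y * z y \<le> B * ?\<phi> y"
        using \<phi>0[of y] bump_bounds(1)[of x1 "x1 + h *\<^sub>R One" n y]
        by (cases "y \<in> cbox x1 (x1 + h *\<^sub>R One)") (auto simp: mult.commute[of B] intro!: mult_left_mono)
    qed
  qed (use int\<phi> in simp)
  also have "\<dots> \<le> B * h ^ DIM('a)" using int\<phi>_le B by (simp add: mult_left_mono)
  finally have Z1: "Z x1 \<le> B * h ^ DIM('a)" .
  have "Z x \<le> W x" using A by (simp add: W_def)
  also have "\<dots> \<le> W x1" by (rule x1(2)[OF x])
  also have "\<dots> \<le> B * h ^ DIM('a) + A / 2 * R\<^sup>2"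
    unfolding W_def using R[of x1] x1(1) K(2) A Z1 by (intro add_mono mult_left_mono power_mono) auto
  finally show ?thesis by (simp add: Z_def mult.commute)
qed

lemma le_if_le_plus_scaled:
  fixes X p q :: real
  assumes "\<And>\<eta>. \<eta> > 0 \<Longrightarrow> X \<le> p + \<eta> * q" shows "X \<le> p"
proof -
  have "(\<lambda>n. p + inverse (real (Suc n)) * q) \<longlonglongrightarrow> p + 0 * q"
    by (intro tendsto_intros LIMSEQ_inverse_real_of_nat)
  then show ?thesis using LIMSEQ_le_const[of _ "p + 0 * q" X] assms by fastforce
qed

text \<open>Continuity and boundary values enter only through \<open>zc\<close>, which dominates
  \<open>z\<close> up to \<open>\<epsilon>\<close> almost everywhere. Where \<open>zc\<close> is at
  least \<open>\<delta> > 0\<close> there is a positive distance to the frontier, so averages over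
  small cubes are available. The term \<open>C / 2 * R\<^sup>2\<close> is the size of the quadratic
  that compensates a source of at most \<open>C\<close>.\<close>

lemma weak_max_principle:
  assumes z: "z \<in> H1 \<Omega>" and g: "locally_integrable \<Omega> g"
    and eq: "\<And>\<phi>. \<phi> \<in> test_functions \<Omega> \<Longrightarrow> energy z \<phi> = (LINT y|lebesgue_on \<Omega>. \<phi> y * g y)"
    and zc: "continuous_on (closure \<Omega>) zc" "\<And>x. x \<in> frontier \<Omega> \<Longrightarrow> zc x \<le> 0"
    and close: "AE x in lebesgue_on \<Omega>. z x \<le> zc x + \<epsilon>" "0 \<le> \<epsilon>"
    and gC: "AE x in lebesgue_on \<Omega>. 0 < zc x \<longrightarrow> g x \<le> C" "0 \<le> C"
    and R: "\<And>x. x \<in> \<Omega> \<Longrightarrow> norm x \<le> R"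
  shows "AE x in lebesgue_on \<Omega>. z x \<le> \<epsilon> + C / 2 * R\<^sup>2"
proof -
  have zL: "integrable (lebesgue_on \<Omega>) z" by (intro L2_integrable H1_D z)
  have main: "AE x in lebesgue_on \<Omega>. z x \<le> \<epsilon> + 2 * \<delta> + C / 2 * R\<^sup>2" if \<delta>: "\<delta> > 0" for \<delta>
  proof -
    define K where "K = {x \<in> closure \<Omega>. \<delta> \<le> zc x}"
    define K' where "K' = {x \<in> \<Omega>. \<delta> < zc x}"
    define U where "U = {x \<in> \<Omega>. 0 < zc x}"
    have cc: "compact (closure \<Omega>)" using bounded_domain by (simp add: compact_closure)
    have K: "compact K" unfolding K_def
      using continuous_closed_preimage[OF zc(1) closed_closure, of "{\<delta>..}"] bounded_domain
      by (auto simp: compact_eq_bounded_closed vimage_def Int_def intro: bounded_subset[OF bounded_closure])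
    have K\<Omega>: "K \<subseteq> \<Omega>"
    proof
      fix x assume "x \<in> K"
      then have "x \<in> closure \<Omega>" "x \<notin> frontier \<Omega>" using zc(2)[of x] \<delta> by (auto simp: K_def)
      then show "x \<in> \<Omega>" using open_domain by (simp add: frontier_def interior_open)
    qed
    have zc\<Omega>: "continuous_on \<Omega> zc" by (rule continuous_on_subset[OF zc(1) closure_subset])
    have K'_open: "open K'" unfolding K'_def
      using continuous_open_preimage[OF zc\<Omega> open_domain, of "{\<delta><..}"] by (simp add: vimage_def Int_def)
    have K'K: "K' \<subseteq> K" using closure_subset by (auto simp: K_def K'_def)
    \<comment> \<open>Within \<open>\<rho>\<close> of \<open>K\<close> a point lies in
      \<open>\<Omega>\<close> and \<open>zc\<close> changes by less than \<open>\<delta>\<close>.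
      Cubes at points of \<open>K\<close> therefore stay where \<open>zc > 0\<close>, and there the
      bound on \<open>g\<close> is valid.\<close>
    obtain \<rho>1 where \<rho>1: "\<rho>1 > 0" "\<And>x y. x \<in> closure \<Omega> \<Longrightarrow> y \<in> closure \<Omega> \<Longrightarrow> dist y x < \<rho>1 \<Longrightarrow> dist (zc y) (zc x) < \<delta>"
      using compact_uniformly_continuous[OF zc(1) cc] \<delta> unfolding uniformly_continuous_on_def by metis
    obtain \<rho>2 where \<rho>2: "\<rho>2 > 0" "(\<Union>x\<in>K. ball x \<rho>2) \<subseteq> \<Omega>"
      using compact_subset_open_imp_ball_epsilon_subset[OF K open_domain K\<Omega>] by metis
    define \<rho> where "\<rho> = min \<rho>1 \<rho>2"
    have \<rho>: "\<rho> > 0" using \<rho>1(1) \<rho>2(1) by (simp add: \<rho>_def)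
    have near: "y \<in> \<Omega>" "\<bar>zc y - zc x\<bar> < \<delta>" if "x \<in> K" "dist x y < \<rho>" for x y
    proof -
      have "y \<in> ball x \<rho>2" using that by (simp add: \<rho>_def)
      then show y: "y \<in> \<Omega>" using \<rho>2(2) that(1) by blast
      show "\<bar>zc y - zc x\<bar> < \<delta>"
        using \<rho>1(2)[of x y] y that closure_subset by (auto simp: K_def \<rho>_def dist_real_def dist_commute)
    qed
    have cube: "cbox x (x + h *\<^sub>R One) \<subseteq> ball x \<rho>" if "0 < h" "h < \<rho> / DIM('a)" for h and x :: 'a
    proof -
      have "h * DIM('a) < \<rho>" using that by (simp add: field_simps)
      then show ?thesis using cube_subset_cball[of h x] that by force
    qed
    have "AE x in lebesgue_on K'. z x \<le> \<epsilon> + 2 * \<delta> + C / 2 * R\<^sup>2"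
    proof (rule AE_le_if_cube_integrals_le[OF _ K'_open])
      show "locally_integrable K' z"
        using integrable_imp_locally_integrable[OF zL sets_domain] K'K K\<Omega>
        unfolding locally_integrable_def by blast
      fix x assume "x \<in> K'"
      then have xK: "x \<in> K" using K'K by blast
      show "\<exists>d>0. \<forall>h. 0 < h \<and> h < d \<and> cbox x (x + h *\<^sub>R One) \<subseteq> K' \<longrightarrow>
               (LINT y|lebesgue_on (cbox x (x + h *\<^sub>R One)). z y) \<le> (\<epsilon> + 2 * \<delta> + C / 2 * R\<^sup>2) * h ^ DIM('a)"
      proof (intro exI[of _ "\<rho> / DIM('a)"] conjI allI impI)
        fix h assume "0 < h \<and> h < \<rho> / DIM('a) \<and> cbox x (x + h *\<^sub>R One) \<subseteq> K'"
        then have h: "0 < h" "h < \<rho> / DIM('a)" by auto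
        have cubes: "cbox y (y + h *\<^sub>R One) \<subseteq> U" if "y \<in> K" for y
          using cube[OF h, of y] near[OF that] that by (fastforce simp: U_def K_def)
        have bd: "AE w in lebesgue_on \<Omega>. w \<in> cbox y (y + h *\<^sub>R One) \<longrightarrow> z w \<le> \<epsilon> + 2 * \<delta>"
          if y: "y \<in> K - interior K'" for y
        proof -
          \<comment> \<open>\<open>K'\<close> is open, so \<open>zc\<close> is at most
            \<open>\<delta>\<close> at \<open>y\<close> and below \<open>2 * \<delta>\<close> on the
            whole cube.\<close>
          have "zc y \<le> \<delta>" using y K\<Omega> K'_open by (auto simp: interior_open K'_def)
          show ?thesis using close(1)
          proof eventually_elim
            fix w assume w: "z w \<le> zc w + \<epsilon>"
            show "w \<in> cbox y (y + h *\<^sub>R One) \<longrightarrow> z w \<le> \<epsilon> + 2 * \<delta>"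
            proof
              assume "w \<in> cbox y (y + h *\<^sub>R One)"
              then have "dist y w < \<rho>" using cube[OF h, of y] by auto
              then have "\<bar>zc w - zc y\<bar> < \<delta>" using near(2)[of y w] y by auto
              then show "z w \<le> \<epsilon> + 2 * \<delta>" using w \<open>zc y \<le> \<delta>\<close> by linarith
            qed
          qed
        qed
        have gU: "AE y in lebesgue_on \<Omega>. y \<in> U \<longrightarrow> g y \<le> C"
          using gC(1) by eventually_elim (auto simp: U_def)
        \<comment> \<open>The curvature must strictly exceed \<open>C * h ^ DIM('a)\<close>; the
          excess \<open>\<eta>\<close> is sent to 0 afterwards.\<close>
        have "(LINT y|lebesgue_on (cbox x (x + h *\<^sub>R One)). z y) \<le>
            (h ^ DIM('a) * (\<epsilon> + 2 * \<delta>) + C * h ^ DIM('a) / 2 * R\<^sup>2) + \<eta> * (R\<^sup>2 / 2)" if \<eta>: "\<eta> > 0" for \<eta>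
        proof (rule LIMSEQ_le_const2)
          show "(\<lambda>n. LINT y|lebesgue_on \<Omega>. bump x (x + h *\<^sub>R One) n y * z y) \<longlonglongrightarrow>
              (LINT y|lebesgue_on (cbox x (x + h *\<^sub>R One)). z y)"
            by (rule bump_integral_tendsto[OF integrable_imp_locally_integrable[OF zL sets_domain] _ sets_domain])
              (use cubes[OF xK] in \<open>auto simp: U_def\<close>)
          have "(LINT y|lebesgue_on \<Omega>. bump x (x + h *\<^sub>R One) n y * z y) \<le>
              h ^ DIM('a) * (\<epsilon> + 2 * \<delta>) + (C * h ^ DIM('a) + \<eta>) / 2 * R\<^sup>2" for n
            by (rule bump_average_le[OF z g eq K K\<Omega> h(1) cubes _ gU gC(2) _ bd K'K _ R xK])
              (use \<eta> \<delta> close(2) in \<open>auto simp: U_def\<close>)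
          then show "\<exists>N. \<forall>n\<ge>N. (LINT y|lebesgue_on \<Omega>. bump x (x + h *\<^sub>R One) n y * z y) \<le>
            (h ^ DIM('a) * (\<epsilon> + 2 * \<delta>) + C * h ^ DIM('a) / 2 * R\<^sup>2) + \<eta> * (R\<^sup>2 / 2)"
            by (simp add: field_simps)
        qed
        then have "(LINT y|lebesgue_on (cbox x (x + h *\<^sub>R One)). z y) \<le>
            h ^ DIM('a) * (\<epsilon> + 2 * \<delta>) + C * h ^ DIM('a) / 2 * R\<^sup>2"
          by (rule le_if_le_plus_scaled)
        then show "(LINT y|lebesgue_on (cbox x (x + h *\<^sub>R One)). z y) \<le> (\<epsilon> + 2 * \<delta> + C / 2 * R\<^sup>2) * h ^ DIM('a)"
          by (simp add: field_simps)
      qed (use \<rho> in simp)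
    qed
    then have "AE x in lebesgue. x \<in> K' \<longrightarrow> z x \<le> \<epsilon> + 2 * \<delta> + C / 2 * R\<^sup>2"
      using K'_open by (simp add: AE_restrict_space_iff)
    moreover have "AE x in lebesgue. x \<in> \<Omega> \<longrightarrow> z x \<le> zc x + \<epsilon>"
      using close(1) by (simp add: AE_restrict_space_iff)
    ultimately have "AE x in lebesgue. x \<in> \<Omega> \<longrightarrow> z x \<le> \<epsilon> + 2 * \<delta> + C / 2 * R\<^sup>2"
    proof eventually_elim
      fix x assume 1: "x \<in> K' \<longrightarrow> z x \<le> \<epsilon> + 2 * \<delta> + C / 2 * R\<^sup>2" "x \<in> \<Omega> \<longrightarrow> z x \<le> zc x + \<epsilon>"
      have "0 \<le> C / 2 * R\<^sup>2" using gC(2) by simp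
      then show "x \<in> \<Omega> \<longrightarrow> z x \<le> \<epsilon> + 2 * \<delta> + C / 2 * R\<^sup>2"
        using 1 \<delta> by (cases "x \<in> K'") (auto simp: K'_def)
    qed
    then show ?thesis by (simp add: AE_restrict_space_iff)
  qed
  \<comment> \<open>Letting \<open>\<delta>\<close> run through a sequence keeps a common null
    set.\<close>
  have "AE x in lebesgue_on \<Omega>. \<forall>n. z x \<le> \<epsilon> + 2 * inverse (real (Suc n)) + C / 2 * R\<^sup>2"
    unfolding AE_all_countable by (intro allI main) simp
  then show ?thesis
  proof eventually_elim
    fix x assume *: "\<forall>n. z x \<le> \<epsilon> + 2 * inverse (real (Suc n)) + C / 2 * R\<^sup>2"
    have "(\<lambda>n. \<epsilon> + 2 * inverse (real (Suc n)) + C / 2 * R\<^sup>2) \<longlonglongrightarrow> \<epsilon> + 2 * 0 + C / 2 * R\<^sup>2"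
      by (intro tendsto_intros LIMSEQ_inverse_real_of_nat)
    then show "z x \<le> \<epsilon> + C / 2 * R\<^sup>2" using * LIMSEQ_le_const[of _ "\<epsilon> + 2 * 0 + C / 2 * R\<^sup>2" "z x"] by simp
  qed
qed

end

section \<open>Existence of Galerkin solutions by minimization\<close>

context bounded_domain
begin

lemma energy_expand:
  assumes v: "v \<in> H1 \<Omega>" and w: "w \<in> H1 \<Omega>"
  shows "energy (\<lambda>x. v x + c * w x) (\<lambda>x. v x + c * w x) = energy v v + 2 * c * energy v w + c\<^sup>2 * energy w w"
  by (simp add: energy_lincomb_left energy_lincomb_right H1_lincomb v w energy_commute[of w v]
      power2_eq_square algebra_simps)

text \<open>Closed linear subspaces of \<open>H10 \<Omega>\<close> for the energy norm, isolated so
  that one minimization argument covers both \<open>H10\<close> and the finite element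
  space.\<close>

definition energy_complete :: "('a \<Rightarrow> real) set \<Rightarrow> bool" where
  "energy_complete V \<longleftrightarrow> V \<subseteq> H10 \<Omega> \<and> (\<lambda>x. 0) \<in> V \<and>
     (\<forall>v\<in>V. \<forall>w\<in>V. \<forall>c. (\<lambda>x. v x + c * w x) \<in> V) \<and>
     (\<forall>v. (\<forall>n::nat. v n \<in> V) \<and>
        (\<forall>e>0. \<exists>N. \<forall>m\<ge>N. \<forall>n\<ge>N. energy (\<lambda>x. v m x - v n x) (\<lambda>x. v m x - v n x) < e) \<longrightarrow>
        (\<exists>u\<in>V. (\<lambda>n. energy (\<lambda>x. v n x - u x) (\<lambda>x. v n x - u x)) \<longlonglongrightarrow> 0))"

lemma energy_complete_H10: "energy_complete (H10 \<Omega>)"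
proof -
  have "(\<lambda>x. 0) \<in> test_functions \<Omega>"
    by (rule test_functionsI[of _ "{}"]) (auto simp: smooth_def Ck_const)
  moreover have "\<exists>u\<in>H10 \<Omega>. (\<lambda>n. energy (\<lambda>x. v n x - u x) (\<lambda>x. v n x - u x)) \<longlonglongrightarrow> 0"
    if v: "\<And>n. v n \<in> H10 \<Omega>"
      and C: "\<And>e. e > 0 \<Longrightarrow> \<exists>N. \<forall>m\<ge>N. \<forall>n\<ge>N. energy (\<lambda>x. v m x - v n x) (\<lambda>x. v m x - v n x) < e"
    for v :: "nat \<Rightarrow> 'a \<Rightarrow> real"
    by (rule H10_complete[of v, OF v C]) auto
  ultimately show ?thesis
    unfolding energy_complete_def using test_H10 H10_lincomb by blast
qed

text \<open>The subgradient inequality for \<open>\<Phi>\<close> makes \<open>v \<mapsto> energy v v / 2 + \<Phi> v\<close> strongly convex, so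
  that minimizing sequences are Cauchy in the energy norm.\<close>

lemma monotone_problem_solvable:
  fixes N :: "('a \<Rightarrow> real) \<Rightarrow> ('a \<Rightarrow> real) \<Rightarrow> real"
  assumes V: "energy_complete V"
    and lin: "\<And>v w \<phi> c. v \<in> V \<Longrightarrow> w \<in> V \<Longrightarrow> \<phi> \<in> V \<Longrightarrow> N v (\<lambda>x. w x + c * \<phi> x) = N v w + c * N v \<phi>"
    and bound: "\<And>v w. v \<in> V \<Longrightarrow> w \<in> V \<Longrightarrow> (N v w)\<^sup>2 \<le> B * energy w w" and B: "0 \<le> B"
    and subgrad: "\<And>v w. v \<in> V \<Longrightarrow> w \<in> V \<Longrightarrow> \<Phi> v + N v (\<lambda>x. w x + (-1) * v x) \<le> \<Phi> w"
    and hemi: "\<And>v \<phi>. v \<in> V \<Longrightarrow> \<phi> \<in> V \<Longrightarrow>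
      (\<lambda>n. N (\<lambda>x. v x + inverse (real (Suc n)) * \<phi> x) \<phi>) \<longlonglongrightarrow> N v \<phi>"
  obtains u where "u \<in> V" "\<And>\<phi>. \<phi> \<in> V \<Longrightarrow> energy u \<phi> + N u \<phi> = 0"
proof -
  have VH: "v \<in> H1 \<Omega>" if "v \<in> V" for v
    using V that H10_D(1) unfolding energy_complete_def by blast
  have V0: "(\<lambda>x. 0) \<in> V" and Vl: "\<And>v w c. v \<in> V \<Longrightarrow> w \<in> V \<Longrightarrow> (\<lambda>x. v x + c * w x) \<in> V"
    using V unfolding energy_complete_def by blast+
  define J where "J = (\<lambda>v. energy v v / 2 + \<Phi> v)"
  \<comment> \<open>Together with the subgradient inequality at 0 this bounds \<open>J\<close> from
    below: half of the energy absorbs the linear growth of \<open>N\<close>.\<close>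
  have N_ge: "- (B + energy w w) / 2 \<le> N v w" if "v \<in> V" "w \<in> V" for v w
  proof -
    have "(N v w)\<^sup>2 \<le> ((B + energy w w) / 2)\<^sup>2"
    proof -
      have "4 * (B * energy w w) \<le> (B + energy w w)\<^sup>2"
        using zero_le_power2[of "B - energy w w"] by (simp add: power2_eq_square algebra_simps)
      then show ?thesis using bound[OF that] by (simp add: power_divide)
    qed
    then have "\<bar>N v w\<bar> \<le> (B + energy w w) / 2"
      using B energy_nonneg[of w] by (intro power2_le_imp_le[of "\<bar>N v w\<bar>"]) auto
    then show ?thesis by (simp add: abs_le_iff field_simps)
  qed
  have J_ge: "\<Phi> (\<lambda>x. 0) - B / 2 \<le> J w" if w: "w \<in> V" for w
    using subgrad[OF V0 w] N_ge[OF V0 w] by (simp add: J_def field_simps)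
  define I where "I = Inf (J ` V)"
  have bdd: "bdd_below (J ` V)" using J_ge by (intro bdd_belowI2) auto
  have I: "I \<le> J w" if "w \<in> V" for w unfolding I_def using bdd that by (intro cInf_lower) auto
  have "\<exists>v\<in>V. J v < I + inverse (real (Suc n))" for n
  proof -
    have "Inf (J ` V) < I + inverse (real (Suc n))" by (simp add: I_def)
    then show ?thesis using cInf_lessD[of "J ` V"] V0 by blast
  qed
  then have "\<forall>n. \<exists>v. v \<in> V \<and> J v < I + inverse (real (Suc n))" by blast
  from choice[OF this] obtain v where v: "\<And>n. v n \<in> V" "\<And>n. J (v n) < I + inverse (real (Suc n))" by blast
  \<comment> \<open>The subgradient inequality is used at the midpoint \<open>m\<close>, towards
    \<open>p\<close> and towards \<open>q\<close>. The two linear terms cancel, and the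
    parallelogram identity leaves a quarter of the energy distance.\<close>
  have convex: "2 * I + energy (\<lambda>x. p x - q x) (\<lambda>x. p x - q x) / 4 \<le> J p + J q" if p: "p \<in> V" and q: "q \<in> V" for p q
  proof -
    define w where "w = (\<lambda>x. p x + (-1) * q x)"
    define m where "m = (\<lambda>x. q x + (1/2) * w x)"
    have w: "w \<in> V" and m: "m \<in> V" unfolding w_def m_def by (intro Vl p q)+
    have pw: "p = (\<lambda>x. m x + (1/2) * w x)" and qw: "q = (\<lambda>x. m x + (-1/2) * w x)"
      by (auto simp: w_def m_def field_simps)
    have z: "N m (\<lambda>x. 0 + c * w x) = c * N m w" for c
    proof -
      have "N m (\<lambda>x. 0 + 1 * (0::real)) = N m (\<lambda>x. 0) + 1 * N m (\<lambda>x. 0)"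
        using lin[OF m V0 V0, of 1] by simp
      then have "N m (\<lambda>x. 0) = 0" by simp
      then show ?thesis using lin[OF m V0 w, of c] by simp
    qed
    have "\<Phi> m + (1/2) * N m w \<le> \<Phi> p"
    proof -
      have "(\<lambda>x. p x + (-1) * m x) = (\<lambda>x. 0 + (1/2) * w x)" by (subst pw) simp
      then show ?thesis using subgrad[OF m p] z[of "1/2"] by simp
    qed
    moreover have "\<Phi> m + (-1/2) * N m w \<le> \<Phi> q"
    proof -
      have "(\<lambda>x. q x + (-1) * m x) = (\<lambda>x. 0 + (-1/2) * w x)" by (subst qw) simp
      then show ?thesis using subgrad[OF m q] z[of "-1/2"] by simp
    qed
    moreover have "energy p p = energy m m + energy m w + energy w w / 4"
      unfolding pw using energy_expand[OF VH[OF m] VH[OF w], of "1/2"] by (simp add: power2_eq_square)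
    moreover have "energy q q = energy m m - energy m w + energy w w / 4"
      unfolding qw using energy_expand[OF VH[OF m] VH[OF w], of "-1/2"] by (simp add: power2_eq_square)
    moreover have "I \<le> energy m m / 2 + \<Phi> m" using I[OF m] by (simp add: J_def)
    moreover have "energy (\<lambda>x. p x - q x) (\<lambda>x. p x - q x) = energy w w" by (simp add: w_def)
    ultimately show ?thesis unfolding J_def by (simp add: field_simps)
  qed
  have Cauchy: "\<exists>M. \<forall>m\<ge>M. \<forall>n\<ge>M. energy (\<lambda>x. v m x - v n x) (\<lambda>x. v m x - v n x) < e" if e: "e > 0" for e
  proof -
    \<comment> \<open>By \<open>convex\<close> the energy distance is at most four times the sum of
      the two excesses over \<open>I\<close>, each of them below \<open>e / 8\<close>.\<close>
    obtain M where M: "inverse (real (Suc M)) < e / 8" using reals_Archimedean[of "e / 8"] e by auto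
    have "energy (\<lambda>x. v m x - v n x) (\<lambda>x. v m x - v n x) < e" if "m \<ge> M" "n \<ge> M" for m n
    proof -
      have "inverse (real (Suc m)) \<le> inverse (real (Suc M))" "inverse (real (Suc n)) \<le> inverse (real (Suc M))"
        using that by (simp_all add: field_simps)
      then show ?thesis using convex[OF v(1) v(1), of m n] v(2)[of m] v(2)[of n] M by linarith
    qed
    then show ?thesis by blast
  qed
  obtain u where u: "u \<in> V" "(\<lambda>n. energy (\<lambda>x. v n x - u x) (\<lambda>x. v n x - u x)) \<longlonglongrightarrow> 0"
    using V v(1) Cauchy unfolding energy_complete_def by blast
  \<comment> \<open>Lower semicontinuity without continuity of \<open>\<Phi>\<close>: the
    subgradient inequality at \<open>u\<close> bounds \<open>J (v n)\<close> from below by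
    \<open>J u\<close> plus terms linear in \<open>v n - u\<close>, which tend to 0.\<close>
  have Ju: "J u \<le> J w" if w: "w \<in> V" for w
  proof -
    define d where "d = (\<lambda>n x. v n x + (-1) * u x)"
    have d: "d n \<in> V" for n unfolding d_def by (intro Vl v u)
    have d0: "(\<lambda>n. energy (d n) (d n)) \<longlonglongrightarrow> 0" using u(2) by (simp add: d_def)
    have sq0: "X \<longlonglongrightarrow> 0" if "\<And>n. (X n)\<^sup>2 \<le> c * energy (d n) (d n)" for X :: "nat \<Rightarrow> real" and c
    proof -
      have "(\<lambda>n. (X n)\<^sup>2) \<longlonglongrightarrow> 0"
        by (rule tendsto_sandwich[OF _ _ tendsto_const tendsto_mult_right_zero[OF d0, of c]])
          (use that in auto)
      then have "(\<lambda>n. sqrt ((X n)\<^sup>2)) \<longlonglongrightarrow> sqrt 0" by (rule tendsto_real_sqrt)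
      then show ?thesis by (simp add: tendsto_rabs_zero_iff)
    qed
    have 1: "(\<lambda>n. energy u (d n)) \<longlonglongrightarrow> 0"
      by (rule sq0[of _ "energy u u"]) (intro energy_Cauchy_Schwarz VH u(1) d)
    have 2: "(\<lambda>n. N u (d n)) \<longlonglongrightarrow> 0" by (rule sq0[of _ B]) (rule bound[OF u(1) d])
    have "J u + energy u (d n) + N u (d n) \<le> I + inverse (real (Suc n))" for n
    proof -
      have "v n = (\<lambda>x. u x + 1 * d n x)" by (simp add: d_def)
      then have "energy (v n) (v n) = energy u u + 2 * energy u (d n) + energy (d n) (d n)"
        using energy_expand[OF VH[OF u(1)] VH[OF d[of n]], of 1] by simp
      moreover have "\<Phi> u + N u (d n) \<le> \<Phi> (v n)"
        using subgrad[OF u(1) v(1)[of n]] by (simp add: d_def)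
      ultimately have "J u + energy u (d n) + N u (d n) \<le> J (v n)"
        using energy_nonneg[of "d n"] by (simp add: J_def field_simps)
      then show ?thesis using v(2)[of n] by simp
    qed
    moreover have "(\<lambda>n. J u + energy u (d n) + N u (d n)) \<longlonglongrightarrow> J u + 0 + 0"
      by (intro tendsto_intros 1 2)
    moreover have "(\<lambda>n. I + inverse (real (Suc n))) \<longlonglongrightarrow> I + 0"
      by (intro tendsto_intros LIMSEQ_inverse_real_of_nat)
    ultimately have "J u \<le> I" using LIMSEQ_le[of "\<lambda>n. J u + energy u (d n) + N u (d n)" "J u" "\<lambda>n. I + inverse (real (Suc n))" I] by auto
    then show ?thesis using I[OF w] by simp
  qed
  \<comment> \<open>In place of a derivative of \<open>\<Phi>\<close> the subgradient at the
    perturbed point \<open>u + t \<phi>\<close> is compared with the minimality of \<open>u\<close>;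
    \<open>hemi\<close> then lets \<open>t\<close> tend to 0. The reverse inequality comes from
    \<open>- \<phi>\<close>.\<close>
  have EL: "0 \<le> energy u \<phi> + N u \<phi>" if \<phi>: "\<phi> \<in> V" for \<phi>
  proof (rule LIMSEQ_le_const)
    define t where "t = (\<lambda>n. inverse (real (Suc n)))"
    have t: "t \<longlonglongrightarrow> 0" "\<And>n. t n > 0" unfolding t_def using LIMSEQ_inverse_real_of_nat by auto
    show "(\<lambda>n. energy u \<phi> + t n / 2 * energy \<phi> \<phi> + N (\<lambda>x. u x + t n * \<phi> x) \<phi>) \<longlonglongrightarrow> energy u \<phi> + N u \<phi>"
    proof -
      have "(\<lambda>n. energy u \<phi> + t n / 2 * energy \<phi> \<phi> + N (\<lambda>x. u x + t n * \<phi> x) \<phi>) \<longlonglongrightarrow>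
          energy u \<phi> + 0 / 2 * energy \<phi> \<phi> + N u \<phi>"
        using hemi[OF u(1) \<phi>] by (intro tendsto_intros t) (auto simp: t_def)
      then show ?thesis by simp
    qed
    have "0 \<le> energy u \<phi> + t n / 2 * energy \<phi> \<phi> + N (\<lambda>x. u x + t n * \<phi> x) \<phi>" for n
    proof -
      define w where "w = (\<lambda>x. u x + t n * \<phi> x)"
      have w: "w \<in> V" unfolding w_def by (intro Vl u \<phi>)
      have "N w (\<lambda>x. u x + (-1) * w x) = - t n * N w \<phi>"
      proof -
        have "N w (\<lambda>x. 0) = 0" using lin[OF w V0 V0, of 1] by simp
        then have "N w (\<lambda>x. 0 + (- t n) * \<phi> x) = - t n * N w \<phi>" using lin[OF w V0 \<phi>, of "- t n"] by simp
        then show ?thesis by (simp add: w_def)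
      qed
      then have "\<Phi> w - t n * N w \<phi> \<le> \<Phi> u" using subgrad[OF w u(1)] by simp
      moreover have "energy w w = energy u u + 2 * t n * energy u \<phi> + (t n)\<^sup>2 * energy \<phi> \<phi>"
        unfolding w_def by (rule energy_expand[OF VH[OF u(1)] VH[OF \<phi>]])
      ultimately have "0 \<le> t n * (energy u \<phi> + t n / 2 * energy \<phi> \<phi> + N w \<phi>)"
        using Ju[OF w] by (simp add: J_def field_simps power2_eq_square)
      then show ?thesis using t(2)[of n] by (simp add: zero_le_mult_iff w_def)
    qed
    then show "\<exists>n0. \<forall>n\<ge>n0. 0 \<le> energy u \<phi> + t n / 2 * energy \<phi> \<phi> + N (\<lambda>x. u x + t n * \<phi> x) \<phi>" by blast
  qed
  have "energy u \<phi> + N u \<phi> = 0" if \<phi>: "\<phi> \<in> V" for \<phi>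
  proof -
    have m: "(\<lambda>x. 0 + (-1) * \<phi> x) \<in> V" by (intro Vl V0 \<phi>)
    have "N u (\<lambda>x. 0) = 0" using lin[OF u(1) V0 V0, of 1] by simp
    then have "N u (\<lambda>x. 0 + (-1) * \<phi> x) = - N u \<phi>" using lin[OF u(1) V0 \<phi>, of "-1"] by simp
    moreover have "energy u (\<lambda>x. 0) = 0"
      using energy_lincomb_right[OF VH[OF V0] VH[OF V0] VH[OF u(1)], of 1] by simp
    then have "energy u (\<lambda>x. 0 + (-1) * \<phi> x) = - energy u \<phi>"
      using energy_lincomb_right[OF VH[OF V0] VH[OF \<phi>] VH[OF u(1)], of "-1"] by simp
    ultimately show ?thesis using EL[OF \<phi>] EL[OF m] by linarith
  qed
  with u(1) show ?thesis by (rule that)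
qed

text \<open>The linear instance of the minimization: with \<open>N\<close> constant in its first
  argument the subgradient inequality is an equality and hemicontinuity is trivial.\<close>

lemma Poisson_solvable:
  assumes g: "g \<in> L2 \<Omega>"
  obtains z where "z \<in> H10 \<Omega>" "\<And>\<phi>. \<phi> \<in> H10 \<Omega> \<Longrightarrow> energy z \<phi> = L2_inner \<Omega> g \<phi>"
proof -
  obtain C where C: "C > 0" "\<And>v. v \<in> H10 \<Omega> \<Longrightarrow> L2_sq \<Omega> v \<le> C * energy v v" by (rule Poincare) blast
  define N where "N = (\<lambda>(v :: 'a \<Rightarrow> real) w. - L2_inner \<Omega> g w)"
  have lin: "L2_inner \<Omega> g (\<lambda>x. w x + c * \<phi> x) = L2_inner \<Omega> g w + c * L2_inner \<Omega> g \<phi>"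
    if "w \<in> H10 \<Omega>" "\<phi> \<in> H10 \<Omega>" for w \<phi> c
    using L2_inner_lincomb_right[OF H10_D(2)[OF that(1)] H10_D(2)[OF that(2)] g, of c] by simp
  obtain u where u: "u \<in> H10 \<Omega>" "\<And>\<phi>. \<phi> \<in> H10 \<Omega> \<Longrightarrow> energy u \<phi> + N u \<phi> = 0"
  proof (rule monotone_problem_solvable[OF energy_complete_H10, of N "L2_sq \<Omega> g * C" "\<lambda>w. - L2_inner \<Omega> g w"])
    fix v w assume "v \<in> H10 \<Omega>" and w: "w \<in> H10 \<Omega>"
    have "(L2_inner \<Omega> g w)\<^sup>2 \<le> L2_sq \<Omega> g * L2_sq \<Omega> w" by (rule L2_Cauchy_Schwarz[OF g H10_D(2)[OF w]])
    also have "\<dots> \<le> L2_sq \<Omega> g * (C * energy w w)" by (intro mult_left_mono C w) simp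
    finally show "(N v w)\<^sup>2 \<le> L2_sq \<Omega> g * C * energy w w" by (simp add: N_def)
  next
    fix v w assume "v \<in> H10 \<Omega>" "w \<in> H10 \<Omega>"
    then show "- L2_inner \<Omega> g v + N v (\<lambda>x. w x + (-1) * v x) \<le> - L2_inner \<Omega> g w"
      using lin[of w v "-1"] by (simp add: N_def)
  qed (use C(1) lin in \<open>auto simp: N_def\<close>)
  show ?thesis by (rule that[OF u(1)]) (use u(2) in \<open>simp add: N_def\<close>)
qed

end

section \<open>Linear finite elements\<close>

lemma inball_diameter_nonneg:
  fixes K :: "'a::euclidean_space set"
  assumes "bounded K" "K \<noteq> {}" shows "0 \<le> inball_diameter K"
proof -
  obtain x where x: "x \<in> K" using assms(2) by blast
  have "2 * r \<le> diameter K" if "0 \<le> r" "cball x r \<subseteq> K" for r x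
    using diameter_subset[OF that(2) assms(1)] that(1) by simp
  then have "bdd_above {2 * r | r. 0 \<le> r \<and> (\<exists>x. cball x r \<subseteq> K)}"
    by (intro bdd_aboveI[of _ "diameter K"]) auto
  moreover have "0 \<in> {2 * r | r. 0 \<le> r \<and> (\<exists>x. cball x r \<subseteq> K)}"
    using x by (auto intro!: exI[of _ x])
  ultimately show ?thesis unfolding inball_diameter_def by (rule cSup_upper[rotated])
qed

text \<open>The two mesh conditions chain to
  \<open>h0 \<le> \<kappa> * \<sigma> * inball_diameter K\<close>. One factor 2 passes from diameter
  to radius, the other leaves room below the supremum. Positivity of
  \<open>\<kappa> * \<sigma>\<close>, nowhere assumed, follows from the existence of a cell.\<close>

lemma cell_contains_ball:
  fixes K :: "'a::euclidean_space set"
  assumes K: "K \<in> \<T>" "bounded K" and sr: "shape_regular \<sigma> \<T>" and qu: "quasi_uniform \<kappa> \<T>"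
    and h0: "0 < h0" "h0 \<le> mesh_size \<T>"
  obtains c r where "0 < \<kappa> * \<sigma>" "h0 / (4 * (\<kappa> * \<sigma>)) < r" "cball c r \<subseteq> K"
proof -
  have d: "h0 \<le> \<kappa> * diameter K" "diameter K \<le> \<sigma> * inball_diameter K"
    using K(1) sr qu h0(2) unfolding shape_regular_def quasi_uniform_def by force+
  have dK: "0 \<le> diameter K" by (rule diameter_ge_0[OF K(2)])
  have "0 < \<kappa> * diameter K" using d(1) h0(1) by linarith
  then have \<kappa>: "0 < \<kappa>" "0 < diameter K" using dK by (auto simp: zero_less_mult_iff)
  have K0: "K \<noteq> {}" using \<kappa>(2) by auto
  have i: "0 \<le> inball_diameter K" by (rule inball_diameter_nonneg[OF K(2) K0])
  have "0 < \<sigma> * inball_diameter K" using d(2) \<kappa>(2) by linarith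
  then have \<sigma>: "0 < \<sigma>" using i by (auto simp: zero_less_mult_iff)
  have "h0 \<le> (\<kappa> * \<sigma>) * inball_diameter K"
    using order_trans[OF d(1) mult_left_mono[OF d(2) less_imp_le[OF \<kappa>(1)]]] by (simp only: mult.assoc)
  then have "h0 / (2 * (\<kappa> * \<sigma>)) < inball_diameter K"
    using \<kappa>(1) \<sigma> h0(1) by (simp add: field_simps)
  moreover have "{2 * r | r. 0 \<le> r \<and> (\<exists>x. cball x r \<subseteq> K)} \<noteq> {}"
    using K0 by (auto intro!: exI[of _ "0::real"])
  ultimately obtain q where "q \<in> {2 * r | r. 0 \<le> r \<and> (\<exists>x. cball x r \<subseteq> K)}" "h0 / (2 * (\<kappa> * \<sigma>)) < q"
    unfolding inball_diameter_def by (rule less_cSupE)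
  then obtain r c where r: "h0 / (2 * (\<kappa> * \<sigma>)) < 2 * r" "cball c r \<subseteq> K" by auto
  have "h0 / (4 * (\<kappa> * \<sigma>)) < r" using r(1) by (simp add: field_simps)
  then show ?thesis using that[OF _ _ r(2)] \<kappa> \<sigma> by simp
qed

lemma simplicial_mesh_D:
  fixes \<Omega> :: "'a::euclidean_space set"
  assumes "simplicial_mesh \<Omega> \<T>" "K \<in> \<T>"
  shows "convex K" "K \<subseteq> closure \<Omega>" "aff_dim K = int DIM('a)"
  using assms unfolding simplicial_mesh_def
  by (auto intro: convex_simplex aff_dim_simplex)

text \<open>A cell of diameter zero would be a single point, against its full affine
  dimension.\<close>

lemma mesh_size_pos:
  fixes \<Omega> :: "'a::euclidean_space set"
  assumes m: "simplicial_mesh \<Omega> \<T>" and \<Omega>: "\<Omega> \<noteq> {}" "bounded \<Omega>"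
  shows "0 < mesh_size \<T>"
proof -
  have fin: "finite \<T>" using m by (auto simp: simplicial_mesh_def triangulation_def)
  obtain x where "x \<in> closure \<Omega>" using \<Omega>(1) closure_subset by blast
  then obtain K where K: "K \<in> \<T>" using m by (auto simp: simplicial_mesh_def)
  note D = simplicial_mesh_D[OF m K]
  have bK: "bounded K" using D(2) \<Omega>(2) bounded_subset bounded_closure by blast
  have "diameter K \<noteq> 0"
  proof
    assume 0: "diameter K = 0"
    have "K \<noteq> {}" using D(3) by auto
    then obtain p where p: "p \<in> K" by blast
    have "K \<subseteq> {p}" using diameter_bounded_bound[OF bK _ p] 0 by fastforce
    then have "aff_dim K \<le> aff_dim {p}" by (rule aff_dim_subset)
    then show False using D(3) DIM_positive[where 'a='a] by simp
  qed
  then have "0 < diameter K" using diameter_ge_0[OF bK] by simp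
  also have "\<dots> \<le> mesh_size \<T>" unfolding mesh_size_def using fin K by (intro Max_ge) auto
  finally show ?thesis .
qed

lemma C0_bounded:
  assumes "v \<in> C0 \<Omega>" "bounded \<Omega>"
  obtains B where "0 \<le> B" "\<And>x. x \<in> closure \<Omega> \<Longrightarrow> \<bar>v x\<bar> \<le> B"
proof -
  have "compact (closure \<Omega>)" using assms(2) by (simp add: compact_closure)
  then have "bounded (v ` closure \<Omega>)"
    using assms(1) by (intro compact_imp_bounded compact_continuous_image) (auto simp: C0_def)
  then show ?thesis using that unfolding bounded_pos by (auto intro: less_imp_le)
qed

lemma C0_lincomb: "v \<in> C0 \<Omega> \<Longrightarrow> w \<in> C0 \<Omega> \<Longrightarrow> (\<lambda>x. v x + c * w x) \<in> C0 \<Omega>"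
  unfolding C0_def by (auto intro!: continuous_intros)

locale convex_domain = bounded_domain \<Omega> for \<Omega> :: "'a::euclidean_space set" +
  assumes convex_domain: "convex \<Omega>" and nonempty_domain: "\<Omega> \<noteq> {}"
begin

lemma C0_measurable: "v \<in> C0 \<Omega> \<Longrightarrow> v \<in> borel_measurable (lebesgue_on \<Omega>)"
  unfolding C0_def
  by (auto intro!: continuous_imp_measurable_on_sets_lebesgue continuous_on_subset[OF _ closure_subset])

lemma Vh_D:
  assumes "v \<in> Vh \<Omega> \<T>"
  shows "v \<in> H10 \<Omega>" "v \<in> C0 \<Omega>" "\<And>K. K \<in> \<T> \<Longrightarrow> \<exists>a b. \<forall>x\<in>K. v x = a \<bullet> x + b"
  using assms by (auto simp: Vh_def)

lemma Vh_lincomb: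
  assumes "v \<in> Vh \<Omega> \<T>" "w \<in> Vh \<Omega> \<T>" shows "(\<lambda>x. v x + c * w x) \<in> Vh \<Omega> \<T>"
proof -
  have "\<exists>a b. \<forall>x\<in>K. v x + c * w x = a \<bullet> x + b" if K: "K \<in> \<T>" for K
  proof -
    obtain a b a' b' where "\<forall>x\<in>K. v x = a \<bullet> x + b" "\<forall>x\<in>K. w x = a' \<bullet> x + b'"
      using Vh_D(3)[OF assms(1) K] Vh_D(3)[OF assms(2) K] by blast
    then show ?thesis
      by (intro exI[of _ "a + c *\<^sub>R a'"] exI[of _ "b + c * b'"]) (auto simp: inner_add_left algebra_simps)
  qed
  then show ?thesis
    using H10_lincomb[OF Vh_D(1)[OF assms(1)] Vh_D(1)[OF assms(2)]]
      C0_lincomb[OF Vh_D(2)[OF assms(1)] Vh_D(2)[OF assms(2)]] by (auto simp: Vh_def)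
qed

lemma Vh_zero: "(\<lambda>x. 0) \<in> Vh \<Omega> \<T>"
proof -
  have "(\<lambda>x. 0) \<in> H10 \<Omega>" using energy_complete_H10 by (auto simp: energy_complete_def)
  then show ?thesis by (auto simp: Vh_def C0_def intro!: exI[of _ "0::'a"] exI[of _ "0::real"])
qed

text \<open>Near a point where \<open>\<bar>v\<bar>\<close> is maximal, namely on the image of an inscribed ball under the
  homothety with ratio \<open>1/4\<close> centred there, an affine function is at least half its maximum.\<close>

lemma inverse_estimate:
  assumes h0: "0 < h0"
  obtains C where "0 < C" "\<And>\<T> v x. simplicial_mesh \<Omega> \<T> \<Longrightarrow> shape_regular \<sigma> \<T> \<Longrightarrow> quasi_uniform \<kappa> \<T> \<Longrightarrow>
    h0 \<le> mesh_size \<T> \<Longrightarrow> v \<in> Vh \<Omega> \<T> \<Longrightarrow> x \<in> closure \<Omega> \<Longrightarrow> (v x)\<^sup>2 \<le> C * energy v v"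
proof -
  obtain CP where CP: "CP > 0" "\<And>v. v \<in> H10 \<Omega> \<Longrightarrow> L2_sq \<Omega> v \<le> CP * energy v v" by (rule Poincare) blast
  \<comment> \<open>A quarter of the radius granted by \<open>cell_contains_ball\<close>, the effect
    of the homothety. If \<open>\<kappa> * \<sigma>\<close> is not positive no mesh qualifies, and
    \<open>m0\<close> takes the dummy value 1.\<close>
  define r0 where "r0 = h0 / (16 * (\<kappa> * \<sigma>))"
  define m0 where "m0 = (if 0 < r0 then measure lebesgue (ball (0::'a) r0) else 1)"
  have m0: "0 < m0" by (simp add: m0_def content_ball_pos)
  show ?thesis
  proof (rule that[of "4 / m0 * CP"])
    show "0 < 4 / m0 * CP" using m0 CP by simp
    fix \<T> v x
    assume m: "simplicial_mesh \<Omega> \<T>" and sr: "shape_regular \<sigma> \<T>" and qu: "quasi_uniform \<kappa> \<T>"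
      and h: "h0 \<le> mesh_size \<T>" and v: "v \<in> Vh \<Omega> \<T>" and x: "x \<in> closure \<Omega>"
    note V = Vh_D[OF v]
    have 1: "compact (closure \<Omega>)" using bounded_domain by (simp add: compact_closure)
    have 2: "continuous_on (closure \<Omega>) (\<lambda>x. \<bar>v x\<bar>)"
      using V(2) by (auto simp: C0_def intro!: continuous_intros)
    from continuous_attains_sup[OF 1 _ 2] nonempty_domain
    obtain p where p: "p \<in> closure \<Omega>" "\<forall>y\<in>closure \<Omega>. \<bar>v y\<bar> \<le> \<bar>v p\<bar>" by auto
    obtain K where K: "K \<in> \<T>" "p \<in> K" using p(1) m by (auto simp: simplicial_mesh_def)
    note D = simplicial_mesh_D[OF m K(1)]
    have bK: "bounded K" using D(2) bounded_domain bounded_subset bounded_closure by blast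
    obtain c r where cr: "0 < \<kappa> * \<sigma>" "h0 / (4 * (\<kappa> * \<sigma>)) < r" "cball c r \<subseteq> K"
      by (rule cell_contains_ball[OF K(1) bK sr qu h0 h])
    have r0: "0 < r0" "4 * r0 < r" using cr h0 by (auto simp: r0_def)
    obtain a b where ab: "\<And>y. y \<in> K \<Longrightarrow> v y = a \<bullet> y + b" using V(3)[OF K(1)] by blast
    define q where "q = p + (1/4) *\<^sub>R (c - p)"
    have B: "y \<in> K \<and> \<bar>v p\<bar> / 2 \<le> \<bar>v y\<bar>" if y: "y \<in> ball q r0" for y
    proof -
      define w where "w = p + 4 *\<^sub>R (y - p)"
      have "w - c = 4 *\<^sub>R (y - q)" by (simp add: w_def q_def algebra_simps)
      then have "dist c w = 4 * dist q y" by (simp add: dist_norm norm_minus_commute[of c] norm_minus_commute[of q])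
      then have "w \<in> cball c r" using y r0 by simp
      then have wK: "w \<in> K" using cr(3) by blast
      have yw: "y = (3/4) *\<^sub>R p + (1/4) *\<^sub>R w" by (simp add: w_def algebra_simps) (simp flip: scaleR_left_distrib)
      have yK: "y \<in> K" unfolding yw using convexD[OF D(1) K(2) wK] by simp
      \<comment> \<open>By maximality of \<open>\<bar>v p\<bar>\<close> the second term can take
        away at most a quarter of it, which leaves one half.\<close>
      have "v y = (3/4) * v p + (1/4) * v w"
        unfolding ab[OF yK] ab[OF K(2)] ab[OF wK] by (simp add: yw inner_add_right field_simps)
      moreover have "\<bar>v w\<bar> \<le> \<bar>v p\<bar>" using p(2) wK D(2) by blast
      ultimately show ?thesis using yK by linarith
    qed
    \<comment> \<open>The cells fill the closure, whereas the integrals run over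
      \<open>\<Omega>\<close>; an open convex set is the interior of its closure.\<close>
    have "ball q r0 \<subseteq> closure \<Omega>" using B D(2) by blast
    then have "ball q r0 \<subseteq> interior (closure \<Omega>)" by (rule interior_maximal) simp
    then have sub: "ball q r0 \<subseteq> \<Omega>"
      using convex_interior_closure[OF convex_domain] open_domain by (simp add: interior_open)
    have "(v p)\<^sup>2 / 4 * m0 = (LINT y|lebesgue_on \<Omega>. (v p)\<^sup>2 / 4 * indicator (ball q r0) y)"
    proof -
      have "measure (lebesgue_on \<Omega>) (ball q r0) = measure lebesgue (ball q r0)"
        using sub by (intro measure_restrict_space) auto
      moreover have "measure lebesgue (ball q r0) = m0"
        using r0 by (simp add: m0_def content_ball)
      ultimately show ?thesis using sub by (simp add: Int_absorb2)
    qed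
    also have "\<dots> \<le> L2_sq \<Omega> v"
    proof (rule integral_mono)
      interpret finite_measure "lebesgue_on \<Omega>" by (rule finite_measure_lebesgue_on[OF lmeasurable_domain])
      show "integrable (lebesgue_on \<Omega>) (\<lambda>y. (v p)\<^sup>2 / 4 * indicator (ball q r0) y)"
        using sub by (intro integrable_mult_right integrable_real_indicator)
          (auto simp: sets_restrict_space_iff emeasure_finite less_top[symmetric])
      show "integrable (lebesgue_on \<Omega>) (\<lambda>x. (norm (v x))\<^sup>2)" by (rule L2_D(2)[OF H10_D(2)[OF V(1)]])
      fix y
      show "(v p)\<^sup>2 / 4 * indicator (ball q r0) y \<le> (norm (v y))\<^sup>2"
        using B[of y] power_mono[of "\<bar>v p\<bar> / 2" "\<bar>v y\<bar>" 2]
        by (cases "y \<in> ball q r0") (auto simp: power_divide)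
    qed
    also have "\<dots> \<le> CP * energy v v" by (rule CP(2)[OF V(1)])
    finally have "(v p)\<^sup>2 \<le> 4 / m0 * CP * energy v v" using m0 by (simp add: field_simps)
    moreover have "(v x)\<^sup>2 \<le> (v p)\<^sup>2" using p(2) x by (simp add: abs_le_square_iff)
    ultimately show "(v x)\<^sup>2 \<le> 4 / m0 * CP * energy v v" by simp
  qed
qed

lemma L2_sq_le_bound:
  assumes "f \<in> borel_measurable (lebesgue_on \<Omega>)" "\<And>x. x \<in> \<Omega> \<Longrightarrow> norm (f x) \<le> e"
  shows "L2_sq \<Omega> f \<le> e\<^sup>2 * measure lebesgue \<Omega>"
proof -
  interpret finite_measure "lebesgue_on \<Omega>" by (rule finite_measure_lebesgue_on[OF lmeasurable_domain])
  have "L2_sq \<Omega> f \<le> (LINT x|lebesgue_on \<Omega>. e\<^sup>2)"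
  proof (rule integral_mono)
    show "integrable (lebesgue_on \<Omega>) (\<lambda>x. (norm (f x))\<^sup>2)"
      by (rule L2_D(2)[OF L2_bounded[OF lmeasurable_domain assms(1), of e]]) (use assms(2) in auto)
    show "(norm (f x))\<^sup>2 \<le> e\<^sup>2" if "x \<in> space (lebesgue_on \<Omega>)" for x
      using assms(2)[of x] that by (intro power_mono) auto
  qed simp
  then show ?thesis by (simp add: measure_restrict_space mult.commute)
qed

text \<open>An affine function is recovered from its values at \<open>c\<close> and at the points
  \<open>c + r *\<^sub>R e\<close> by the interpolation formula \<open>s\<close>, and this formula
  passes to pointwise limits.\<close>

lemma affine_limit:
  fixes K :: "'a set"
  assumes K: "cball c r \<subseteq> K" "0 < r" and v: "\<And>n::nat. \<exists>a b. \<forall>x\<in>K. v n x = a \<bullet> x + b"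
    and lim: "\<And>x. x \<in> K \<Longrightarrow> (\<lambda>n. v n x) \<longlonglongrightarrow> l x"
  shows "\<exists>a b. \<forall>x\<in>K. l x = a \<bullet> x + b"
proof -
  have inK: "c \<in> K" "\<And>e. e \<in> Basis \<Longrightarrow> c + r *\<^sub>R e \<in> K" using K by (auto simp: subset_iff dist_norm)
  define s where "s = (\<lambda>f (x::'a). (\<Sum>e\<in>Basis. (f (c + r *\<^sub>R e) - f c) / r * ((x - c) \<bullet> e)) + f c)"
  have vs: "v n x = s (v n) x" if x: "x \<in> K" for n x
  proof -
    obtain a b where ab: "\<And>x. x \<in> K \<Longrightarrow> v n x = a \<bullet> x + b" using v by blast
    have "s (v n) x = (\<Sum>e\<in>Basis. (a \<bullet> e) * ((x - c) \<bullet> e)) + (a \<bullet> c + b)"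
      unfolding s_def using inK K(2) by (simp add: ab inner_add_right)
    also have "\<dots> = a \<bullet> (x - c) + (a \<bullet> c + b)" by (subst euclidean_inner[of a]) simp
    also have "\<dots> = v n x" using x by (simp add: ab inner_diff_right)
    finally show ?thesis by simp
  qed
  have "l x = s l x" if x: "x \<in> K" for x
  proof -
    have "(\<lambda>n. s (v n) x) \<longlonglongrightarrow> s l x"
      unfolding s_def using K(2) by (intro tendsto_intros lim inK) auto
    then show ?thesis using lim[OF x] unfolding vs[OF x] by (rule LIMSEQ_unique[rotated])
  qed
  moreover define a where "a = (\<Sum>e\<in>Basis. ((l (c + r *\<^sub>R e) - l c) / r) *\<^sub>R e)"
  have "s l x = a \<bullet> x + (l c - a \<bullet> c)" for x
  proof -
    have "a \<bullet> y = (\<Sum>e\<in>Basis. (l (c + r *\<^sub>R e) - l c) / r * (y \<bullet> e))" for y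
      unfolding a_def inner_sum_left by (simp add: inner_commute[of _ y])
    then have "s l x = a \<bullet> (x - c) + l c" by (simp add: s_def)
    then show ?thesis by (simp add: inner_diff_right)
  qed
  ultimately show ?thesis by auto
qed

text \<open>The inverse estimate upgrades energy Cauchy sequences to uniformly Cauchy ones. Their
  uniform limit is continuous, vanishes on the frontier and is affine on the cells, and it agrees
  almost everywhere with the energy limit in \<open>H10\<close>.\<close>

lemma energy_complete_Vh:
  assumes m: "simplicial_mesh \<Omega> \<T>" and sr: "shape_regular \<sigma> \<T>" and qu: "quasi_uniform \<kappa> \<T>"
  shows "energy_complete (Vh \<Omega> \<T>)"
proof -
  have h: "0 < mesh_size \<T>" by (rule mesh_size_pos[OF m nonempty_domain bounded_domain])
  obtain C where C: "0 < C" "\<And>v x. v \<in> Vh \<Omega> \<T> \<Longrightarrow> x \<in> closure \<Omega> \<Longrightarrow> (v x)\<^sup>2 \<le> C * energy v v"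
    using inverse_estimate[OF h, of \<sigma> \<kappa>] m sr qu by (metis order_refl)
  have "\<exists>l\<in>Vh \<Omega> \<T>. (\<lambda>n. energy (\<lambda>x. v n x - l x) (\<lambda>x. v n x - l x)) \<longlonglongrightarrow> 0"
    if v: "\<And>n. v n \<in> Vh \<Omega> \<T>"
      and Cau: "\<And>e. e > 0 \<Longrightarrow> \<exists>N. \<forall>m\<ge>N. \<forall>n\<ge>N. energy (\<lambda>x. v m x - v n x) (\<lambda>x. v m x - v n x) < e"
    for v :: "nat \<Rightarrow> 'a \<Rightarrow> real"
  proof -
    note V = Vh_D[OF v]
    have vd: "(\<lambda>x. v m x - v n x) \<in> Vh \<Omega> \<T>" for m n using Vh_lincomb[OF v v, of m "-1" n] by simp
    obtain u where u: "u \<in> H10 \<Omega>" "(\<lambda>n. energy (\<lambda>x. v n x - u x) (\<lambda>x. v n x - u x)) \<longlonglongrightarrow> 0"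
      "(\<lambda>n. L2_sq \<Omega> (\<lambda>x. v n x - u x)) \<longlonglongrightarrow> 0"
      by (rule H10_complete[of v, OF V(1) Cau]) auto
    have "uniformly_Cauchy_on (closure \<Omega>) v"
    proof (rule uniformly_Cauchy_onI)
      fix e :: real assume e: "e > 0"
      then obtain N where N: "\<And>m n. m \<ge> N \<Longrightarrow> n \<ge> N \<Longrightarrow> energy (\<lambda>x. v m x - v n x) (\<lambda>x. v m x - v n x) < e\<^sup>2 / C"
        using Cau[of "e\<^sup>2 / C"] C(1) by auto
      have "dist (v m x) (v n x) < e" if "x \<in> closure \<Omega>" "m \<ge> N" "n \<ge> N" for x m n
      proof -
        have "(v m x - v n x)\<^sup>2 \<le> C * energy (\<lambda>x. v m x - v n x) (\<lambda>x. v m x - v n x)"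
          by (rule C(2)[OF vd that(1)])
        also have "\<dots> < e\<^sup>2" using N[OF that(2,3)] C(1) by (simp add: field_simps)
        finally have "\<bar>v m x - v n x\<bar>\<^sup>2 < e\<^sup>2" by simp
        then show ?thesis using e unfolding dist_real_def by (intro power2_less_imp_less[of _ e]) simp_all
      qed
      then show "\<exists>M. \<forall>x\<in>closure \<Omega>. \<forall>m\<ge>M. \<forall>n\<ge>M. dist (v m x) (v n x) < e" by blast
    qed
    then obtain l where l: "uniform_limit (closure \<Omega>) v l sequentially"
      using Cauchy_uniformly_convergent unfolding uniformly_convergent_on_def by blast
    have lp: "(\<lambda>n. v n x) \<longlonglongrightarrow> l x" if "x \<in> closure \<Omega>" for x
      by (rule tendsto_uniform_limitI[OF l that])
    have lc: "continuous_on (closure \<Omega>) l"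
      by (rule uniform_limit_theorem[OF _ l]) (use V(2) in \<open>auto simp: C0_def\<close>)
    have l0: "l x = 0" if "x \<in> frontier \<Omega>" for x
    proof -
      have "v n x = 0" for n using V(2)[of n] that by (auto simp: C0_def)
      then show ?thesis using lp[of x] that LIMSEQ_unique[OF _ tendsto_const]
        by (auto simp: frontier_def LIMSEQ_const_iff)
    qed
    have lC0: "l \<in> C0 \<Omega>" using lc l0 by (simp add: C0_def)
    have lL: "l \<in> L2 \<Omega>"
    proof -
      obtain B where "\<And>x. x \<in> closure \<Omega> \<Longrightarrow> \<bar>l x\<bar> \<le> B" by (rule C0_bounded[OF lC0 bounded_domain]) blast
      then show ?thesis
        using closure_subset by (intro L2_bounded[OF lmeasurable_domain C0_measurable[OF lC0], of B] AE_I2) auto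
    qed
    have "(\<lambda>n. L2_sq \<Omega> (\<lambda>x. v n x - l x)) \<longlonglongrightarrow> 0"
    proof (rule LIMSEQ_I)
      fix r :: real assume r: "0 < r"
      define M where "M = measure lebesgue \<Omega> + 1"
      have M: "M > 0" "measure lebesgue \<Omega> < M" unfolding M_def by (auto intro: add_nonneg_pos)
      define e where "e = sqrt (r / M)"
      have e: "e > 0" "e\<^sup>2 = r / M" using r M by (auto simp: e_def)
      obtain n0 where n0: "\<And>n x. n \<ge> n0 \<Longrightarrow> x \<in> closure \<Omega> \<Longrightarrow> dist (v n x) (l x) < e"
        using uniform_limitD[OF l e(1)] unfolding eventually_sequentially by blast
      have "L2_sq \<Omega> (\<lambda>x. v n x - l x) < r" if n: "n \<ge> n0" for n
      proof -
        have "L2_sq \<Omega> (\<lambda>x. v n x - l x) \<le> e\<^sup>2 * measure lebesgue \<Omega>"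
          using n0[OF n] closure_subset
          by (intro L2_sq_le_bound borel_measurable_diff C0_measurable V(2) lC0)
            (force simp: dist_real_def intro: less_imp_le)
        also have "\<dots> < e\<^sup>2 * M" using M e r by (intro mult_strict_left_mono) auto
        finally show ?thesis using e M by simp
      qed
      then show "\<exists>no. \<forall>n\<ge>no. norm (L2_sq \<Omega> (\<lambda>x. v n x - l x) - 0) < r"
        by (intro exI[of _ n0]) auto
    qed
    then have "(\<lambda>n. 2 * L2_sq \<Omega> (\<lambda>x. v n x - u x) + 2 * L2_sq \<Omega> (\<lambda>x. v n x - l x)) \<longlonglongrightarrow> 2 * 0 + 2 * 0"
      by (intro tendsto_intros u(3))
    moreover have "L2_sq \<Omega> (\<lambda>x. u x - l x) \<le> 2 * L2_sq \<Omega> (\<lambda>x. v n x - u x) + 2 * L2_sq \<Omega> (\<lambda>x. v n x - l x)" for n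
      using L2_sq_diff_le[OF H10_D(2)[OF u(1)] lL H10_D(2)[OF V(1)], of n] L2_sq_commute[of \<Omega> u "v n"] by simp
    ultimately have "L2_sq \<Omega> (\<lambda>x. u x - l x) \<le> 2 * 0 + 2 * 0" by (intro LIMSEQ_le_const) auto
    then have "L2_sq \<Omega> (\<lambda>x. u x - l x) = 0"
      using L2_sq_nonneg[of \<Omega> "\<lambda>x. u x - l x"] by linarith
    then have ul: "AE x in lebesgue_on \<Omega>. u x = l x" by (rule AE_eq_if_L2_sq_eq_0[OF H10_D(2)[OF u(1)] lL])
    note LH = H10_cong_AE[OF u(1) ul]
    have "\<exists>a b. \<forall>x\<in>K. l x = a \<bullet> x + b" if K: "K \<in> \<T>" for K
    proof -
      note D = simplicial_mesh_D[OF m K]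
      have bK: "bounded K" using D(2) bounded_domain bounded_subset bounded_closure by blast
      obtain c r where cr: "0 < \<kappa> * \<sigma>" "mesh_size \<T> / (4 * (\<kappa> * \<sigma>)) < r" "cball c r \<subseteq> K"
        by (rule cell_contains_ball[OF K bK sr qu h order_refl])
      have "0 < mesh_size \<T> / (4 * (\<kappa> * \<sigma>))" using h cr(1) by simp
      then have "0 < r" using cr(2) by linarith
      then show ?thesis
        by (rule affine_limit[OF cr(3), of v, OF _ V(3)[OF K]]) (use lp D(2) in blast)
    qed
    then have lV: "l \<in> Vh \<Omega> \<T>" using LH(1) lC0 by (simp add: Vh_def)
    have "energy (\<lambda>x. v n x - l x) (\<lambda>x. v n x - l x) = energy (\<lambda>x. v n x - u x) (\<lambda>x. v n x - u x)" for n
    proof -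
      have "AE x in lebesgue_on \<Omega>. weak_grad \<Omega> (v n) x - weak_grad \<Omega> l x = weak_grad \<Omega> (v n) x - weak_grad \<Omega> u x"
        using LH(2) by eventually_elim simp
      then show ?thesis
        unfolding energy_diff_diff[OF H10_D(1)[OF V(1)] H10_D(1)[OF LH(1)]] energy_diff_diff[OF H10_D(1)[OF V(1)] H10_D(1)[OF u(1)]]
        by (intro L2_sq_cong_AE L2_diff H10_D(4) V(1) LH(1) u(1))
    qed
    then have "(\<lambda>n. energy (\<lambda>x. v n x - l x) (\<lambda>x. v n x - l x)) = (\<lambda>n. energy (\<lambda>x. v n x - u x) (\<lambda>x. v n x - u x))"
      by (rule ext)
    then show ?thesis using u(2) by (intro bexI[OF _ lV]) (simp only:)
  qed
  then show ?thesis
    unfolding energy_complete_def using Vh_lincomb Vh_zero Vh_D(1) by blast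
qed

end

section \<open>Potentials and superposition operators of monotone nonlinearities\<close>

definition primitive :: "(real \<Rightarrow> real) \<Rightarrow> real \<Rightarrow> real" where
  "primitive f s = (LBINT y=0..s. f y)"

lemma primitive_has_derivative:
  assumes "continuous_on UNIV f"
  shows "(primitive f has_real_derivative f s) (at s)"
proof -
  let ?a = "- \<bar>s\<bar> - 1" and ?b = "\<bar>s\<bar> + 1"
  have "((\<lambda>u. LBINT y=ereal 0..ereal u. f y) has_vector_derivative f s) (at s within {?a..?b})"
    by (rule interval_integral_FTC2) (auto intro: continuous_on_subset[OF assms])
  moreover have "at s within {?a..?b} = at s" by (rule at_within_Icc_at) auto
  ultimately show ?thesis
    by (simp add: primitive_def[abs_def] has_real_derivative_iff_has_vector_derivative zero_ereal_def)
qed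

lemma primitive_0: "primitive f 0 = 0"
  by (simp add: primitive_def zero_ereal_def)

text \<open>The mean value theorem combined with monotonicity. The lower bound is the subgradient
  inequality of the convex potential; both bounds together control its growth.\<close>

lemma primitive_diff_bounds:
  assumes f: "continuous_on UNIV f" "mono f"
  shows "(w - v) * f v \<le> primitive f w - primitive f v" "primitive f w - primitive f v \<le> (w - v) * f w"
proof -
  have lt: "(b - a) * f a \<le> primitive f b - primitive f a \<and> primitive f b - primitive f a \<le> (b - a) * f b"
    if ab: "a < b" for a b
  proof -
    obtain z where z: "a < z" "z < b" "primitive f b - primitive f a = (b - a) * f z"
      using MVT2[OF ab primitive_has_derivative[OF f(1)]] by blast
    have "f a \<le> f z" "f z \<le> f b" using z by (auto intro!: monoD[OF f(2)])
    then show ?thesis unfolding z(3) using ab by (auto intro!: mult_left_mono)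
  qed
  show "(w - v) * f v \<le> primitive f w - primitive f v" "primitive f w - primitive f v \<le> (w - v) * f w"
    using lt[of v w] lt[of w v] by (cases v w rule: linorder_cases; simp add: algebra_simps)+
qed

text \<open>Serves the measurability of \<open>\<lambda>x. primitive (e x) (v x)\<close>, since
  Riemann sums involve only point values of the integrand. By monotonicity the left sums err by at
  most the telescoping quantity \<open>s / Suc n * (f s - f 0)\<close>.\<close>

lemma primitive_Riemann:
  assumes f: "continuous_on UNIV f" "mono f"
  shows "(\<lambda>n. \<Sum>k<Suc n. s / real (Suc n) * f (real k * s / real (Suc n))) \<longlonglongrightarrow> primitive f s"
proof -
  define S where "S = (\<lambda>n. \<Sum>k<Suc n. s / real (Suc n) * f (real k * s / real (Suc n)))"
  define a where "a = (\<lambda>n k. real k * s / real (Suc n))"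
  have step: "a n (Suc k) - a n k = s / real (Suc n)" for n k
    by (simp add: a_def add_divide_distrib distrib_right)
  have tel: "(\<Sum>k<Suc n. primitive f (a n (Suc k)) - primitive f (a n k)) = primitive f s" for n
    by (subst sum_lessThan_telescope) (simp add: a_def primitive_0 del: of_nat_Suc)
  have lo: "S n \<le> primitive f s" for n
    unfolding tel[of n, symmetric] S_def
    by (intro sum_mono) (use primitive_diff_bounds(1)[OF f, of "a n (Suc k)" "a n k" for k] step in \<open>simp add: a_def\<close>)
  have up: "primitive f s \<le> S n + s / real (Suc n) * (f s - f 0)" for n
  proof -
    have "primitive f s \<le> (\<Sum>k<Suc n. s / real (Suc n) * f (a n (Suc k)))"
      unfolding tel[of n, symmetric]
      by (intro sum_mono) (use primitive_diff_bounds(2)[OF f, of "a n (Suc k)" "a n k" for k] step in simp)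
    also have "\<dots> = S n + (\<Sum>k<Suc n. s / real (Suc n) * f (a n (Suc k)) - s / real (Suc n) * f (a n k))"
      by (simp add: S_def a_def sum_subtractf)
    also have "(\<Sum>k<Suc n. s / real (Suc n) * f (a n (Suc k)) - s / real (Suc n) * f (a n k)) =
        s / real (Suc n) * f s - s / real (Suc n) * f 0"
      by (subst sum_lessThan_telescope) (simp add: a_def del: of_nat_Suc)
    finally show ?thesis by (simp add: right_diff_distrib)
  qed
  have "(\<lambda>n. primitive f s - inverse (real (Suc n)) * (s * (f s - f 0))) \<longlonglongrightarrow> primitive f s - 0 * (s * (f s - f 0))"
    by (intro tendsto_intros LIMSEQ_inverse_real_of_nat)
  then have lim: "(\<lambda>n. primitive f s - s / real (Suc n) * (f s - f 0)) \<longlonglongrightarrow> primitive f s"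
    by (simp add: divide_inverse mult_ac)
  have "S \<longlonglongrightarrow> primitive f s"
  proof (rule tendsto_sandwich[OF _ _ lim tendsto_const])
    show "\<forall>\<^sub>F n in sequentially. primitive f s - s / real (Suc n) * (f s - f 0) \<le> S n"
      using up by (intro always_eventually allI) (simp only: diff_le_eq)
  qed (use lo in simp)
  then show ?thesis by (simp add: S_def)
qed

context bounded_domain
begin

text \<open>A Caratheodory condition. The single null set for all arguments \<open>s\<close> is what
  evaluation at \<open>s = v x\<close> requires.\<close>

definition bounded_monotone :: "real \<Rightarrow> ('a \<Rightarrow> real \<Rightarrow> real) \<Rightarrow> bool" where
  "bounded_monotone D e \<longleftrightarrow> (\<forall>s. (\<lambda>x. e x s) \<in> borel_measurable (lebesgue_on \<Omega>)) \<and>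
     (AE x in lebesgue_on \<Omega>. mono (e x) \<and> continuous_on UNIV (e x) \<and> (\<forall>s. \<bar>e x s\<bar> \<le> D))"

text \<open>The approximations \<open>vn\<close> take countably many values, and on each of them the
  hypothesis gives measurability; continuity of \<open>e x\<close> for almost every \<open>x\<close>
  yields the limit.\<close>

lemma superposition_measurable:
  assumes e: "bounded_monotone D e" and v: "v \<in> borel_measurable (lebesgue_on \<Omega>)"
  shows "(\<lambda>x. e x (v x)) \<in> borel_measurable (lebesgue_on \<Omega>)"
proof -
  let ?M = "lebesgue_on \<Omega>"
  define vn where "vn = (\<lambda>n x. real_of_int \<lfloor>real (Suc n) * v x\<rfloor> / real (Suc n))"
  have em: "(\<lambda>x. e x s) \<in> borel_measurable ?M" for s using e by (auto simp: bounded_monotone_def)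
  have m: "(\<lambda>x. e x (vn n x)) \<in> borel_measurable ?M" for n
    unfolding vn_def
  proof (rule measurable_compose_countable[where f="\<lambda>i x. e x (real_of_int i / real (Suc n))"])
    show "(\<lambda>x. \<lfloor>real (Suc n) * v x\<rfloor>) \<in> measurable ?M (count_space UNIV)"
      using v by measurable
  qed (rule em)
  have vn: "(\<lambda>n. vn n x) \<longlonglongrightarrow> v x" for x
  proof (rule tendsto_sandwich[OF _ _ _ tendsto_const])
    have 1: "vn n x \<le> v x" for n
      using of_int_floor_le[of "real (Suc n) * v x"] by (simp add: vn_def field_simps)
    have 2: "v x - inverse (real (Suc n)) \<le> vn n x" for n
    proof -
      have "real (Suc n) * v x - 1 \<le> real_of_int \<lfloor>real (Suc n) * v x\<rfloor>" by linarith
      then have "(real (Suc n) * v x - 1) / real (Suc n) \<le> vn n x"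
        unfolding vn_def by (intro divide_right_mono) auto
      then show ?thesis by (simp add: diff_divide_distrib inverse_eq_divide)
    qed
    show "\<forall>\<^sub>F n in sequentially. v x - inverse (real (Suc n)) \<le> vn n x" using 2 by simp
    show "\<forall>\<^sub>F n in sequentially. vn n x \<le> v x" using 1 by simp
    have "(\<lambda>n. v x - inverse (real (Suc n))) \<longlonglongrightarrow> v x - 0"
      by (intro tendsto_intros LIMSEQ_inverse_real_of_nat)
    then show "(\<lambda>n. v x - inverse (real (Suc n))) \<longlonglongrightarrow> v x" by simp
  qed
  show ?thesis
  proof (rule borel_measurable_AE_on[OF borel_measurable_lim_metric[OF m] _ sets_domain])
    show "AE x in ?M. lim (\<lambda>n. e x (vn n x)) = e x (v x)"
      using e[unfolded bounded_monotone_def, THEN conjunct2]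
    proof eventually_elim
      fix x assume "mono (e x) \<and> continuous_on UNIV (e x) \<and> (\<forall>s. \<bar>e x s\<bar> \<le> D)"
      then have "isCont (e x) (v x)" by (simp add: continuous_on_eq_continuous_at)
      from isCont_tendsto_compose[OF this vn] show "lim (\<lambda>n. e x (vn n x)) = e x (v x)" by (rule limI)
    qed
  qed
qed

lemma superposition_L2:
  assumes e: "bounded_monotone D e" and v: "v \<in> borel_measurable (lebesgue_on \<Omega>)"
  shows "(\<lambda>x. e x (v x)) \<in> L2 \<Omega>"
proof (rule L2_bounded[OF lmeasurable_domain superposition_measurable[OF e v]])
  show "AE x in lebesgue_on \<Omega>. norm (e x (v x)) \<le> D"
    using e[unfolded bounded_monotone_def, THEN conjunct2] by eventually_elim auto
qed

text \<open>\<open>N v\<close> pairs with the residual \<open>e x (v x) - f x\<close> and is a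
  subgradient at \<open>v\<close> of the convex functional \<open>\<Phi>\<close> built from the
  primitives of \<open>e x\<close>. The bound \<open>D\<close> makes all integrals finite and gives
  one constant \<open>B\<close> for all \<open>v\<close>.\<close>

lemma galerkin_solvable:
  assumes V: "energy_complete V" and e: "bounded_monotone D e" and f: "f \<in> L2 \<Omega>"
  obtains u where "galerkin_solution \<Omega> V e f u"
proof -
  let ?M = "lebesgue_on \<Omega>"
  obtain C where C: "C > 0" "\<And>v. v \<in> H10 \<Omega> \<Longrightarrow> L2_sq \<Omega> v \<le> C * energy v v" by (rule Poincare) blast
  have VH: "v \<in> H10 \<Omega>" if "v \<in> V" for v using V that unfolding energy_complete_def by blast
  have Vl: "\<And>v w c. v \<in> V \<Longrightarrow> w \<in> V \<Longrightarrow> (\<lambda>x. v x + c * w x) \<in> V"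
    using V unfolding energy_complete_def by blast
  have L: "v \<in> L2 \<Omega>" if "v \<in> V" for v by (rule H10_D(2)[OF VH[OF that]])
  have Lm: "v \<in> borel_measurable ?M" if "v \<in> V" for v by (rule L2_D(1)[OF L[OF that]])
  have eL: "(\<lambda>x. e x (v x)) \<in> L2 \<Omega>" if "v \<in> V" for v by (rule superposition_L2[OF e Lm[OF that]])
  have ae: "AE x in ?M. mono (e x) \<and> continuous_on UNIV (e x) \<and> (\<forall>s. \<bar>e x s\<bar> \<le> D)"
    using e by (simp add: bounded_monotone_def)
  define N where "N = (\<lambda>v w. L2_inner \<Omega> (\<lambda>x. e x (v x) - f x) w)"
  define P where "P = (\<lambda>v x. primitive (e x) (v x))"
  define \<Phi> where "\<Phi> = (\<lambda>v. (LINT x|?M. P v x) - L2_inner \<Omega> f v)"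
  have Pm: "P v \<in> borel_measurable ?M" if v: "v \<in> V" for v
  proof -
    define S where "S = (\<lambda>n x. \<Sum>k<Suc n. v x / real (Suc n) * e x (real k * v x / real (Suc n)))"
    have Sm: "S n \<in> borel_measurable ?M" for n
      unfolding S_def using Lm[OF v] superposition_measurable[OF e, of "\<lambda>x. real k * v x / real (Suc n)" for k]
      by (intro borel_measurable_sum borel_measurable_times borel_measurable_divide borel_measurable_const) auto
    show ?thesis
    proof (rule borel_measurable_AE_on[OF borel_measurable_lim_metric[OF Sm] _ sets_domain])
      show "AE x in ?M. lim (\<lambda>n. S n x) = P v x"
        using ae
      proof eventually_elim
        fix x assume "mono (e x) \<and> continuous_on UNIV (e x) \<and> (\<forall>s. \<bar>e x s\<bar> \<le> D)"
        then show "lim (\<lambda>n. S n x) = P v x"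
          unfolding S_def P_def by (intro limI primitive_Riemann) auto
      qed
    qed
  qed
  have Pint: "integrable ?M (P v)" if v: "v \<in> V" for v
  proof (rule Bochner_Integration.integrable_bound[OF _ Pm[OF v]])
    show "integrable ?M (\<lambda>x. D * v x)" by (intro integrable_mult_right L2_integrable L v)
    show "AE x in ?M. norm (P v x) \<le> norm (D * v x)"
      using ae
    proof eventually_elim
      fix x assume *: "mono (e x) \<and> continuous_on UNIV (e x) \<and> (\<forall>s. \<bar>e x s\<bar> \<le> D)"
      \<comment> \<open>Both bounds on the primitive between 0 and \<open>v x\<close> have this
        form, with \<open>s = 0\<close> and \<open>s = v x\<close>.\<close>
      have "\<bar>v x * e x s\<bar> \<le> \<bar>D * v x\<bar>" for s
        using * abs_ge_self[of D] by (auto simp: abs_mult mult.commute[of "\<bar>v x\<bar>"] intro!: mult_right_mono order_trans[of _ D "\<bar>D\<bar>"])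
      from this[of 0] this[of "v x"] show "norm (P v x) \<le> norm (D * v x)"
        using primitive_diff_bounds[of "e x" "v x" 0] * by (simp add: P_def primitive_0 abs_le_iff)
    qed
  qed
  have lin: "N v (\<lambda>x. w x + c * \<phi> x) = N v w + c * N v \<phi>" if "v \<in> V" "w \<in> V" "\<phi> \<in> V" for v w \<phi> c
    unfolding N_def using L2_inner_lincomb_right[OF L[OF that(2)] L[OF that(3)] L2_diff[OF eL[OF that(1)] f], of c]
    by simp
  obtain u where u: "u \<in> V" "\<And>\<phi>. \<phi> \<in> V \<Longrightarrow> energy u \<phi> + N u \<phi> = 0"
  proof (rule monotone_problem_solvable[OF V])
    show "N v (\<lambda>x. w x + c * \<phi> x) = N v w + c * N v \<phi>" if "v \<in> V" "w \<in> V" "\<phi> \<in> V" for v w \<phi> c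
      by (rule lin[OF that])
    define B where "B = (2 * (D\<^sup>2 * measure lebesgue \<Omega>) + 2 * L2_sq \<Omega> f) * C"
    show "0 \<le> B" using C(1) L2_sq_nonneg[of \<Omega> f] by (simp add: B_def)
    show "(N v w)\<^sup>2 \<le> B * energy w w" if v: "v \<in> V" and w: "w \<in> V" for v w
    proof -
      have "L2_sq \<Omega> (\<lambda>x. e x (v x)) \<le> (LINT x|?M. D\<^sup>2)"
      proof (rule integral_mono_AE[OF L2_D(2)[OF eL[OF v]]])
        interpret finite_measure ?M by (rule finite_measure_lebesgue_on[OF lmeasurable_domain])
        show "integrable ?M (\<lambda>x. D\<^sup>2)" by simp
        show "AE x in ?M. (norm (e x (v x)))\<^sup>2 \<le> D\<^sup>2"
          using ae
        proof eventually_elim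
          fix x assume "mono (e x) \<and> continuous_on UNIV (e x) \<and> (\<forall>s. \<bar>e x s\<bar> \<le> D)"
          then have "\<bar>e x (v x)\<bar> \<le> D" by blast
          from power_mono[OF this abs_ge_zero, of 2] show "(norm (e x (v x)))\<^sup>2 \<le> D\<^sup>2" by simp
        qed
      qed
      then have "L2_sq \<Omega> (\<lambda>x. e x (v x)) \<le> D\<^sup>2 * measure lebesgue \<Omega>"
        by (simp add: measure_restrict_space mult.commute)
      moreover have "L2_sq \<Omega> (\<lambda>x. - f x) = L2_sq \<Omega> f" by simp
      moreover have "(\<lambda>x. - f x) \<in> L2 \<Omega>" using L2_lincomb[OF L2_diff[OF f f] f, of "-1"] by simp
      ultimately have le: "L2_sq \<Omega> (\<lambda>x. e x (v x) - f x) \<le> 2 * (D\<^sup>2 * measure lebesgue \<Omega>) + 2 * L2_sq \<Omega> f"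
        using L2_sq_add_le[OF eL[OF v], of "\<lambda>x. - f x"] by simp
      have "(N v w)\<^sup>2 \<le> L2_sq \<Omega> (\<lambda>x. e x (v x) - f x) * L2_sq \<Omega> w"
        unfolding N_def by (rule L2_Cauchy_Schwarz[OF L2_diff[OF eL[OF v] f] L[OF w]])
      also have "\<dots> \<le> (2 * (D\<^sup>2 * measure lebesgue \<Omega>) + 2 * L2_sq \<Omega> f) * (C * energy w w)"
        using le C(2)[OF VH[OF w]] L2_sq_nonneg[of \<Omega> f]
        by (intro mult_mono) auto
      finally show ?thesis by (simp add: B_def)
    qed
    show "\<Phi> v + N v (\<lambda>x. w x + (-1) * v x) \<le> \<Phi> w" if v: "v \<in> V" and w: "w \<in> V" for v w
    proof -
      have i: "integrable ?M (\<lambda>x. (w x - v x) * e x (v x))"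
        using integrable_L2_inner[OF L2_diff[OF L[OF w] L[OF v]] eL[OF v]] by simp
      have "N v (\<lambda>x. w x + (-1) * v x) = (LINT x|?M. (w x - v x) * e x (v x)) - (L2_inner \<Omega> f w - L2_inner \<Omega> f v)"
      proof -
        have "N v (\<lambda>x. w x - v x) = L2_inner \<Omega> (\<lambda>x. e x (v x)) (\<lambda>x. w x - v x) - L2_inner \<Omega> f (\<lambda>x. w x - v x)"
          unfolding N_def by (rule L2_inner_diff_left[OF eL[OF v] f L2_diff[OF L[OF w] L[OF v]]])
        also have "L2_inner \<Omega> f (\<lambda>x. w x - v x) = L2_inner \<Omega> f w - L2_inner \<Omega> f v"
          by (rule L2_inner_diff_right[OF L[OF w] L[OF v] f])
        finally show ?thesis by (simp add: L2_inner_def mult.commute)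
      qed
      moreover have "(LINT x|?M. P v x) + (LINT x|?M. (w x - v x) * e x (v x)) \<le> (LINT x|?M. P w x)"
      proof -
        have "(LINT x|?M. P v x) + (LINT x|?M. (w x - v x) * e x (v x)) = (LINT x|?M. P v x + (w x - v x) * e x (v x))"
          by (rule Bochner_Integration.integral_add[OF Pint[OF v] i, symmetric])
        also have "\<dots> \<le> (LINT x|?M. P w x)"
        proof (rule integral_mono_AE[OF Bochner_Integration.integrable_add[OF Pint[OF v] i] Pint[OF w]])
          show "AE x in ?M. P v x + (w x - v x) * e x (v x) \<le> P w x"
            using ae
          proof eventually_elim
            fix x assume "mono (e x) \<and> continuous_on UNIV (e x) \<and> (\<forall>s. \<bar>e x s\<bar> \<le> D)"
            then show "P v x + (w x - v x) * e x (v x) \<le> P w x"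
              using primitive_diff_bounds(1)[of "e x" "w x" "v x"] by (simp add: P_def)
          qed
        qed
        finally show ?thesis .
      qed
      ultimately show ?thesis by (simp add: \<Phi>_def)
    qed
    show "(\<lambda>n. N (\<lambda>x. v x + inverse (real (Suc n)) * \<phi> x) \<phi>) \<longlonglongrightarrow> N v \<phi>" if v: "v \<in> V" and \<phi>: "\<phi> \<in> V" for v \<phi>
    proof -
      have N_eq: "N w \<phi> = (LINT x|?M. e x (w x) * \<phi> x) - L2_inner \<Omega> f \<phi>" if w: "w \<in> V" for w
        unfolding N_def L2_inner_diff_left[OF eL[OF w] f L[OF \<phi>]] by (simp add: L2_inner_def)
      have wV: "(\<lambda>x. v x + inverse (real (Suc n)) * \<phi> x) \<in> V" for n by (rule Vl[OF v \<phi>])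
      have "(\<lambda>n. LINT x|?M. e x (v x + inverse (real (Suc n)) * \<phi> x) * \<phi> x) \<longlonglongrightarrow> (LINT x|?M. e x (v x) * \<phi> x)"
      proof (rule integral_dominated_convergence)
        show "(\<lambda>x. e x (v x) * \<phi> x) \<in> borel_measurable ?M"
          by (intro borel_measurable_times L2_D(1)[OF eL[OF v]] Lm \<phi>)
        show "(\<lambda>x. e x (v x + inverse (real (Suc n)) * \<phi> x) * \<phi> x) \<in> borel_measurable ?M" for n
          by (intro borel_measurable_times L2_D(1)[OF eL[OF wV]] Lm \<phi>)
        show "integrable ?M (\<lambda>x. D * norm (\<phi> x))"
          by (intro integrable_mult_right integrable_norm L2_integrable L \<phi>)
        show "AE x in ?M. (\<lambda>n. e x (v x + inverse (real (Suc n)) * \<phi> x) * \<phi> x) \<longlonglongrightarrow> e x (v x) * \<phi> x"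
          using ae
        proof eventually_elim
          fix x assume "mono (e x) \<and> continuous_on UNIV (e x) \<and> (\<forall>s. \<bar>e x s\<bar> \<le> D)"
          then have "isCont (e x) (v x)" by (simp add: continuous_on_eq_continuous_at)
          moreover have "(\<lambda>n. v x + inverse (real (Suc n)) * \<phi> x) \<longlonglongrightarrow> v x + 0 * \<phi> x"
            by (intro tendsto_intros LIMSEQ_inverse_real_of_nat)
          then have "(\<lambda>n. v x + inverse (real (Suc n)) * \<phi> x) \<longlonglongrightarrow> v x" by simp
          ultimately show "(\<lambda>n. e x (v x + inverse (real (Suc n)) * \<phi> x) * \<phi> x) \<longlonglongrightarrow> e x (v x) * \<phi> x"
            by (intro tendsto_mult tendsto_const isCont_tendsto_compose[of "v x" "e x"])
        qed
        show "AE x in ?M. norm (e x (v x + inverse (real (Suc n)) * \<phi> x) * \<phi> x) \<le> D * norm (\<phi> x)" for n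
          using ae by eventually_elim (auto simp: abs_mult intro!: mult_right_mono)
      qed
      from tendsto_diff[OF this tendsto_const[of "L2_inner \<Omega> f \<phi>"]]
      show ?thesis unfolding N_eq[OF v] N_eq[OF wV] .
    qed
  qed (rule that)
  have "energy u \<phi> + L2_inner \<Omega> (\<lambda>x. e x (u x)) \<phi> = L2_inner \<Omega> f \<phi>" if "\<phi> \<in> V" for \<phi>
    using u(2)[OF that] L2_inner_diff_left[OF eL[OF u(1)] f L[OF that]] by (simp add: N_def)
  then show ?thesis using u(1) by (intro that[of u]) (auto simp: galerkin_solution_def)
qed

end

section \<open>Essential bounds and truncation of the nonlinearity\<close>

lemma Linf_norm_leI:
  assumes "f \<in> borel_measurable (lebesgue_on \<Omega>)" "AE x in lebesgue_on \<Omega>. \<bar>f x\<bar> \<le> B"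
  shows "Linf_norm \<Omega> f \<le> ereal B"
  unfolding Linf_norm_def using assms by (intro esssup_I) auto

lemma Linf_norm_leD:
  assumes "Linf_norm \<Omega> f \<le> ereal B"
  shows "AE x in lebesgue_on \<Omega>. \<bar>f x\<bar> \<le> B"
  using esssup_AE[of "\<lambda>x. ereal \<bar>f x\<bar>" "lebesgue_on \<Omega>"]
proof eventually_elim
  fix x assume "ereal \<bar>f x\<bar> \<le> esssup (lebesgue_on \<Omega>) (\<lambda>x. ereal \<bar>f x\<bar>)"
  also have "\<dots> \<le> ereal B" using assms by (simp add: Linf_norm_def)
  finally show "\<bar>f x\<bar> \<le> B" by simp
qed

lemma Linf_bounded:
  assumes "f \<in> Linf \<Omega>"
  obtains B where "0 \<le> B" "AE x in lebesgue_on \<Omega>. \<bar>f x\<bar> \<le> B"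
proof -
  have "Linf_norm \<Omega> f < \<infinity>" using assms by (simp add: Linf_def)
  then obtain r where "Linf_norm \<Omega> f \<le> ereal r" by (cases "Linf_norm \<Omega> f") auto
  then have "AE x in lebesgue_on \<Omega>. \<bar>f x\<bar> \<le> r" by (rule Linf_norm_leD)
  then have "AE x in lebesgue_on \<Omega>. \<bar>f x\<bar> \<le> max r 0" by eventually_elim simp
  then show ?thesis by (rule that[rotated]) simp
qed

text \<open>Clamping the argument rather than the value preserves monotonicity, confines the values
  between \<open>d x (- M)\<close> and \<open>d x M\<close>, and changes nothing at arguments of
  modulus at most \<open>M\<close>.\<close>

definition truncation :: "real \<Rightarrow> ('a \<Rightarrow> real \<Rightarrow> real) \<Rightarrow> 'a \<Rightarrow> real \<Rightarrow> real" where
  "truncation M d x s = d x (max (- M) (min s M))"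

lemma truncation_eq: "\<bar>s\<bar> \<le> M \<Longrightarrow> truncation M d x s = d x s"
  by (simp add: truncation_def abs_le_iff min_absorb1 max_absorb2)

text \<open>In (A3) the exceptional null set may vary with the argument. Compactness leaves finitely
  many centres \<open>c\<close>, (A3) is used only at \<open>c + \<delta> c / 2\<close> and
  \<open>c - \<delta> c / 2\<close>, and monotonicity controls all arguments in between, so that
  finitely many null sets remain.\<close>

lemma A3_uniform:
  assumes A2: "assm_A2 \<Omega> d" and A3: "assm_A3 \<Omega> d" and M: "0 \<le> M" and \<epsilon>: "0 < \<epsilon>"
  shows "\<exists>\<delta>>0. AE x in lebesgue_on \<Omega>. \<forall>s t. \<bar>s\<bar> \<le> M \<and> \<bar>t\<bar> \<le> M \<and> \<bar>s - t\<bar> < \<delta> \<longrightarrow> \<bar>d x s - d x t\<bar> \<le> \<epsilon>"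
proof -
  have "\<forall>u0. \<exists>\<delta>>0. \<forall>u. \<bar>u - u0\<bar> < \<delta> \<longrightarrow> (AE x in lebesgue_on \<Omega>. \<bar>d x u - d x u0\<bar> < \<epsilon> / 2)"
    using A3 \<epsilon> unfolding assm_A3_def by (metis half_gt_zero)
  from choice[OF this] obtain \<delta> where \<delta>: "\<And>u0. 0 < \<delta> u0"
    "\<And>u0 u. \<bar>u - u0\<bar> < \<delta> u0 \<Longrightarrow> AE x in lebesgue_on \<Omega>. \<bar>d x u - d x u0\<bar> < \<epsilon> / 2" by blast
  \<comment> \<open>One quarter of \<open>\<delta> c\<close> is spent on the distance from
    \<open>s\<close> to its centre, another on the distance from \<open>s\<close> to
    \<open>t\<close>; both points then lie between the two control points.\<close>
  have "{-M..M} \<subseteq> (\<Union>c\<in>{-M..M}. ball c (\<delta> c / 4))" using \<delta>(1) by force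
  then obtain C where C: "C \<subseteq> {-M..M}" "finite C" "{-M..M} \<subseteq> (\<Union>c\<in>C. ball c (\<delta> c / 4))"
    by (rule compactE_image[OF compact_Icc, of "{-M..M}" "\<lambda>c. ball c (\<delta> c / 4)", rotated]) auto
  have C0: "C \<noteq> {}" using C(3) M by auto
  define \<delta>0 where "\<delta>0 = Min ((\<lambda>c. \<delta> c / 4) ` C)"
  have \<delta>0: "0 < \<delta>0" using C(2) C0 \<delta>(1) by (simp add: \<delta>0_def)
  have \<delta>0_le: "\<delta>0 \<le> \<delta> c / 4" if "c \<in> C" for c
    unfolding \<delta>0_def using C(2) that by (intro Min_le) auto
  have mono: "AE x in lebesgue_on \<Omega>. mono (d x)" using A2 by (simp add: assm_A2_def)
  have grid: "AE x in lebesgue_on \<Omega>. \<forall>c\<in>C. \<bar>d x (c + \<delta> c / 2) - d x c\<bar> < \<epsilon> / 2 \<and> \<bar>d x (c - \<delta> c / 2) - d x c\<bar> < \<epsilon> / 2"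
  proof (rule AE_finite_allI[OF C(2)])
    fix c
    show "AE x in lebesgue_on \<Omega>. \<bar>d x (c + \<delta> c / 2) - d x c\<bar> < \<epsilon> / 2 \<and> \<bar>d x (c - \<delta> c / 2) - d x c\<bar> < \<epsilon> / 2"
      using \<delta>(1)[of c] \<delta>(2)[of "c + \<delta> c / 2" c] \<delta>(2)[of "c - \<delta> c / 2" c] by auto
  qed
  have "AE x in lebesgue_on \<Omega>. \<forall>s t. \<bar>s\<bar> \<le> M \<and> \<bar>t\<bar> \<le> M \<and> \<bar>s - t\<bar> < \<delta>0 \<longrightarrow> \<bar>d x s - d x t\<bar> \<le> \<epsilon>"
    using mono grid
  proof eventually_elim
    fix x
    assume m: "mono (d x)" and
      g: "\<forall>c\<in>C. \<bar>d x (c + \<delta> c / 2) - d x c\<bar> < \<epsilon> / 2 \<and> \<bar>d x (c - \<delta> c / 2) - d x c\<bar> < \<epsilon> / 2"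
    show "\<forall>s t. \<bar>s\<bar> \<le> M \<and> \<bar>t\<bar> \<le> M \<and> \<bar>s - t\<bar> < \<delta>0 \<longrightarrow> \<bar>d x s - d x t\<bar> \<le> \<epsilon>"
    proof (intro allI impI, elim conjE)
      fix s t assume s: "\<bar>s\<bar> \<le> M" and "\<bar>t\<bar> \<le> M" and st: "\<bar>s - t\<bar> < \<delta>0"
      have "s \<in> {-M..M}" using s by auto
      then obtain c where c: "c \<in> C" "\<bar>c - s\<bar> < \<delta> c / 4" using C(3) by (auto simp: dist_real_def)
      have "c - \<delta> c / 2 \<le> s" "s \<le> c + \<delta> c / 2" "c - \<delta> c / 2 \<le> t" "t \<le> c + \<delta> c / 2"
        using c(2) st \<delta>0_le[OF c(1)] by linarith+
      then have "d x (c - \<delta> c / 2) \<le> d x s" "d x s \<le> d x (c + \<delta> c / 2)"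
        "d x (c - \<delta> c / 2) \<le> d x t" "d x t \<le> d x (c + \<delta> c / 2)"
        by (auto intro: monoD[OF m])
      moreover have "\<bar>d x (c + \<delta> c / 2) - d x c\<bar> < \<epsilon> / 2" "\<bar>d x (c - \<delta> c / 2) - d x c\<bar> < \<epsilon> / 2"
        using g c(1) by auto
      ultimately show "\<bar>d x s - d x t\<bar> \<le> \<epsilon>" by arith
    qed
  qed
  with \<delta>0 show ?thesis by blast
qed

context bounded_domain
begin

text \<open>(A1) at the two ends of the clamping interval bounds all values by monotonicity. For
  continuity, the uniform moduli for the tolerances \<open>inverse (Suc k)\<close> are collected on
  one null set.\<close>

lemma bounded_monotone_truncation:
  assumes A1: "assm_A1 \<Omega> d" and A2: "assm_A2 \<Omega> d" and A3: "assm_A3 \<Omega> d" and M: "0 \<le> M"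
  obtains D where "0 \<le> D" "bounded_monotone D (truncation M d)"
proof -
  have A1': "(\<lambda>x. d x s) \<in> Linf \<Omega>" for s using A1 by (simp add: assm_A1_def)
  obtain D1 where D1: "0 \<le> D1" "AE x in lebesgue_on \<Omega>. \<bar>d x M\<bar> \<le> D1" by (rule Linf_bounded[OF A1'])
  obtain D2 where D2: "0 \<le> D2" "AE x in lebesgue_on \<Omega>. \<bar>d x (- M)\<bar> \<le> D2" by (rule Linf_bounded[OF A1'])
  have mono: "AE x in lebesgue_on \<Omega>. mono (d x)" using A2 by (simp add: assm_A2_def)
  have "\<forall>k::nat. \<exists>\<delta>>0. AE x in lebesgue_on \<Omega>. \<forall>s t. \<bar>s\<bar> \<le> M \<and> \<bar>t\<bar> \<le> M \<and> \<bar>s - t\<bar> < \<delta> \<longrightarrow> \<bar>d x s - d x t\<bar> \<le> inverse (real (Suc k))"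
    by (intro allI A3_uniform[OF A2 A3 M]) simp
  from choice[OF this] obtain \<delta> where \<delta>: "\<And>k. 0 < \<delta> k"
    "\<And>k. AE x in lebesgue_on \<Omega>. \<forall>s t. \<bar>s\<bar> \<le> M \<and> \<bar>t\<bar> \<le> M \<and> \<bar>s - t\<bar> < \<delta> k \<longrightarrow> \<bar>d x s - d x t\<bar> \<le> inverse (real (Suc k))"
    by blast
  have uc: "AE x in lebesgue_on \<Omega>. \<forall>k s t. \<bar>s\<bar> \<le> M \<and> \<bar>t\<bar> \<le> M \<and> \<bar>s - t\<bar> < \<delta> k \<longrightarrow> \<bar>d x s - d x t\<bar> \<le> inverse (real (Suc k))"
    using \<delta>(2) by (simp add: AE_all_countable)
  have cl: "\<bar>max (- M) (min s M)\<bar> \<le> M" for s using M by auto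
  have "bounded_monotone (D1 + D2) (truncation M d)"
    unfolding bounded_monotone_def
  proof (intro conjI allI)
    show "(\<lambda>x. truncation M d x s) \<in> borel_measurable (lebesgue_on \<Omega>)" for s
      unfolding truncation_def using A1' by (simp add: Linf_def)
    show "AE x in lebesgue_on \<Omega>. mono (truncation M d x) \<and> continuous_on UNIV (truncation M d x) \<and>
        (\<forall>s. \<bar>truncation M d x s\<bar> \<le> D1 + D2)"
      using mono uc D1(2) D2(2)
    proof eventually_elim
      fix x
      assume m: "mono (d x)"
        and u: "\<forall>k s t. \<bar>s\<bar> \<le> M \<and> \<bar>t\<bar> \<le> M \<and> \<bar>s - t\<bar> < \<delta> k \<longrightarrow> \<bar>d x s - d x t\<bar> \<le> inverse (real (Suc k))"
        and d: "\<bar>d x M\<bar> \<le> D1" "\<bar>d x (- M)\<bar> \<le> D2"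
      have "mono (truncation M d x)"
        unfolding truncation_def by (intro monoI monoD[OF m]) auto
      moreover have "\<bar>truncation M d x s\<bar> \<le> D1 + D2" for s
      proof -
        have "d x (- M) \<le> truncation M d x s" "truncation M d x s \<le> d x M"
          unfolding truncation_def using cl[of s] by (auto intro!: monoD[OF m])
        then show ?thesis using d D1(1) D2(1) by linarith
      qed
      moreover have "continuous_on UNIV (truncation M d x)"
        unfolding continuous_on_iff
      proof (intro ballI allI impI)
        fix s e :: real assume "0 < e"
        then obtain k where k: "inverse (real (Suc k)) < e" using reals_Archimedean by blast
        have "dist (truncation M d x t) (truncation M d x s) < e" if "dist t s < \<delta> k" for t
        proof -
          have "\<bar>max (- M) (min t M) - max (- M) (min s M)\<bar> < \<delta> k"
            using that by (auto simp: dist_real_def)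
          then have "\<bar>truncation M d x t - truncation M d x s\<bar> \<le> inverse (real (Suc k))"
            unfolding truncation_def using u cl by blast
          then show ?thesis using k by (simp add: dist_real_def)
        qed
        then show "\<exists>r>0. \<forall>t\<in>UNIV. dist t s < r \<longrightarrow> dist (truncation M d x t) (truncation M d x s) < e"
          using \<delta>(1)[of k] by blast
      qed
      ultimately show "mono (truncation M d x) \<and> continuous_on UNIV (truncation M d x) \<and>
        (\<forall>s. \<bar>truncation M d x s\<bar> \<le> D1 + D2)" by blast
    qed
  qed
  with D1(1) D2(1) show ?thesis by (intro that[of "D1 + D2"]) auto
qed

section \<open>Truncated Galerkin problems: transfer, uniqueness and energy bound\<close>

lemma galerkin_solution_truncation:
  assumes "\<And>x. x \<in> \<Omega> \<Longrightarrow> \<bar>v x\<bar> \<le> M"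
  shows "galerkin_solution \<Omega> V (truncation M d) f v \<longleftrightarrow> galerkin_solution \<Omega> V d f v"
proof -
  have "L2_inner \<Omega> (\<lambda>x. truncation M d x (v x)) \<phi> = L2_inner \<Omega> (\<lambda>x. d x (v x)) \<phi>" for \<phi>
    unfolding L2_inner_def
    by (intro Bochner_Integration.integral_cong refl) (use assms in \<open>simp add: truncation_eq\<close>)
  then show ?thesis by (simp add: galerkin_solution_def)
qed

text \<open>The set where \<open>f > c\<close> is open, and a nonempty open set is not
  negligible.\<close>

lemma continuous_AE_le:
  assumes f: "continuous_on \<Omega> f" and ae: "AE x in lebesgue_on \<Omega>. f x \<le> (c::real)" and x: "x \<in> \<Omega>"
  shows "f x \<le> c"
proof (rule ccontr)
  assume "\<not> f x \<le> c"
  define U where "U = {y \<in> \<Omega>. c < f y}"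
  have "open U" unfolding U_def
    using continuous_open_preimage[OF f open_domain, of "{c<..}"] by (simp add: vimage_def Int_def)
  moreover have "U \<noteq> {}" using x \<open>\<not> f x \<le> c\<close> by (auto simp: U_def)
  ultimately have "\<not> negligible U" by (rule open_not_negligible)
  moreover have "AE y in lebesgue. y \<notin> U"
    using ae by (simp add: AE_restrict_space_iff, elim eventually_mono) (auto simp: U_def)
  then have "negligible U"
    unfolding negligible_iff_null_sets by (simp add: completion.AE_iff_null_sets)
  ultimately show False by blast
qed

text \<open>With the difference as test function in both equations, monotonicity makes its energy
  nonpositive, and the Poincare inequality turns this into equality almost everywhere.\<close>

lemma galerkin_unique:
  assumes V: "V \<subseteq> H10 \<Omega>" "\<And>v w c. v \<in> V \<Longrightarrow> w \<in> V \<Longrightarrow> (\<lambda>x. v x + c * w x) \<in> V"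
    and e: "bounded_monotone D e" and f: "f \<in> L2 \<Omega>"
    and v: "galerkin_solution \<Omega> V e f v" and w: "galerkin_solution \<Omega> V e f w"
  shows "AE x in lebesgue_on \<Omega>. v x = w x"
proof -
  obtain C where C: "C > 0" "\<And>v. v \<in> H10 \<Omega> \<Longrightarrow> L2_sq \<Omega> v \<le> C * energy v v" by (rule Poincare) blast
  have vV: "v \<in> V" and wV: "w \<in> V" using v w by (auto simp: galerkin_solution_def)
  then have vH: "v \<in> H10 \<Omega>" and wH: "w \<in> H10 \<Omega>" using V(1) by auto
  note vL = H10_D(2)[OF vH] and wL = H10_D(2)[OF wH]
  note ev = superposition_L2[OF e L2_D(1)[OF vL]] and ew = superposition_L2[OF e L2_D(1)[OF wL]]
  define z where "z = (\<lambda>x. v x + (-1) * w x)"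
  have zV: "z \<in> V" unfolding z_def by (rule V(2)[OF vV wV])
  then have zH: "z \<in> H10 \<Omega>" using V(1) by auto
  have "energy z z = energy v z - energy w z"
    using energy_lincomb_left[OF H10_D(1)[OF vH] H10_D(1)[OF wH] H10_D(1)[OF zH], of "-1"] unfolding z_def by simp
  also have "\<dots> = L2_inner \<Omega> (\<lambda>x. e x (w x)) z - L2_inner \<Omega> (\<lambda>x. e x (v x)) z"
    using v w zV unfolding galerkin_solution_def by (smt (verit))
  also have "\<dots> = L2_inner \<Omega> (\<lambda>x. e x (w x) - e x (v x)) z"
    by (rule L2_inner_diff_left[OF ew ev H10_D(2)[OF zH], symmetric])
  also have "\<dots> \<le> 0"
  proof -
    have "AE x in lebesgue_on \<Omega>. 0 \<le> - ((e x (w x) - e x (v x)) \<bullet> z x)"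
      using e[unfolded bounded_monotone_def, THEN conjunct2]
    proof eventually_elim
      fix x assume "mono (e x) \<and> continuous_on UNIV (e x) \<and> (\<forall>s. \<bar>e x s\<bar> \<le> D)"
      then have m: "mono (e x)" by blast
      show "0 \<le> - ((e x (w x) - e x (v x)) \<bullet> z x)"
        using monoD[OF m, of "v x" "w x"] monoD[OF m, of "w x" "v x"]
        by (cases "v x \<le> w x") (auto simp: z_def mult_le_0_iff)
    qed
    from integral_nonneg_AE[OF this] show ?thesis by (simp add: L2_inner_def)
  qed
  finally have "C * energy z z \<le> 0" using C(1) by (simp add: mult_le_0_iff)
  then have "L2_sq \<Omega> z \<le> 0" using C(2)[OF zH] by linarith
  then have "L2_sq \<Omega> z = 0" using L2_sq_nonneg by (rule order_antisym)
  moreover have "z = (\<lambda>x. v x - w x)" by (simp add: z_def)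
  ultimately have "L2_sq \<Omega> (\<lambda>x. v x - w x) = 0" by simp
  then show ?thesis by (rule AE_eq_if_L2_sq_eq_0[OF vL wL])
qed

text \<open>With \<open>v\<close> itself as test function, monotonicity discards the increment
  \<open>e x (v x) - e x 0\<close>. Only \<open>e x 0\<close> is left, so the bound is common to all
  truncation levels.\<close>

lemma galerkin_energy_le:
  assumes e: "bounded_monotone D e" and f: "f \<in> L2 \<Omega>"
    and C: "0 \<le> C" "\<And>v. v \<in> H10 \<Omega> \<Longrightarrow> L2_sq \<Omega> v \<le> C * energy v v"
    and V: "V \<subseteq> H10 \<Omega>" and v: "galerkin_solution \<Omega> V e f v"
  shows "energy v v \<le> C * L2_sq \<Omega> (\<lambda>x. f x - e x 0)"
proof -
  have vV: "v \<in> V" using v by (auto simp: galerkin_solution_def)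
  then have vH: "v \<in> H10 \<Omega>" using V by auto
  note vL = H10_D(2)[OF vH]
  note ev = superposition_L2[OF e L2_D(1)[OF vL]] and e0 = superposition_L2[OF e borel_measurable_const[of 0]]
  let ?g = "\<lambda>x. f x - e x 0"
  have "energy v v = L2_inner \<Omega> f v - L2_inner \<Omega> (\<lambda>x. e x (v x)) v"
    using v vV unfolding galerkin_solution_def by (smt (verit))
  also have "\<dots> = L2_inner \<Omega> ?g v - L2_inner \<Omega> (\<lambda>x. e x (v x) - e x 0) v"
    by (simp add: L2_inner_diff_left[OF f e0 vL] L2_inner_diff_left[OF ev e0 vL])
  also have "\<dots> \<le> L2_inner \<Omega> ?g v"
  proof -
    have "AE x in lebesgue_on \<Omega>. 0 \<le> (e x (v x) - e x 0) \<bullet> v x"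
      using e[unfolded bounded_monotone_def, THEN conjunct2]
    proof eventually_elim
      fix x assume "mono (e x) \<and> continuous_on UNIV (e x) \<and> (\<forall>s. \<bar>e x s\<bar> \<le> D)"
      then have m: "mono (e x)" by blast
      show "0 \<le> (e x (v x) - e x 0) \<bullet> v x"
        using monoD[OF m, of "v x" 0] monoD[OF m, of 0 "v x"]
        by (cases "v x \<le> 0") (auto simp: zero_le_mult_iff)
    qed
    from integral_nonneg_AE[OF this] show ?thesis by (simp add: L2_inner_def)
  qed
  finally have 1: "energy v v \<le> L2_inner \<Omega> ?g v" .
  have "(energy v v)\<^sup>2 \<le> (L2_inner \<Omega> ?g v)\<^sup>2"
    by (rule power_mono[OF 1 energy_nonneg])
  also have "\<dots> \<le> L2_sq \<Omega> ?g * L2_sq \<Omega> v" by (rule L2_Cauchy_Schwarz[OF L2_diff[OF f e0] vL])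
  also have "\<dots> \<le> L2_sq \<Omega> ?g * (C * energy v v)" by (rule mult_left_mono[OF C(2)[OF vH] L2_sq_nonneg])
  finally have "energy v v * energy v v \<le> (C * L2_sq \<Omega> ?g) * energy v v"
    by (simp only: power2_eq_square mult_ac)
  moreover have "0 \<le> C * L2_sq \<Omega> ?g" using C(1) L2_sq_nonneg[of \<Omega> ?g] by (rule mult_nonneg_nonneg)
  ultimately show ?thesis
    using energy_nonneg[of v] unfolding mult_le_cancel_right by linarith
qed

end

section \<open>The error estimate\<close>

context convex_domain
begin

text \<open>The maximum principle is applied with source bound 0 and the companions
  \<open>v - u\<close> and \<open>u - v\<close>, since \<open>z\<close> is close to \<open>v\<close>
  only almost everywhere. The factor 2 adds the distances from \<open>z\<close> to \<open>u\<close>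
  and from \<open>z\<close> to \<open>v\<close>.\<close>

lemma galerkin_error:
  assumes ritz: "\<And>z w r. z \<in> H10 \<Omega> \<Longrightarrow> w \<in> Linf \<Omega> \<Longrightarrow> has_weak_laplacian \<Omega> z w \<Longrightarrow>
      is_ritz_projection \<Omega> \<T> z r \<Longrightarrow> Linf_norm \<Omega> (\<lambda>x. z x - r x) \<le> ereal k * Linf_norm \<Omega> w"
    and k: "0 \<le> k" and e: "bounded_monotone D e"
    and f: "f \<in> borel_measurable (lebesgue_on \<Omega>)" "AE x in lebesgue_on \<Omega>. \<bar>f x\<bar> \<le> F"
    and FD: "0 \<le> F" "0 \<le> D"
    and u: "u \<in> C0 \<Omega>" "galerkin_solution \<Omega> (H10 \<Omega>) e f u"
    and v: "galerkin_solution \<Omega> (Vh \<Omega> \<T>) e f v"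
  shows "AE x in lebesgue_on \<Omega>. \<bar>u x - v x\<bar> \<le> 2 * (k * (F + D))"
proof -
  have ae: "AE x in lebesgue_on \<Omega>. mono (e x) \<and> continuous_on UNIV (e x) \<and> (\<forall>s. \<bar>e x s\<bar> \<le> D)"
    using e by (simp add: bounded_monotone_def)
  have uH: "u \<in> H10 \<Omega>" using u(2) by (simp add: galerkin_solution_def)
  have vV: "v \<in> Vh \<Omega> \<T>" using v by (simp add: galerkin_solution_def)
  note vH = Vh_D(1)[OF vV] and vC = Vh_D(2)[OF vV]
  have fL: "f \<in> L2 \<Omega>" by (rule L2_bounded[OF lmeasurable_domain f(1), of F]) (use f(2) in simp)
  note euL = superposition_L2[OF e L2_D(1)[OF H10_D(2)[OF uH]]]
    and evL = superposition_L2[OF e L2_D(1)[OF H10_D(2)[OF vH]]]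
  obtain z where z: "z \<in> H10 \<Omega>" "\<And>\<phi>. \<phi> \<in> H10 \<Omega> \<Longrightarrow> energy z \<phi> = L2_inner \<Omega> (\<lambda>x. f x - e x (v x)) \<phi>"
    by (rule Poisson_solvable[OF L2_diff[OF fL evL]]) blast
  note zH1 = H10_D(1)[OF z(1)] and uH1 = H10_D(1)[OF uH] and vH1 = H10_D(1)[OF vH]
  \<comment> \<open>The Ritz estimate is phrased with the Laplacian and not its negative, hence the
    reversed sign of the residual.\<close>
  let ?w = "\<lambda>x. e x (v x) - f x"
  have wm: "?w \<in> borel_measurable (lebesgue_on \<Omega>)" by (rule L2_D(1)[OF L2_diff[OF evL fL]])
  have wn: "Linf_norm \<Omega> ?w \<le> ereal (F + D)"
  proof (rule Linf_norm_leI[OF wm])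
    show "AE x in lebesgue_on \<Omega>. \<bar>?w x\<bar> \<le> F + D"
      using ae f(2) by eventually_elim (smt (verit))
  qed
  then have w: "?w \<in> Linf \<Omega>" using wm by (auto simp: Linf_def intro: le_less_trans)
  have neg: "L2_inner \<Omega> ?w \<phi> = - L2_inner \<Omega> (\<lambda>x. f x - e x (v x)) \<phi>" for \<phi>
    unfolding L2_inner_def by (simp add: algebra_simps flip: Bochner_Integration.integral_minus)
  have lap: "has_weak_laplacian \<Omega> z ?w"
    unfolding has_weak_laplacian_def
  proof (intro conjI ballI)
    show "locally_integrable \<Omega> ?w"
      by (rule L2_locally_integrable[OF L2_diff[OF evL fL]])
    fix \<phi> assume \<phi>: "\<phi> \<in> test_functions \<Omega>"
    show "L2_inner \<Omega> ?w \<phi> = - L2_inner \<Omega> (weak_grad \<Omega> z) (grad \<phi>)"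
      unfolding neg energy_test_eq[OF zH1 \<phi>, symmetric] z(2)[OF test_H10[OF \<phi>]] ..
  qed
  have rp: "is_ritz_projection \<Omega> \<T> z v"
    unfolding is_ritz_projection_def
  proof (intro conjI ballI vV)
    fix \<phi> assume \<phi>: "\<phi> \<in> Vh \<Omega> \<T>"
    note \<phi>H = Vh_D(1)[OF \<phi>]
    have "energy (\<lambda>x. z x - v x) \<phi> = energy z \<phi> - energy v \<phi>"
      using energy_lincomb_left[OF zH1 vH1 H10_D(1)[OF \<phi>H], of "-1"] by simp
    also have "energy z \<phi> = L2_inner \<Omega> f \<phi> - L2_inner \<Omega> (\<lambda>x. e x (v x)) \<phi>"
      unfolding z(2)[OF \<phi>H] by (rule L2_inner_diff_left[OF fL evL H10_D(2)[OF \<phi>H]])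
    also have "\<dots> = energy v \<phi>" using v \<phi> unfolding galerkin_solution_def by (smt (verit))
    finally show "energy (\<lambda>x. z x - v x) \<phi> = 0" by simp
  qed
  define \<epsilon> where "\<epsilon> = k * (F + D)"
  have \<epsilon>: "0 \<le> \<epsilon>" using k FD by (simp add: \<epsilon>_def)
  have "Linf_norm \<Omega> (\<lambda>x. z x - v x) \<le> ereal k * Linf_norm \<Omega> ?w" by (rule ritz[OF z(1) w lap rp])
  also have "\<dots> \<le> ereal k * ereal (F + D)" by (rule ereal_mult_left_mono[OF wn]) (use k in simp)
  finally have zv: "AE x in lebesgue_on \<Omega>. \<bar>z x - v x\<bar> \<le> \<epsilon>"
    unfolding \<epsilon>_def by (intro Linf_norm_leD) simp
  obtain R where R: "\<And>x. x \<in> \<Omega> \<Longrightarrow> norm x \<le> R" using bounded_domain unfolding bounded_iff by blast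
  have C0d: "continuous_on (closure \<Omega>) (\<lambda>x. p x - q x)" "\<And>x. x \<in> frontier \<Omega> \<Longrightarrow> p x - q x \<le> 0"
    if "p \<in> C0 \<Omega>" "q \<in> C0 \<Omega>" for p q
    using that by (auto simp: C0_def intro!: continuous_intros)
  have li: "locally_integrable \<Omega> (\<lambda>x. p x - q x)" if "p \<in> L2 \<Omega>" "q \<in> L2 \<Omega>" for p q :: "'a \<Rightarrow> real"
    by (rule L2_locally_integrable[OF L2_diff[OF that]])
  have en: "energy (\<lambda>x. z x - u x) \<phi> = (LINT y|lebesgue_on \<Omega>. \<phi> y * (e y (u y) - e y (v y)))"
    if \<phi>: "\<phi> \<in> test_functions \<Omega>" for \<phi>
  proof -
    note \<phi>H = test_H10[OF \<phi>]
    have "energy (\<lambda>x. z x - u x) \<phi> = energy z \<phi> - energy u \<phi>"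
      using energy_lincomb_left[OF zH1 uH1 H10_D(1)[OF \<phi>H], of "-1"] by simp
    also have "energy z \<phi> = L2_inner \<Omega> f \<phi> - L2_inner \<Omega> (\<lambda>x. e x (v x)) \<phi>"
      unfolding z(2)[OF \<phi>H] by (rule L2_inner_diff_left[OF fL evL H10_D(2)[OF \<phi>H]])
    also have "energy u \<phi> = L2_inner \<Omega> f \<phi> - L2_inner \<Omega> (\<lambda>x. e x (u x)) \<phi>"
      using u(2) \<phi>H unfolding galerkin_solution_def by (smt (verit))
    also have "(L2_inner \<Omega> f \<phi> - L2_inner \<Omega> (\<lambda>x. e x (v x)) \<phi>) - (L2_inner \<Omega> f \<phi> - L2_inner \<Omega> (\<lambda>x. e x (u x)) \<phi>)
       = L2_inner \<Omega> (\<lambda>x. e x (u x) - e x (v x)) \<phi>"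
      using L2_inner_diff_left[OF euL evL H10_D(2)[OF \<phi>H]] by simp
    finally show ?thesis by (simp add: L2_inner_def mult.commute)
  qed
  have upper: "AE x in lebesgue_on \<Omega>. z x - u x \<le> \<epsilon> + 0 / 2 * R\<^sup>2"
  proof (rule weak_max_principle[OF _ li[OF euL evL] en C0d[OF vC u(1)]])
    show "(\<lambda>x. z x - u x) \<in> H1 \<Omega>" using H1_lincomb(1)[OF zH1 uH1, of "-1"] by simp
    show "AE x in lebesgue_on \<Omega>. z x - u x \<le> v x - u x + \<epsilon>" using zv by eventually_elim linarith
    show "AE x in lebesgue_on \<Omega>. 0 < v x - u x \<longrightarrow> e x (u x) - e x (v x) \<le> 0"
      using ae by eventually_elim (auto intro: monoD)
  qed (use \<epsilon> R in auto)
  have "AE x in lebesgue_on \<Omega>. u x - z x \<le> \<epsilon> + 0 / 2 * R\<^sup>2"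
  proof (rule weak_max_principle[OF _ li[OF evL euL] _ C0d[OF u(1) vC]])
    show "(\<lambda>x. u x - z x) \<in> H1 \<Omega>" using H1_lincomb(1)[OF uH1 zH1, of "-1"] by simp
    fix \<phi> assume \<phi>: "\<phi> \<in> test_functions \<Omega>"
    note \<phi>1 = test_H1[OF \<phi>]
    have "energy (\<lambda>x. u x - z x) \<phi> = - energy (\<lambda>x. z x - u x) \<phi>"
      using energy_lincomb_left[OF uH1 zH1 \<phi>1, of "-1"] energy_lincomb_left[OF zH1 uH1 \<phi>1, of "-1"] by simp
    also have "\<dots> = (LINT y|lebesgue_on \<Omega>. \<phi> y * (e y (v y) - e y (u y)))"
      unfolding en[OF \<phi>] by (simp add: algebra_simps flip: Bochner_Integration.integral_minus)
    finally show "energy (\<lambda>x. u x - z x) \<phi> = (LINT y|lebesgue_on \<Omega>. \<phi> y * (e y (v y) - e y (u y)))" .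
  next
    show "AE x in lebesgue_on \<Omega>. u x - z x \<le> u x - v x + \<epsilon>" using zv by eventually_elim linarith
    show "AE x in lebesgue_on \<Omega>. 0 < u x - v x \<longrightarrow> e x (v x) - e x (u x) \<le> 0"
      using ae by eventually_elim (auto intro: monoD)
  qed (use \<epsilon> R in auto)
  with upper zv show ?thesis unfolding \<epsilon>_def by eventually_elim (simp add: abs_le_iff)
qed

text \<open>The continuous \<open>u\<close> is its own companion, with
  \<open>\<epsilon> = 0\<close>. Where \<open>u\<close> is positive, monotonicity keeps the source
  \<open>f x - e x (u x)\<close> below \<open>F + E\<close>, and the quadratic inside the maximum
  principle plays the supersolution; \<open>- u\<close> is treated in the same way. The bound
  involves \<open>e\<close> only at 0, whatever the truncation level.\<close>

lemma weak_solution_bounded: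
  assumes R: "\<And>x. x \<in> \<Omega> \<Longrightarrow> norm x \<le> R"
    and e: "bounded_monotone D e"
    and f: "f \<in> borel_measurable (lebesgue_on \<Omega>)" "AE x in lebesgue_on \<Omega>. \<bar>f x\<bar> \<le> F"
    and e0: "AE x in lebesgue_on \<Omega>. \<bar>e x 0\<bar> \<le> E" and FE: "0 \<le> F" "0 \<le> E"
    and u: "u \<in> C0 \<Omega>" "galerkin_solution \<Omega> (H10 \<Omega>) e f u"
    and x: "x \<in> \<Omega>"
  shows "\<bar>u x\<bar> \<le> (F + E) / 2 * R\<^sup>2"
proof -
  have ae: "AE x in lebesgue_on \<Omega>. mono (e x) \<and> continuous_on UNIV (e x) \<and> (\<forall>s. \<bar>e x s\<bar> \<le> D)"
    using e by (simp add: bounded_monotone_def)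
  have uH: "u \<in> H10 \<Omega>" using u(2) by (simp add: galerkin_solution_def)
  note uH1 = H10_D(1)[OF uH]
  have fL: "f \<in> L2 \<Omega>" by (rule L2_bounded[OF lmeasurable_domain f(1), of F]) (use f(2) in simp)
  note euL = superposition_L2[OF e L2_D(1)[OF H10_D(2)[OF uH]]]
  have li: "locally_integrable \<Omega> (\<lambda>x. p x - q x)" if "p \<in> L2 \<Omega>" "q \<in> L2 \<Omega>" for p q :: "'a \<Rightarrow> real"
    by (rule L2_locally_integrable[OF L2_diff[OF that]])
  have uc: "continuous_on (closure \<Omega>) u" "\<And>x. x \<in> frontier \<Omega> \<Longrightarrow> u x = 0" using u(1) by (auto simp: C0_def)
  have en: "energy u \<phi> = (LINT y|lebesgue_on \<Omega>. \<phi> y * (f y - e y (u y)))" if \<phi>: "\<phi> \<in> test_functions \<Omega>" for \<phi>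
  proof -
    note \<phi>H = test_H10[OF \<phi>]
    have "energy u \<phi> = L2_inner \<Omega> f \<phi> - L2_inner \<Omega> (\<lambda>x. e x (u x)) \<phi>"
      using u(2) \<phi>H unfolding galerkin_solution_def by (smt (verit))
    also have "\<dots> = L2_inner \<Omega> (\<lambda>x. f x - e x (u x)) \<phi>"
      by (rule L2_inner_diff_left[OF fL euL H10_D(2)[OF \<phi>H], symmetric])
    finally show ?thesis by (simp add: L2_inner_def mult.commute)
  qed
  have "AE x in lebesgue_on \<Omega>. u x \<le> 0 + (F + E) / 2 * R\<^sup>2"
  proof (rule weak_max_principle[OF uH1 li[OF fL euL] en uc(1)])
    show "AE x in lebesgue_on \<Omega>. 0 < u x \<longrightarrow> f x - e x (u x) \<le> F + E"
      using ae f(2) e0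
    proof eventually_elim
      fix x assume a: "mono (e x) \<and> continuous_on UNIV (e x) \<and> (\<forall>s. \<bar>e x s\<bar> \<le> D)" "\<bar>f x\<bar> \<le> F" "\<bar>e x 0\<bar> \<le> E"
      have "e x 0 \<le> e x (u x)" if "0 < u x" using a(1) that by (auto intro: monoD)
      then show "0 < u x \<longrightarrow> f x - e x (u x) \<le> F + E" using a(2,3) by fastforce
    qed
  qed (use uc FE R in auto)
  from continuous_AE_le[OF continuous_on_subset[OF uc(1) closure_subset] this x]
  have 1: "u x \<le> (F + E) / 2 * R\<^sup>2" by (simp only: add_0)
  have "AE x in lebesgue_on \<Omega>. - u x \<le> 0 + (F + E) / 2 * R\<^sup>2"
  proof (rule weak_max_principle[OF _ li[OF euL fL]])
    \<comment> \<open>The zero function is written as \<open>u - u\<close>, so that the negative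
      becomes a linear combination.\<close>
    show "(\<lambda>x. - u x) \<in> H1 \<Omega>"
      using H1_lincomb(1)[OF H10_D(1)[OF H10_diff[OF uH uH]] uH1, of "-1"] by simp
    fix \<phi> assume \<phi>: "\<phi> \<in> test_functions \<Omega>"
    note \<phi>1 = test_H1[OF \<phi>]
    have "energy (\<lambda>x. u x - u x) \<phi> = 0" using energy_lincomb_left[OF uH1 uH1 \<phi>1, of "-1"] by simp
    then have "energy (\<lambda>x. - u x) \<phi> = - energy u \<phi>"
      using energy_lincomb_left[OF H10_D(1)[OF H10_diff[OF uH uH]] uH1 \<phi>1, of "-1"] by simp
    then show "energy (\<lambda>x. - u x) \<phi> = (LINT y|lebesgue_on \<Omega>. \<phi> y * (e y (u y) - f y))"
      unfolding en[OF \<phi>] by (simp add: algebra_simps flip: Bochner_Integration.integral_minus)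
  next
    show "AE x in lebesgue_on \<Omega>. 0 < - u x \<longrightarrow> e x (u x) - f x \<le> F + E"
      using ae f(2) e0
    proof eventually_elim
      fix x assume a: "mono (e x) \<and> continuous_on UNIV (e x) \<and> (\<forall>s. \<bar>e x s\<bar> \<le> D)" "\<bar>f x\<bar> \<le> F" "\<bar>e x 0\<bar> \<le> E"
      have "e x (u x) \<le> e x 0" if "0 < - u x" using a(1) that by (auto intro: monoD)
      then show "0 < - u x \<longrightarrow> e x (u x) - f x \<le> F + E" using a(2,3) by fastforce
    qed
    show "continuous_on (closure \<Omega>) (\<lambda>x. - u x)" using uc(1) by (rule continuous_on_minus)
  qed (use uc FE R in auto)
  from continuous_AE_le[OF continuous_on_minus[OF continuous_on_subset[OF uc(1) closure_subset]] this x]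
  have "- u x \<le> (F + E) / 2 * R\<^sup>2" by (simp only: add_0)
  with 1 show ?thesis by (simp only: abs_le_iff)
qed

end

text \<open>One power of \<open>h\<close> pays for the logarithm; in the error bound
  \<open>h powr \<gamma>\<close> is then left to produce smallness.\<close>

lemma mult_abs_ln_le_1:
  fixes h :: real
  assumes "0 < h" "h < 1" shows "h * \<bar>ln h\<bar> \<le> 1"
proof -
  have "ln (inverse h) \<le> inverse h - 1" using assms by (intro ln_le_minus_one) simp
  then have "\<bar>ln h\<bar> \<le> inverse h - 1" using assms by (simp add: ln_inverse)
  then have "h * \<bar>ln h\<bar> \<le> h * (inverse h - 1)" using assms by (intro mult_left_mono) auto
  also have "\<dots> = 1 - h" using assms by (simp add: right_diff_distrib)
  finally show ?thesis using assms by simp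
qed

text \<open>All constants are fixed before the mesh, \<open>f\<close> and the solutions are
  introduced. The threshold \<open>h0\<close> separates fine from coarse meshes; each case has its
  own truncation level and its own bound for the truncated \<open>d\<close>.\<close>

lemma semilinear_max_norm_error:
  fixes \<Omega> :: "'a::euclidean_space set" and d :: "'a \<Rightarrow> real \<Rightarrow> real"
  assumes dom: "convex_polytopal_domain \<Omega>" and rexp: "ritz_exponent \<Omega> \<gamma>\<^sub>\<Omega>"
    and \<gamma>: "0 < \<gamma>" "\<gamma> < \<gamma>\<^sub>\<Omega>" and hmax: "0 < h_max" "h_max < 1"
    and A1: "assm_A1 \<Omega> d" and A2: "assm_A2 \<Omega> d" and A3: "assm_A3 \<Omega> d"
  shows "\<exists>c>0. \<forall>\<T>\<in>mesh_family \<Omega> h_max \<sigma> \<kappa>. \<forall>f\<in>Linf \<Omega>. \<forall>u u\<^sub>h.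
           Linf_norm \<Omega> f = ereal F \<and>
           u \<in> C0 \<Omega> \<and> galerkin_solution \<Omega> (H10 \<Omega>) d f u \<and>
           galerkin_solution \<Omega> (Vh \<Omega> \<T>) d f u\<^sub>h \<longrightarrow>
           Linf_norm \<Omega> (\<lambda>x. u x - u\<^sub>h x)
             \<le> ereal (c * mesh_size \<T> powr (1 + \<gamma>) * \<bar>ln (mesh_size \<T>)\<bar>)"
proof -
  have clos: "polytope (closure \<Omega>)" and \<Omega>: "open \<Omega>" "convex \<Omega>" "\<Omega> \<noteq> {}"
    using dom by (auto simp: convex_polytopal_domain_def)
  interpret convex_domain \<Omega>
  proof
    show "bounded \<Omega>" using polytope_imp_bounded[OF clos] closure_subset bounded_subset by blast
  qed (use \<Omega> in auto)
  obtain R where R: "\<And>x. x \<in> \<Omega> \<Longrightarrow> norm x \<le> R" using bounded_domain unfolding bounded_iff by blast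
  obtain CP where CP: "CP > 0" "\<And>v. v \<in> H10 \<Omega> \<Longrightarrow> L2_sq \<Omega> v \<le> CP * energy v v" by (rule Poincare) blast
  \<comment> \<open>\<open>F\<close> is a free real until it is equated with a norm, so its sign is
    still open here.\<close>
  define F' where "F' = max F 0"
  have F': "0 \<le> F'" by (simp add: F'_def)
  have "(\<lambda>x. d x 0) \<in> Linf \<Omega>" using A1 by (simp add: assm_A1_def)
  then obtain E where E: "0 \<le> E" "AE x in lebesgue_on \<Omega>. \<bar>d x 0\<bar> \<le> E" by (rule Linf_bounded)
  obtain c where c: "c > 0" "\<And>\<T> v w r. \<lbrakk>\<T> \<in> mesh_family \<Omega> h_max \<sigma> \<kappa>; v \<in> H10 \<Omega>; w \<in> Linf \<Omega>;
      has_weak_laplacian \<Omega> v w; is_ritz_projection \<Omega> \<T> v r\<rbrakk> \<Longrightarrow>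
      Linf_norm \<Omega> (\<lambda>x. v x - r x) \<le> ereal (c * mesh_size \<T> powr (1 + \<gamma>) * \<bar>ln (mesh_size \<T>)\<bar>) * Linf_norm \<Omega> w"
  proof -
    have "\<exists>c>0. \<forall>\<T>\<in>mesh_family \<Omega> h_max \<sigma> \<kappa>. \<forall>v\<in>H10 \<Omega>. \<forall>w\<in>Linf \<Omega>. \<forall>r.
          has_weak_laplacian \<Omega> v w \<and> is_ritz_projection \<Omega> \<T> v r \<longrightarrow>
          Linf_norm \<Omega> (\<lambda>x. v x - r x)
            \<le> ereal (c * mesh_size \<T> powr (1 + \<gamma>) * \<bar>ln (mesh_size \<T>)\<bar>) * Linf_norm \<Omega> w"
      using rexp \<gamma> hmax unfolding ritz_exponent_def by blast
    then show ?thesis using that by blast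
  qed
  \<comment> \<open>The a priori bound on \<open>u\<close> plus 1; the extra 1 is room for the
    discretization error on fine meshes.\<close>
  define M0 where "M0 = (F' + E) / 2 * R\<^sup>2 + 1"
  have M0: "1 \<le> M0" using F' E(1) by (simp add: M0_def)
  obtain D0 where D0: "0 \<le> D0" "bounded_monotone D0 (truncation M0 d)"
    using bounded_monotone_truncation[OF A1 A2 A3, of M0] M0 by auto
  \<comment> \<open>\<open>h0\<close> is chosen so that \<open>h0 powr \<gamma> * G = 1\<close>,
    which makes the error bound \<open>2 * (k * (F' + D0))\<close> at most 1 for
    \<open>h < h0\<close>. The added 1 keeps \<open>G\<close> positive.\<close>
  define G where "G = 2 * c * (F' + D0) + 1"
  have G: "1 \<le> G" using c(1) F' D0(1) by (simp add: G_def)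
  define h0 where "h0 = (1 / G) powr (1 / \<gamma>)"
  have h0: "0 < h0" using G by (simp add: h0_def)
  obtain CI where CI: "0 < CI" "\<And>\<T> v x. simplicial_mesh \<Omega> \<T> \<Longrightarrow> shape_regular \<sigma> \<T> \<Longrightarrow> quasi_uniform \<kappa> \<T> \<Longrightarrow>
    h0 \<le> mesh_size \<T> \<Longrightarrow> v \<in> Vh \<Omega> \<T> \<Longrightarrow> x \<in> closure \<Omega> \<Longrightarrow> (v x)\<^sup>2 \<le> CI * energy v v"
    using inverse_estimate[OF h0, of \<sigma> \<kappa>] by auto
  \<comment> \<open>A bound on \<open>u\<^sub>h\<close> for \<open>h \<ge> h0\<close> from the
    inverse estimate and the energy bound, raised to at least \<open>M0\<close> so that this
    truncation leaves \<open>u\<close> unchanged as well.\<close>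
  define M1 where "M1 = max M0 (sqrt (CI * (CP * ((F' + E)\<^sup>2 * measure lebesgue \<Omega>))))"
  have M1: "M0 \<le> M1" "0 \<le> M1" using M0 by (auto simp: M1_def)
  obtain D1 where D1: "0 \<le> D1" "bounded_monotone D1 (truncation M1 d)"
    using bounded_monotone_truncation[OF A1 A2 A3 M1(2)] by auto
  \<comment> \<open>Covers the bounds \<open>D0\<close> and \<open>D1\<close> of both cases; the
    added 1 ensures positivity.\<close>
  define c' where "c' = 2 * c * (F' + D0 + D1 + 1)"
  have c': "0 < c'" using c(1) F' D0(1) D1(1) by (simp add: c'_def)
  show ?thesis
  proof (rule exI[of _ c'], intro conjI ballI allI impI c', elim conjE)
    fix \<T> f u u\<^sub>h
    assume \<T>: "\<T> \<in> mesh_family \<Omega> h_max \<sigma> \<kappa>" and f: "f \<in> Linf \<Omega>" and fF: "Linf_norm \<Omega> f = ereal F"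
      and u: "u \<in> C0 \<Omega>" "galerkin_solution \<Omega> (H10 \<Omega>) d f u"
      and uh: "galerkin_solution \<Omega> (Vh \<Omega> \<T>) d f u\<^sub>h"
    define h where "h = mesh_size \<T>"
    have mesh: "simplicial_mesh \<Omega> \<T>" "shape_regular \<sigma> \<T>" "quasi_uniform \<kappa> \<T>" and hm: "h \<le> h_max"
      using \<T> by (auto simp: mesh_family_def h_def)
    have h: "0 < h" "h < 1"
      using mesh_size_pos[OF mesh(1) \<Omega>(3) bounded_domain] hm hmax by (auto simp: h_def)
    define k where "k = c * h powr (1 + \<gamma>) * \<bar>ln h\<bar>"
    have k: "0 \<le> k" using c(1) by (simp add: k_def)
    note ritz = c(2)[OF \<T>, folded h_def, folded k_def]
    have fm: "f \<in> borel_measurable (lebesgue_on \<Omega>)" using f by (simp add: Linf_def)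
    have fb: "AE x in lebesgue_on \<Omega>. \<bar>f x\<bar> \<le> F'"
      by (rule Linf_norm_leD) (simp add: fF F'_def)
    have fL: "f \<in> L2 \<Omega>" by (rule L2_bounded[OF lmeasurable_domain fm, of F']) (use fb in simp)
    have V: "Vh \<Omega> \<T> \<subseteq> H10 \<Omega>" using Vh_D(1) by blast
    have uhV: "u\<^sub>h \<in> Vh \<Omega> \<T>" using uh by (simp add: galerkin_solution_def)
    have um: "(\<lambda>x. u x - u\<^sub>h x) \<in> borel_measurable (lebesgue_on \<Omega>)"
      by (intro borel_measurable_diff C0_measurable u(1) Vh_D(2)[OF uhV])
    have at0: "AE x in lebesgue_on \<Omega>. \<bar>truncation M d x 0\<bar> \<le> E" if "0 \<le> M" for M
      using E(2) by eventually_elim (use that in \<open>simp add: truncation_eq\<close>)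
    obtain Bu where Bu: "0 \<le> Bu" "\<And>x. x \<in> closure \<Omega> \<Longrightarrow> \<bar>u x\<bar> \<le> Bu"
      by (rule C0_bounded[OF u(1) bounded_domain]) blast
    obtain Bh where Bh: "0 \<le> Bh" "\<And>x. x \<in> closure \<Omega> \<Longrightarrow> \<bar>u\<^sub>h x\<bar> \<le> Bh"
      by (rule C0_bounded[OF Vh_D(2)[OF uhV] bounded_domain]) blast
    \<comment> \<open>Truncation at a bound \<open>Bu\<close> of \<open>u\<close> itself makes the
      nonlinearity bounded and keeps \<open>u\<close> a solution. The resulting estimate sees
      \<open>d\<close> only through \<open>E\<close>, so \<open>Bu\<close> drops out again.\<close>
    have uM: "\<bar>u x\<bar> \<le> M0 - 1" if x: "x \<in> \<Omega>" for x
    proof -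
      obtain D where D: "0 \<le> D" "bounded_monotone D (truncation Bu d)"
        by (rule bounded_monotone_truncation[OF A1 A2 A3 Bu(1)]) blast
      have "galerkin_solution \<Omega> (H10 \<Omega>) (truncation Bu d) f u"
        using u(2) Bu(2) closure_subset by (subst galerkin_solution_truncation) auto
      from weak_solution_bounded[OF R D(2) fm fb at0[OF Bu(1)] F' E(1) u(1) this x]
      show ?thesis by (simp add: M0_def)
    qed
    have ut: "galerkin_solution \<Omega> (H10 \<Omega>) (truncation M d) f u" if "M0 \<le> M" for M
      using u(2) uM that by (subst galerkin_solution_truncation) (fastforce+)
    have goal: "Linf_norm \<Omega> (\<lambda>x. u x - u\<^sub>h x) \<le> ereal (c' * h powr (1 + \<gamma>) * \<bar>ln h\<bar>)"
      if ae: "AE x in lebesgue_on \<Omega>. \<bar>u x - u\<^sub>h x\<bar> \<le> 2 * (k * B)" and B: "B \<le> F' + D0 + D1 + 1" for B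
    proof (rule Linf_norm_leI[OF um])
      have "2 * (k * B) \<le> 2 * (k * (F' + D0 + D1 + 1))" using k B by (intro mult_left_mono) auto
      also have "\<dots> = c' * h powr (1 + \<gamma>) * \<bar>ln h\<bar>" by (simp add: k_def c'_def)
      finally show "AE x in lebesgue_on \<Omega>. \<bar>u x - u\<^sub>h x\<bar> \<le> c' * h powr (1 + \<gamma>) * \<bar>ln h\<bar>"
        using ae by (auto elim: eventually_mono)
    qed
    have "Linf_norm \<Omega> (\<lambda>x. u x - u\<^sub>h x) \<le> ereal (c' * h powr (1 + \<gamma>) * \<bar>ln h\<bar>)"
    proof (cases "h0 \<le> h")
      case True
      have uhM: "\<bar>u\<^sub>h x\<bar> \<le> M1" if x: "x \<in> \<Omega>" for x
      proof -
        \<comment> \<open>The same device for \<open>u\<^sub>h\<close> with its own bound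
          \<open>Bh\<close>, which is likewise absent from the energy bound.\<close>
        obtain D where D: "0 \<le> D" "bounded_monotone D (truncation Bh d)"
          by (rule bounded_monotone_truncation[OF A1 A2 A3 Bh(1)]) blast
        have g: "galerkin_solution \<Omega> (Vh \<Omega> \<T>) (truncation Bh d) f u\<^sub>h"
          using uh Bh(2) closure_subset by (subst galerkin_solution_truncation) auto
        have "energy u\<^sub>h u\<^sub>h \<le> CP * L2_sq \<Omega> (\<lambda>x. f x - truncation Bh d x 0)"
          by (rule galerkin_energy_le[OF D(2) fL less_imp_le[OF CP(1)] CP(2) V g])
        also have "\<dots> \<le> CP * ((F' + E)\<^sup>2 * measure lebesgue \<Omega>)"
        proof (rule mult_left_mono)
          interpret finite_measure "lebesgue_on \<Omega>" by (rule finite_measure_lebesgue_on[OF lmeasurable_domain])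
          have "L2_sq \<Omega> (\<lambda>x. f x - truncation Bh d x 0) \<le> (LINT x|lebesgue_on \<Omega>. (F' + E)\<^sup>2)"
          proof (rule integral_mono_AE)
            show "integrable (lebesgue_on \<Omega>) (\<lambda>x. (norm (f x - truncation Bh d x 0))\<^sup>2)"
              by (intro L2_D(2) L2_diff fL superposition_L2[OF D(2)] borel_measurable_const)
            show "AE x in lebesgue_on \<Omega>. (norm (f x - truncation Bh d x 0))\<^sup>2 \<le> (F' + E)\<^sup>2"
              using fb at0[OF Bh(1)]
            proof eventually_elim
              fix x assume "\<bar>f x\<bar> \<le> F'" "\<bar>truncation Bh d x 0\<bar> \<le> E"
              then have "norm (f x - truncation Bh d x 0) \<le> F' + E" by simp
              then show "(norm (f x - truncation Bh d x 0))\<^sup>2 \<le> (F' + E)\<^sup>2" by (intro power_mono) auto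
            qed
          qed simp
          then show "L2_sq \<Omega> (\<lambda>x. f x - truncation Bh d x 0) \<le> (F' + E)\<^sup>2 * measure lebesgue \<Omega>"
            by (simp add: measure_restrict_space mult.commute)
        qed (use CP(1) in simp)
        finally have en: "energy u\<^sub>h u\<^sub>h \<le> CP * ((F' + E)\<^sup>2 * measure lebesgue \<Omega>)" .
        have "(u\<^sub>h x)\<^sup>2 \<le> CI * energy u\<^sub>h u\<^sub>h"
          using x closure_subset by (intro CI(2)[OF mesh True[unfolded h_def] uhV]) blast
        also have "\<dots> \<le> CI * (CP * ((F' + E)\<^sup>2 * measure lebesgue \<Omega>))"
          using CI(1) en by (intro mult_left_mono) auto
        finally have "\<bar>u\<^sub>h x\<bar> \<le> sqrt (CI * (CP * ((F' + E)\<^sup>2 * measure lebesgue \<Omega>)))"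
          using real_sqrt_le_mono by fastforce
        then show ?thesis by (simp add: M1_def)
      qed
      have "galerkin_solution \<Omega> (Vh \<Omega> \<T>) (truncation M1 d) f u\<^sub>h"
        using uh uhM by (subst galerkin_solution_truncation) auto
      from galerkin_error[OF ritz k D1(2) fm fb F' D1(1) u(1) ut[OF M1(1)] this]
      have "AE x in lebesgue_on \<Omega>. \<bar>u x - u\<^sub>h x\<bar> \<le> 2 * (k * (F' + D1))" .
      then show ?thesis by (rule goal) (use D0(1) in simp)
    next
      case False
      have small: "2 * (k * (F' + D0)) \<le> 1"
      proof -
        have "h powr \<gamma> \<le> h0 powr \<gamma>" using False h(1) \<gamma>(1) by (intro powr_mono2) auto
        also have "\<dots> = 1 / G" using \<gamma>(1) G by (simp add: h0_def powr_powr)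
        finally have hG: "h powr \<gamma> * G \<le> 1" using G by (simp add: field_simps)
        \<comment> \<open>\<open>h powr (1 + \<gamma>)\<close> splits: one power of \<open>h\<close>
          pays for the logarithm, the remaining \<open>h powr \<gamma>\<close> is at most
          \<open>1 / G\<close>.\<close>
        have "2 * (k * (F' + D0)) = (h powr \<gamma> * (2 * c * (F' + D0))) * (h * \<bar>ln h\<bar>)"
          using h(1) by (simp add: k_def powr_add)
        also have "\<dots> \<le> (h powr \<gamma> * (2 * c * (F' + D0))) * 1"
          using c(1) F' D0(1) by (intro mult_left_mono mult_abs_ln_le_1 h) auto
        also have "\<dots> \<le> h powr \<gamma> * G" by (simp add: G_def distrib_left)
        finally show ?thesis using hG by simp
      qed
      obtain v where v: "galerkin_solution \<Omega> (Vh \<Omega> \<T>) (truncation M0 d) f v"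
        by (rule galerkin_solvable[OF energy_complete_Vh[OF mesh] D0(2) fL]) blast
      then have vV: "v \<in> Vh \<Omega> \<T>" by (simp add: galerkin_solution_def)
      have uv: "AE x in lebesgue_on \<Omega>. \<bar>u x - v x\<bar> \<le> 2 * (k * (F' + D0))"
        by (rule galerkin_error[OF ritz k D0(2) fm fb F' D0(1) u(1) ut[OF order_refl] v])
      have vM: "\<bar>v x\<bar> \<le> M0" if x: "x \<in> \<Omega>" for x
      proof -
        \<comment> \<open>Removing the truncation needs the bound at every point of
          \<open>\<Omega>\<close>; continuity upgrades the estimate almost everywhere.\<close>
        have "continuous_on \<Omega> (\<lambda>x. \<bar>u x - v x\<bar>)"
          using u(1) Vh_D(2)[OF vV] unfolding C0_def
          by (auto intro!: continuous_intros intro: continuous_on_subset[OF _ closure_subset])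
        from continuous_AE_le[OF this uv x] have "\<bar>u x - v x\<bar> \<le> 1" using small by linarith
        then show ?thesis using uM[OF x] by linarith
      qed
      have vd: "galerkin_solution \<Omega> (Vh \<Omega> \<T>) d f v"
        using v galerkin_solution_truncation[of v M0] vM by blast
      \<comment> \<open>A level above both \<open>v\<close> and \<open>u\<^sub>h\<close>: there both
        solve the same bounded problem, to which uniqueness applies.\<close>
      define M2 where "M2 = max M0 Bh"
      have M2: "0 \<le> M2" using M0 by (simp add: M2_def)
      obtain D2 where D2: "0 \<le> D2" "bounded_monotone D2 (truncation M2 d)"
        by (rule bounded_monotone_truncation[OF A1 A2 A3 M2]) blast
      have v2: "galerkin_solution \<Omega> (Vh \<Omega> \<T>) (truncation M2 d) f v"
        using vd vM by (subst galerkin_solution_truncation) (auto simp: M2_def intro!: max.coboundedI1)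
      have uh2: "galerkin_solution \<Omega> (Vh \<Omega> \<T>) (truncation M2 d) f u\<^sub>h"
        using uh Bh(2) closure_subset
        by (subst galerkin_solution_truncation) (auto simp: M2_def intro!: max.coboundedI2)
      have "AE x in lebesgue_on \<Omega>. v x = u\<^sub>h x"
        by (rule galerkin_unique[OF V Vh_lincomb D2(2) fL v2 uh2])
      then have "AE x in lebesgue_on \<Omega>. \<bar>u x - u\<^sub>h x\<bar> \<le> 2 * (k * (F' + D0))"
        using uv by eventually_elim simp
      then show ?thesis by (rule goal) (use D1(1) in simp)
    qed
    then show "Linf_norm \<Omega> (\<lambda>x. u x - u\<^sub>h x)
             \<le> ereal (c' * mesh_size \<T> powr (1 + \<gamma>) * \<bar>ln (mesh_size \<T>)\<bar>)"
      by (simp add: h_def)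
  qed
qed

text \<open>\<open>F\<close> is fixed before \<open>c\<close> while \<open>f\<close> ranges over all
  functions of that norm; in this way the constant depends on \<open>f\<close> through its norm
  only. It is uniform over all meshes that share \<open>h_max\<close>, \<open>\<sigma>\<close> and
  \<open>\<kappa>\<close>, hence independent of \<open>h\<close>.\<close>

theorem corollary4p6:
  fixes \<Omega> :: "(real ^ 'n) set"
    and d :: "real ^ 'n \<Rightarrow> real \<Rightarrow> real"
    and \<gamma>\<^sub>\<Omega> \<gamma> h_max \<sigma> \<kappa> F :: real
  assumes "CARD('n) = 2 \<or> CARD('n) = 3"
    and "convex_polytopal_domain \<Omega>"
    and "ritz_exponent \<Omega> \<gamma>\<^sub>\<Omega>"
    and "0 < \<gamma>" and "\<gamma> < \<gamma>\<^sub>\<Omega>"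
    and "0 < h_max" and "h_max < 1"
    and "assm_A1 \<Omega> d" and "assm_A2 \<Omega> d" and "assm_A3 \<Omega> d"
  shows "\<exists>c>0. \<forall>\<T>\<in>mesh_family \<Omega> h_max \<sigma> \<kappa>. \<forall>f\<in>Linf \<Omega>. \<forall>u u\<^sub>h.
           Linf_norm \<Omega> f = ereal F \<and>
           u \<in> C0 \<Omega> \<and> galerkin_solution \<Omega> (H10 \<Omega>) d f u \<and>
           galerkin_solution \<Omega> (Vh \<Omega> \<T>) d f u\<^sub>h \<longrightarrow>
           Linf_norm \<Omega> (\<lambda>x. u x - u\<^sub>h x)
             \<le> ereal (c * mesh_size \<T> powr (1 + \<gamma>) * \<bar>ln (mesh_size \<T>)\<bar>)"
  by (rule semilinear_max_norm_error[OF assms(2-)])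

end
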